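(* Let $\mathbf{K}$ be an abstract elementary class and let $\lambda\geq\operatorname{LS}(\mathbf{K})$. If $\mathbf{K}$ has amalgamation in $\lambda$, has no maximal model in $\lambda$, is stable in $\lambda$, and splitting is continuous in $\lambda$, then $\mathbf{K}$ has a model of cardinality $\lambda^{++}$.
   Context: $\mathbf{K}_\lambda$ denotes the models of $\mathbf{K}$ of cardinality $\lambda$; $\mathbf{S}(M)$ is the set of Galois (orbital) types over $M$, and $\mathbf{S}^{na}(M)$ the non-algebraic ones. $\mathbf{K}$ has amalgamation in $\lambda$ if any two $\leq_{\mathbf{K}}$-extensions in $\mathbf{K}_\lambda$ of a model in $\mathbf{K}_\lambda$ can be $\mathbf{K}$-embedded over it into a common model; no maximal model in $\lambda$ means every model in $\mathbf{K}_\lambda$ has a proper extension in $\mathbf{K}_\lambda$. $\mathbf{K}$ is stable in $\lambda$ if $|\mathbf{S}(M)|\leq\lambda$ for all $M\in\mathbf{K}_\lambda$. For $M\leq_{\mathbf{K}}N$ both of cardinality $\mu$, $N$ is universal over $M$ if every $N^*\in\mathbf{K}_\mu$ with $M\leq_{\mathbf{K}}N^*$ admits a $\mathbf{K}$-embedding $N^*\to N$ fixing $M$. For $M\in\mathbf{K}_\lambda$, $M\leq_{\mathbf{K}}N$ and $p\in\mathbf{S}(N)$, $p$ splits over $M$ if there are $N_1,N_2\in\mathbf{K}_\lambda$ with $M\leq_{\mathbf{K}}N_1,N_2\leq_{\mathbf{K}}N$ and an isomorphism $h:N_1\cong N_2$ fixing $M$ with $h(p\restriction N_1)\neq p\restriction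 N_2$. Splitting is continuous in $\lambda$ if for every limit ordinal $\delta<\lambda^+$ and every increasing continuous chain $\langle M_i : i\leq\delta\rangle$ in $\mathbf{K}_\lambda$ with $M_{i+1}$ universal over $M_i$ for all $i<\delta$, if $p\in\mathbf{S}^{na}(M_\delta)$ and $p\restriction M_i$ does not split over $M_0$ for all $i<\delta$, then $p$ does not split over $M_0$.
   Formalization: The formal theorem also assumes that K has a model of cardinality λ (for the empty class the claim fails), and takes K as a class of structures whose universes lie in a fixed arbitrary set of size at least λ⁺⁺, to which any AEC can be restricted by Löwenheim–Skolem. *)

theory Defs
  imports Main
begin

unbundle cardinal_syntax

text \<open>
  The type \<open>'a\<close> plays the role of the universe of sets: carriers of structures are sets of elements
  of \<open>'a\<close>, and a cardinal is a relation satisfying \<open>Card_order\<close>, compared by \<open>\<le>o\<close> and \<open>=o\<close>.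
\<close>

section \<open>Structures in a finitary vocabulary\<close>

record ('f, 'r) vocabulary =
  funs :: "'f set"
  rels :: "'r set"
  far :: "'f \<Rightarrow> nat"
  rar :: "'r \<Rightarrow> nat"

record ('a, 'f, 'r) struct =
  carrier :: "'a set"
  fint :: "'f \<Rightarrow> 'a list \<Rightarrow> 'a"
  rint :: "'r \<Rightarrow> 'a list set"

definition tuples :: "nat \<Rightarrow> 'a set \<Rightarrow> 'a list set" where
  "tuples n A = {xs. length xs = n \<and> set xs \<subseteq> A}"

text \<open>
  Interpretations are made canonical outside their proper domain, so that equality of records is
  equality of structures.
\<close>

definition is_struct :: "('f, 'r) vocabulary \<Rightarrow> ('a, 'f, 'r) struct \<Rightarrow> bool" where
  "is_struct L M \<longleftrightarrow>
     carrier M \<noteq> {} \<and>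
     (\<forall>f\<in>funs L. \<forall>xs\<in>tuples (far L f) (carrier M). fint M f xs \<in> carrier M) \<and>
     (\<forall>f xs. \<not> (f \<in> funs L \<and> xs \<in> tuples (far L f) (carrier M)) \<longrightarrow> fint M f xs = undefined) \<and>
     (\<forall>R\<in>rels L. rint M R \<subseteq> tuples (rar L R) (carrier M)) \<and>
     (\<forall>R. R \<notin> rels L \<longrightarrow> rint M R = {})"

definition substruct ::
    "('f, 'r) vocabulary \<Rightarrow> ('a, 'f, 'r) struct \<Rightarrow> ('a, 'f, 'r) struct \<Rightarrow> bool" where
  "substruct L M N \<longleftrightarrow>
     is_struct L M \<and> is_struct L N \<and> carrier M \<subseteq> carrier N \<and>
     (\<forall>f\<in>funs L. \<forall>xs\<in>tuples (far L f) (carrier M). fint M f xs = fint N f xs) \<and>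
     (\<forall>R\<in>rels L. rint M R = rint N R \<inter> tuples (rar L R) (carrier M))"

definition struct_iso ::
    "('f, 'r) vocabulary \<Rightarrow> ('a \<Rightarrow> 'a) \<Rightarrow> ('a, 'f, 'r) struct \<Rightarrow> ('a, 'f, 'r) struct \<Rightarrow> bool" where
  "struct_iso L h M N \<longleftrightarrow>
     is_struct L M \<and> is_struct L N \<and> bij_betw h (carrier M) (carrier N) \<and>
     (\<forall>f\<in>funs L. \<forall>xs\<in>tuples (far L f) (carrier M). h (fint M f xs) = fint N f (map h xs)) \<and>
     (\<forall>R\<in>rels L. \<forall>xs\<in>tuples (rar L R) (carrier M). xs \<in> rint M R \<longleftrightarrow> map h xs \<in> rint N R)"

text \<open>
  The union of a chain of structures. The choice of \<open>M\<close> is immaterial when \<open>S\<close> is a chain under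
  \<open>substruct\<close>, and every finite tuple of the union then lies in some member of \<open>S\<close>.
\<close>

definition union_struct :: "('a, 'f, 'r) struct set \<Rightarrow> ('a, 'f, 'r) struct" where
  "union_struct S =
     \<lparr> carrier = (\<Union>M\<in>S. carrier M),
       fint = (\<lambda>f xs. if \<exists>M\<in>S. set xs \<subseteq> carrier M
                      then fint (SOME M. M \<in> S \<and> set xs \<subseteq> carrier M) f xs else undefined),
       rint = (\<lambda>R. \<Union>M\<in>S. rint M R) \<rparr>"

section \<open>Abstract elementary classes\<close>

record ('a, 'f, 'r) aclass =
  voc :: "('f, 'r) vocabulary"
  models :: "('a, 'f, 'r) struct set"
  le :: "('a, 'f, 'r) struct \<Rightarrow> ('a, 'f, 'r) struct \<Rightarrow> bool"

abbreviation le_syntax ::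
    "('a, 'f, 'r) struct \<Rightarrow> ('a, 'f, 'r) aclass \<Rightarrow> ('a, 'f, 'r) struct \<Rightarrow> bool"
    ("(_/ \<preceq>\<^bsub>_\<^esub> _)" [51, 0, 51] 50) where
  "M \<preceq>\<^bsub>K\<^esub> N \<equiv> le K M N"

definition LS_bound :: "('a, 'f, 'r) aclass \<Rightarrow> 'k rel \<Rightarrow> bool" where
  "LS_bound K \<kappa> \<longleftrightarrow>
     Card_order \<kappa> \<and>
     |funs (voc K) <+> rels (voc K)| +c natLeq \<le>o \<kappa> \<and>
     (\<forall>M\<in>models K. \<forall>A. A \<subseteq> carrier M \<longrightarrow>
        (\<exists>N. N \<preceq>\<^bsub>K\<^esub> M \<and> A \<subseteq> carrier N \<and> |carrier N| \<le>o |A| +c \<kappa> ))"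

definition LS :: "('a, 'f, 'r) aclass \<Rightarrow> 'a rel" where
  "LS K = (SOME \<kappa>. LS_bound K \<kappa> \<and> (\<forall>\<kappa>' :: 'a rel. LS_bound K \<kappa>' \<longrightarrow> \<kappa> \<le>o \<kappa>'))"

text \<open>
  A limit ordinal is given by a well-order \<open>r\<close> that is nonempty and has no last element. In the
  chain axioms below, well-orders on \<open>'a\<close> suffice: a strictly increasing chain of structures has
  strictly increasing carriers, so its length injects into \<open>'a\<close>.
\<close>

definition limit_order :: "'i rel \<Rightarrow> bool" where
  "limit_order r \<longleftrightarrow>
     Well_order r \<and> Field r \<noteq> {} \<and> (\<forall>i\<in>Field r. \<exists>j\<in>Field r. i \<in> underS r j)"

definition AEC :: "('a, 'f, 'r) aclass \<Rightarrow> bool" where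
  "AEC K \<longleftrightarrow>
     (\<forall>M\<in>models K. is_struct (voc K) M) \<and>
     (\<forall>M N. M \<preceq>\<^bsub>K\<^esub> N \<longrightarrow> M \<in> models K \<and> N \<in> models K \<and> substruct (voc K) M N) \<and>
     (\<forall>M\<in>models K. M \<preceq>\<^bsub>K\<^esub> M) \<and>
     (\<forall>M N. M \<preceq>\<^bsub>K\<^esub> N \<and> N \<preceq>\<^bsub>K\<^esub> M \<longrightarrow> M = N) \<and>
     (\<forall>M N P. M \<preceq>\<^bsub>K\<^esub> N \<and> N \<preceq>\<^bsub>K\<^esub> P \<longrightarrow> M \<preceq>\<^bsub>K\<^esub> P) \<and>
     (\<forall>h M M'. M \<in> models K \<and> struct_iso (voc K) h M M' \<longrightarrow> M' \<in> models K) \<and>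
     (\<forall>h M N M' N'. M \<preceq>\<^bsub>K\<^esub> N \<and> struct_iso (voc K) h N N' \<and> struct_iso (voc K) h M M' \<longrightarrow> M' \<preceq>\<^bsub>K\<^esub> N') \<and>
     (\<forall>M0 M1 M2. M0 \<preceq>\<^bsub>K\<^esub> M2 \<and> M1 \<preceq>\<^bsub>K\<^esub> M2 \<and> substruct (voc K) M0 M1 \<longrightarrow> M0 \<preceq>\<^bsub>K\<^esub> M1) \<and>
     (\<forall>(r :: 'a rel) M. limit_order r \<and> (\<forall>i j. (i, j) \<in> r \<longrightarrow> M i \<preceq>\<^bsub>K\<^esub> M j) \<longrightarrow>
        union_struct (M ` Field r) \<in> models K \<and>
        (\<forall>i\<in>Field r. M i \<preceq>\<^bsub>K\<^esub> union_struct (M ` Field r)) \<and>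
        (\<forall>N\<in>models K. (\<forall>i\<in>Field r. M i \<preceq>\<^bsub>K\<^esub> N) \<longrightarrow> union_struct (M ` Field r) \<preceq>\<^bsub>K\<^esub> N)) \<and>
     (\<exists>\<kappa> :: 'a rel. LS_bound K \<kappa>)"

definition models_of_card :: "('a, 'f, 'r) aclass \<Rightarrow> 'c rel \<Rightarrow> ('a, 'f, 'r) struct set" where
  "models_of_card K \<mu> = {M \<in> models K. |carrier M| =o \<mu>}"

definition K_embedding ::
    "('a, 'f, 'r) aclass \<Rightarrow> ('a \<Rightarrow> 'a) \<Rightarrow> ('a, 'f, 'r) struct \<Rightarrow> ('a, 'f, 'r) struct \<Rightarrow> bool" where
  "K_embedding K f M N \<longleftrightarrow> (\<exists>M'. struct_iso (voc K) f M M' \<and> M' \<preceq>\<^bsub>K\<^esub> N)"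

definition fixes_pointwise :: "('a \<Rightarrow> 'a) \<Rightarrow> ('a, 'f, 'r) struct \<Rightarrow> bool" where
  "fixes_pointwise f M \<longleftrightarrow> (\<forall>x\<in>carrier M. f x = x)"

definition amalgamation_in :: "('a, 'f, 'r) aclass \<Rightarrow> 'c rel \<Rightarrow> bool" where
  "amalgamation_in K \<mu> \<longleftrightarrow>
     (\<forall>M0\<in>models_of_card K \<mu>. \<forall>M1\<in>models_of_card K \<mu>. \<forall>M2\<in>models_of_card K \<mu>.
        M0 \<preceq>\<^bsub>K\<^esub> M1 \<and> M0 \<preceq>\<^bsub>K\<^esub> M2 \<longrightarrow>
        (\<exists>N\<in>models K. \<exists>f1 f2. K_embedding K f1 M1 N \<and> K_embedding K f2 M2 N \<and>
           fixes_pointwise f1 M0 \<and> fixes_pointwise f2 M0))"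

definition no_maximal_model_in :: "('a, 'f, 'r) aclass \<Rightarrow> 'c rel \<Rightarrow> bool" where
  "no_maximal_model_in K \<mu> \<longleftrightarrow>
     (\<forall>M\<in>models_of_card K \<mu>. \<exists>N\<in>models_of_card K \<mu>. M \<preceq>\<^bsub>K\<^esub> N \<and> M \<noteq> N)"

definition universal_over ::
    "('a, 'f, 'r) aclass \<Rightarrow> ('a, 'f, 'r) struct \<Rightarrow> ('a, 'f, 'r) struct \<Rightarrow> bool" where
  "universal_over K N M \<longleftrightarrow>
     M \<preceq>\<^bsub>K\<^esub> N \<and> |carrier N| =o |carrier M| \<and>
     (\<forall>N'\<in>models_of_card K |carrier M|. M \<preceq>\<^bsub>K\<^esub> N' \<longrightarrow>
        (\<exists>f. K_embedding K f N' N \<and> fixes_pointwise f M))"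

section \<open>Galois types\<close>

type_synonym ('a, 'f, 'r) triple = "'a \<times> ('a, 'f, 'r) struct \<times> ('a, 'f, 'r) struct"

definition triples :: "('a, 'f, 'r) aclass \<Rightarrow> ('a, 'f, 'r) triple set" where
  "triples K = {(a, M, N). M \<preceq>\<^bsub>K\<^esub> N \<and> a \<in> carrier N}"

definition E_at :: "('a, 'f, 'r) aclass \<Rightarrow> ('a, 'f, 'r) triple rel" where
  "E_at K = {((a1, M1, N1), (a2, M2, N2)).
     (a1, M1, N1) \<in> triples K \<and> (a2, M2, N2) \<in> triples K \<and> M1 = M2 \<and>
     (\<exists>N\<in>models K. \<exists>f1 f2. K_embedding K f1 N1 N \<and> K_embedding K f2 N2 N \<and>
        fixes_pointwise f1 M1 \<and> fixes_pointwise f2 M1 \<and> f1 a1 = f2 a2)}"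

text \<open>
  \<open>E_at K\<close> is reflexive and symmetric on \<open>triples K\<close>, so its transitive closure is an equivalence
  relation there.
\<close>

definition gtp :: "('a, 'f, 'r) aclass \<Rightarrow> 'a \<Rightarrow> ('a, 'f, 'r) struct \<Rightarrow> ('a, 'f, 'r) struct \<Rightarrow>
    ('a, 'f, 'r) triple set" where
  "gtp K a M N = (E_at K)\<^sup>+ `` {(a, M, N)}"

definition gS :: "('a, 'f, 'r) aclass \<Rightarrow> ('a, 'f, 'r) struct \<Rightarrow> ('a, 'f, 'r) triple set set" where
  "gS K M = {gtp K a M N | a N. M \<preceq>\<^bsub>K\<^esub> N \<and> a \<in> carrier N}"

definition gS_na :: "('a, 'f, 'r) aclass \<Rightarrow> ('a, 'f, 'r) struct \<Rightarrow> ('a, 'f, 'r) triple set set" where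
  "gS_na K M = {gtp K a M N | a N. M \<preceq>\<^bsub>K\<^esub> N \<and> a \<in> carrier N - carrier M}"

definition stable_in :: "('a, 'f, 'r) aclass \<Rightarrow> 'c rel \<Rightarrow> bool" where
  "stable_in K \<mu> \<longleftrightarrow> (\<forall>M\<in>models_of_card K \<mu>. |gS K M| \<le>o \<mu>)"

definition restrict_type :: "('a, 'f, 'r) aclass \<Rightarrow> ('a, 'f, 'r) triple set \<Rightarrow>
    ('a, 'f, 'r) struct \<Rightarrow> ('a, 'f, 'r) triple set" where
  "restrict_type K p M0 = (THE q. \<exists>a M N. (a, M, N) \<in> p \<and> q = gtp K a M0 N)"

text \<open>
  \<open>h(gtp(a/N\<^sub>1; N)) = gtp(h'(a)/N\<^sub>2; N')\<close>, where \<open>h : N\<^sub>1 \<cong> N\<^sub>2\<close> and \<open>h' : N \<cong> N'\<close> extends \<open>h\<close>.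
\<close>

definition map_type :: "('a, 'f, 'r) aclass \<Rightarrow> ('a \<Rightarrow> 'a) \<Rightarrow> ('a, 'f, 'r) struct \<Rightarrow>
    ('a, 'f, 'r) struct \<Rightarrow> ('a, 'f, 'r) triple set \<Rightarrow> ('a, 'f, 'r) triple set" where
  "map_type K h N1 N2 p =
     (THE q. \<exists>a N N' h'. (a, N1, N) \<in> p \<and> struct_iso (voc K) h' N N' \<and>
        (\<forall>x\<in>carrier N1. h' x = h x) \<and> q = gtp K (h' a) N2 N')"

section \<open>Splitting\<close>

text \<open>To be used for \<open>M\<close> in \<open>models_of_card K \<mu>\<close>, \<open>M \<preceq>\<^bsub>K\<^esub> N\<close> and \<open>p\<close> in \<open>gS K N\<close>.\<close>

definition splits_over :: "('a, 'f, 'r) aclass \<Rightarrow> 'c rel \<Rightarrow> ('a, 'f, 'r) triple set \<Rightarrow>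
    ('a, 'f, 'r) struct \<Rightarrow> ('a, 'f, 'r) struct \<Rightarrow> bool" where
  "splits_over K \<mu> p N M \<longleftrightarrow>
     (\<exists>N1\<in>models_of_card K \<mu>. \<exists>N2\<in>models_of_card K \<mu>. \<exists>h.
        M \<preceq>\<^bsub>K\<^esub> N1 \<and> N1 \<preceq>\<^bsub>K\<^esub> N \<and> M \<preceq>\<^bsub>K\<^esub> N2 \<and> N2 \<preceq>\<^bsub>K\<^esub> N \<and>
        struct_iso (voc K) h N1 N2 \<and> fixes_pointwise h M \<and>
        map_type K h N1 N2 (restrict_type K p N1) \<noteq> restrict_type K p N2)"

text \<open>
  Ordinals below a cardinal \<open>r\<close> are identified with the elements of \<open>Field r\<close>. In particular the
  ordinals \<open>\<delta> < \<mu>\<^sup>+\<close> are the elements of \<open>Field (cardSuc \<mu>)\<close>, and a sequence indexed by \<open>i \<le> \<delta>\<close>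
  is a function restricted to \<open>under (cardSuc \<mu>) \<delta>\<close>.
\<close>

definition limit_elem :: "'i rel \<Rightarrow> 'i \<Rightarrow> bool" where
  "limit_elem r d \<longleftrightarrow>
     d \<in> Field r \<and> underS r d \<noteq> {} \<and> (\<forall>i\<in>underS r d. \<exists>j\<in>underS r d. i \<in> underS r j)"

definition cont_chain ::
    "('a, 'f, 'r) aclass \<Rightarrow> 'c rel \<Rightarrow> 'i rel \<Rightarrow> 'i \<Rightarrow> ('i \<Rightarrow> ('a, 'f, 'r) struct) \<Rightarrow> bool" where
  "cont_chain K \<mu> r d M \<longleftrightarrow>
     (\<forall>i\<in>under r d. M i \<in> models_of_card K \<mu>) \<and>
     (\<forall>j\<in>under r d. \<forall>i\<in>under r j. M i \<preceq>\<^bsub>K\<^esub> M j) \<and>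
     (\<forall>j\<in>under r d. limit_elem r j \<longrightarrow> M j = union_struct (M ` underS r j))"

definition splitting_continuous_in :: "('a, 'f, 'r) aclass \<Rightarrow> 'c rel \<Rightarrow> bool" where
  "splitting_continuous_in K \<mu> \<longleftrightarrow>
     (let r = cardSuc \<mu>; z = wo_rel.minim r (Field r) in
      \<forall>d M p. limit_elem r d \<and> cont_chain K \<mu> r d M \<and>
        (\<forall>i\<in>underS r d. universal_over K (M (wo_rel.suc r {i})) (M i)) \<and>
        p \<in> gS_na K (M d) \<and>
        (\<forall>i\<in>underS r d. \<not> splits_over K \<mu> (restrict_type K p (M i)) (M i) (M z)) \<longrightarrow>
        \<not> splits_over K \<mu> p (M d) (M z))"

end

theory Submission
  imports Defs
begin

text \<open>
  It suffices to show that no model of cardinality \<open>\<lambda>\<^sup>+\<close> is maximal. Suppose \<open>B\<close> were. Amalgamation in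
  \<open>\<lambda>\<close>, applied along a filtration, amalgamates \<open>B\<close> with any extension of a submodel of cardinality
  \<open>\<lambda>\<close>, and maximality then forces the amalgam to be \<open>B\<close>. So \<open>B\<close> is its own monster model: embeddings of
  submodels of cardinality \<open>\<lambda>\<close> extend to automorphisms, types over such submodels are orbits, and by
  stability \<open>B\<close> is the union of a continuous chain \<open>(M\<^sub>i)\<close>, \<open>i < \<lambda>\<^sup>+\<close>, with \<open>M\<^sub>i\<^sub>+\<^sub>1\<close> universal over \<open>M\<^sub>i\<close>.
  Stability also provides an element outside \<open>M\<^sub>1\<close> whose type over \<open>M\<^sub>1\<close> does not split over \<open>M\<^sub>0\<close>, for
  a suitable \<open>M\<^sub>0\<close>.
  Non-splitting types extend from \<open>M\<^sub>i\<close> to \<open>M\<^sub>i\<^sub>+\<^sub>1\<close>, because \<open>M\<^sub>i\<^sub>+\<^sub>1\<close> embeds into \<open>M\<^sub>i\<close> over \<open>M\<^sub>0\<close>, and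
  continuity of splitting passes through limits. Hence there is an embedding of \<open>B\<close> into \<open>B\<close>, built
  along the chain, that omits a fixed element \<open>b\<close> because the type of \<open>b\<close> over the image of each \<open>M\<^sub>i\<close>
  corresponds to a non-algebraic non-splitting type. Its image is a maximal model with a proper extension.
\<close>

section \<open>Transfinite constructions\<close>

locale index_order =
  fixes r :: "'i rel"
  assumes limit_order: "limit_order r"
begin

sublocale wo_rel r
  using limit_order by unfold_locales (simp add: limit_order_def)

abbreviation zero :: 'i where "zero \<equiv> minim (Field r)"
abbreviation succ :: "'i \<Rightarrow> 'i" where "succ i \<equiv> suc {i}"

lemma leq_refl: "i \<in> Field r \<Longrightarrow> (i, i) \<in> r"
  using REFL by (auto simp: refl_on_def)

lemma leq_trans: "(i, j) \<in> r \<Longrightarrow> (j, k) \<in> r \<Longrightarrow> (i, k) \<in> r"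
  using TRANS by (auto simp: trans_def)

lemma leq_antisym: "(i, j) \<in> r \<Longrightarrow> (j, i) \<in> r \<Longrightarrow> i = j"
  using ANTISYM by (auto simp: antisym_def)

lemma leq_cases: "(i, j) \<in> r \<Longrightarrow> i = j \<or> i \<in> underS j"
  by (auto simp: underS_def)

lemma underS_leq: "i \<in> underS j \<Longrightarrow> (i, j) \<in> r"
  by (auto simp: underS_def)

lemma underS_FieldD: "i \<in> underS j \<Longrightarrow> i \<in> Field r" "i \<in> underS j \<Longrightarrow> j \<in> Field r"
  by (auto simp: Field_def underS_def)

lemma underS_leq_trans: "i \<in> underS j \<Longrightarrow> (j, k) \<in> r \<Longrightarrow> i \<in> underS k"
  unfolding underS_def using leq_trans leq_antisym by blast

lemma leq_underS_trans: "(i, j) \<in> r \<Longrightarrow> j \<in> underS k \<Longrightarrow> i \<in> underS k"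
  unfolding underS_def using leq_trans leq_antisym by blast

lemma leq_iff_not_underS: "i \<in> Field r \<Longrightarrow> j \<in> Field r \<Longrightarrow> (i, j) \<in> r \<longleftrightarrow> j \<notin> underS i"
  using leq_antisym leq_refl TOTALS by (auto simp: underS_def)

lemma zero_in_Field: "zero \<in> Field r" and zero_leq: "i \<in> Field r \<Longrightarrow> (zero, i) \<in> r"
  using limit_order minim_in minim_least by (auto simp: limit_order_def)

lemma underS_zero: "underS zero = {}"
  using zero_leq leq_iff_not_underS[OF zero_in_Field] underS_FieldD(1) by blast

lemma AboveS_singleton: "i \<in> Field r \<Longrightarrow> AboveS {i} \<noteq> {}"
  using limit_order unfolding limit_order_def AboveS_def underS_def by blast

lemma succ_in_Field: "i \<in> Field r \<Longrightarrow> succ i \<in> Field r"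
  and in_underS_succ: "i \<in> Field r \<Longrightarrow> i \<in> underS (succ i)"
  using suc_inField[of "{i}"] suc_greater[of "{i}" i] AboveS_singleton[of i] by (auto simp: underS_def)

lemma leq_succ: "i \<in> Field r \<Longrightarrow> (i, succ i) \<in> r"
  by (rule underS_leq[OF in_underS_succ])

lemma succ_leq: "i \<in> underS j \<Longrightarrow> (succ i, j) \<in> r"
  using suc_least_AboveS[of j "{i}"] by (auto simp: AboveS_def underS_def Field_def)

lemma underS_succ:
  assumes "i \<in> Field r"
  shows "underS (succ i) = insert i (underS i)"
proof (intro subset_antisym subsetI)
  fix j assume j: "j \<in> underS (succ i)"
  have "i \<notin> underS j"
    using leq_underS_trans[OF succ_leq j] by (auto simp: underS_def)
  then have "(j, i) \<in> r"
    using leq_iff_not_underS[OF underS_FieldD(1)[OF j] assms] by simp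
  then show "j \<in> insert i (underS i)"
    using leq_cases by blast
next
  fix j assume "j \<in> insert i (underS i)"
  then show "j \<in> underS (succ i)"
    using in_underS_succ[OF assms] underS_leq_trans[OF _ leq_succ[OF assms]] by auto
qed

lemma succ_neq_zero: "i \<in> Field r \<Longrightarrow> succ i \<noteq> zero"
  using in_underS_succ[of i] underS_zero by auto

lemma inj_on_succ: "inj_on succ (Field r)"
proof (rule inj_onI)
  fix i j assume ij: "i \<in> Field r" "j \<in> Field r" "succ i = succ j"
  have "underS (succ i) = underS (succ j)"
    using ij(3) by simp
  then have "insert i (underS i) = insert j (underS j)"
    using underS_succ[OF ij(1)] underS_succ[OF ij(2)] by argo
  then have "i \<in> insert j (underS j)" "j \<in> insert i (underS i)"
    by auto
  then show "i = j"
    using leq_antisym[OF underS_leq underS_leq] by auto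
qed

lemma limit_elem_succ: "limit_elem r d \<Longrightarrow> i \<in> underS d \<Longrightarrow> succ i \<in> underS d"
  unfolding limit_elem_def using succ_leq leq_underS_trans by blast

lemma zero_not_limit: "\<not> limit_elem r zero"
  by (simp add: limit_elem_def underS_zero)

lemma succ_not_limit: "i \<in> Field r \<Longrightarrow> \<not> limit_elem r (succ i)"
  using limit_elem_succ[of "succ i" i] in_underS_succ by (auto simp: underS_def)

lemma zero_succ_limit_cases:
  assumes "i \<in> Field r"
  obtains (zero) "i = zero" | (succ) j where "j \<in> Field r" "i = succ j" | (limit) "limit_elem r i"
proof (cases "i = zero \<or> limit_elem r i")
  case False
  then have "underS i \<noteq> {}"
    using zero_leq[OF assms] by (auto simp: underS_def)
  with False assms obtain j where j: "j \<in> underS i" "\<forall>k\<in>underS i. j \<notin> underS k"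
    unfolding limit_elem_def by blast
  then have "(succ j, i) \<in> r" "succ j \<notin> underS i"
    using succ_leq in_underS_succ underS_FieldD by blast+
  then show ?thesis
    using that(2)[of j] j underS_FieldD leq_cases by blast
qed (use that in auto)

lemma transfinite_induct [consumes 1, case_names zero succ limit]:
  assumes "i \<in> Field r" and "P zero" and "\<And>i. i \<in> Field r \<Longrightarrow> P i \<Longrightarrow> P (succ i)"
    and "\<And>d. limit_elem r d \<Longrightarrow> (\<And>i. i \<in> underS d \<Longrightarrow> P i) \<Longrightarrow> P d"
  shows "P i"
proof -
  have "i \<in> Field r \<longrightarrow> P i"
  proof (induction i rule: well_order_induct, intro impI)
    fix i assume IH: "\<forall>j. j \<noteq> i \<and> (j, i) \<in> r \<longrightarrow> j \<in> Field r \<longrightarrow> P j" and "i \<in> Field r"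
    have below: "P j" if "j \<in> underS i" for j
      using IH that underS_FieldD(1) by (auto simp: underS_def)
    from \<open>i \<in> Field r\<close> show "P i"
    proof (cases rule: zero_succ_limit_cases)
      case zero
      then show ?thesis using assms(2) by simp
    next
      case (succ j)
      then show ?thesis using assms(3) below in_underS_succ by simp
    next
      case limit
      then show ?thesis using below by (rule assms(4))
    qed
  qed
  with assms(1) show ?thesis by simp
qed

lemma transfinite_recursion:
  fixes s0 :: 's and S :: "'i \<Rightarrow> 's \<Rightarrow> 's" and L :: "'i \<Rightarrow> ('i \<Rightarrow> 's) \<Rightarrow> 's"
  assumes L_cong: "\<And>d g g'. (\<And>i. i \<in> underS d \<Longrightarrow> g i = g' i) \<Longrightarrow> L d g = L d g'"
  obtains g where "g zero = s0" "\<And>i. i \<in> Field r \<Longrightarrow> g (succ i) = S i (g i)"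
    "\<And>d. limit_elem r d \<Longrightarrow> g d = L d g"
proof -
  define pred where "pred = inv_into (Field r) succ"
  define H where "H g i = (if limit_elem r i then L i g
      else if i \<in> succ ` Field r then S (pred i) (g (pred i)) else s0)" for g i
  have pred_succ: "pred (succ i) = i" if "i \<in> Field r" for i
    unfolding pred_def by (rule inv_into_f_f[OF inj_on_succ that])
  have "adm_wo H"
    unfolding adm_wo_def
  proof (intro allI impI)
    fix f g :: "'i \<Rightarrow> 's" and i assume eq: "\<forall>j\<in>underS i. f j = g j"
    have "f (pred i) = g (pred i)" if "i \<in> succ ` Field r"
      using that eq pred_succ in_underS_succ by auto
    moreover have "L i f = L i g"
      using L_cong eq by blast
    ultimately show "H f i = H g i"
      by (simp add: H_def)
  qed
  then have rec: "worec H i = H (worec H) i" for i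
    using worec_fixpoint by metis
  have "zero \<notin> succ ` Field r"
    using succ_neq_zero by force
  then have "worec H zero = s0"
    using rec[of zero] zero_not_limit by (simp add: H_def)
  moreover have "worec H (succ i) = S i (worec H i)" if "i \<in> Field r" for i
    using rec[of "succ i"] that succ_not_limit pred_succ by (simp add: H_def)
  moreover have "worec H d = L d (worec H)" if "limit_elem r d" for d
    using rec[of d] that by (simp add: H_def)
  ultimately show ?thesis
    by (rule that)
qed

text \<open>
  The relation \<open>R\<close> is indexed so that a state at stage \<open>i\<close> may be compared with a later one only as
  far as stage \<open>i\<close> determines it.
\<close>

lemma transfinite_chain:
  fixes s0 :: 's and L :: "'i \<Rightarrow> ('i \<Rightarrow> 's) \<Rightarrow> 's"
  assumes base: "P zero s0"
    and refl: "\<And>i s. P i s \<Longrightarrow> R i s s"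
    and trans: "\<And>i j s t u. (i, j) \<in> r \<Longrightarrow> R i s t \<Longrightarrow> R j t u \<Longrightarrow> R i s u"
    and step: "\<And>i s. i \<in> Field r \<Longrightarrow> P i s \<Longrightarrow> \<exists>s'. P (succ i) s' \<and> R i s s' \<and> St i s s'"
    and L_cong: "\<And>d g g'. (\<And>i. i \<in> underS d \<Longrightarrow> g i = g' i) \<Longrightarrow> L d g = L d g'"
    and at_limit: "\<And>d g. limit_elem r d \<Longrightarrow> (\<And>i. i \<in> underS d \<Longrightarrow> P i (g i)) \<Longrightarrow>
      (\<And>i j. (i, j) \<in> r \<Longrightarrow> j \<in> underS d \<Longrightarrow> R i (g i) (g j)) \<Longrightarrow>
      P d (L d g) \<and> (\<forall>i\<in>underS d. R i (g i) (L d g))"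
  obtains g where "g zero = s0" "\<And>i. i \<in> Field r \<Longrightarrow> P i (g i)"
    "\<And>i j. (i, j) \<in> r \<Longrightarrow> R i (g i) (g j)"
    "\<And>i. i \<in> Field r \<Longrightarrow> St i (g i) (g (succ i))"
    "\<And>d. limit_elem r d \<Longrightarrow> g d = L d g"
proof -
  define S where "S i s = (SOME s'. P (succ i) s' \<and> R i s s' \<and> St i s s')" for i s
  have S: "P (succ i) (S i s) \<and> R i s (S i s) \<and> St i s (S i s)" if "i \<in> Field r" "P i s" for i s
    unfolding S_def by (rule someI_ex[OF step[OF that]])
  obtain g where g: "g zero = s0" "\<And>i. i \<in> Field r \<Longrightarrow> g (succ i) = S i (g i)"
    "\<And>d. limit_elem r d \<Longrightarrow> g d = L d g"
    by (rule transfinite_recursion[of L s0 S, OF L_cong]) auto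
  have chain: "P i (g i) \<and> (\<forall>j\<in>underS i. R j (g j) (g i))" if "i \<in> Field r" for i
    using that
  proof (induction i rule: transfinite_induct)
    case zero
    then show ?case using g(1) base underS_zero by simp
  next
    case (succ i)
    then have "P (succ i) (g (succ i))" "R i (g i) (g (succ i))"
      using S[of i "g i"] g(2)[OF succ.hyps] by simp_all
    moreover have "R j (g j) (g (succ i))" if "j \<in> underS i" for j
      using trans[OF underS_leq[OF that]] succ.IH that calculation(2) by blast
    ultimately show ?case
      using underS_succ[OF succ.hyps] by auto
  next
    case (limit d)
    have "R i (g i) (g j)" if "(i, j) \<in> r" "j \<in> underS d" for i j
      using leq_cases[OF that(1)] limit.IH[OF that(2)] refl by blast
    then show ?case
      using at_limit[OF limit.hyps, of g] limit.IH g(3)[OF limit.hyps] by simp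
  qed
  show ?thesis
  proof (rule that[of g])
    show "R i (g i) (g j)" if "(i, j) \<in> r" for i j
      using leq_cases[OF that] chain[OF FieldI2[OF that]] refl by blast
    show "St i (g i) (g (succ i))" if "i \<in> Field r" for i
      using S[OF that] chain[OF that] g(2)[OF that] by simp
  qed (use g chain in blast)+
qed

definition limit_set :: "'i set \<Rightarrow> bool" where
  "limit_set I \<longleftrightarrow> I \<subseteq> Field r \<and> I \<noteq> {} \<and> (\<forall>i\<in>I. \<exists>j\<in>I. i \<in> underS j)"

lemma limit_set_Field: "limit_set (Field r)"
  using limit_order by (simp add: limit_set_def limit_order_def)

lemma limit_set_underS: "limit_elem r d \<Longrightarrow> limit_set (underS d)"
  using underS_FieldD(1) by (auto simp: limit_set_def limit_elem_def)

lemma limit_set_total: "limit_set I \<Longrightarrow> i \<in> I \<Longrightarrow> j \<in> I \<Longrightarrow> (i, j) \<in> r \<or> (j, i) \<in> r"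
  using TOTALS by (auto simp: limit_set_def)

lemma Field_Restr: "limit_set I \<Longrightarrow> Field (Restr r I) = I"
  by (simp add: limit_set_def Refl_Field_Restr2[OF REFL])

lemma limit_order_Restr:
  assumes "limit_set I"
  shows "limit_order (Restr r I)"
proof -
  have "Well_order (Restr r I)"
    by (rule Well_order_Restr[OF WELL])
  moreover have "\<exists>j\<in>I. i \<in> Order_Relation.underS (Restr r I) j" if "i \<in> I" for i
    using assms that unfolding limit_set_def underS_def by blast
  ultimately show ?thesis
    using assms by (simp add: limit_order_def Field_Restr) (simp add: limit_set_def)
qed

definition glue :: "('i \<Rightarrow> 'a set) \<Rightarrow> ('i \<Rightarrow> 'a \<Rightarrow> 'b) \<Rightarrow> 'i set \<Rightarrow> 'a \<Rightarrow> 'b" where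
  "glue C g I = (SOME f. \<forall>i\<in>I. \<forall>x\<in>C i. f x = g i x)"

lemma glue_cong: "(\<And>i. i \<in> I \<Longrightarrow> g i = g' i) \<Longrightarrow> glue C g I = glue C g' I"
  by (simp add: glue_def)

lemma glue_eq:
  assumes I: "limit_set I"
    and coherent: "\<And>i j x. i \<in> I \<Longrightarrow> j \<in> I \<Longrightarrow> (i, j) \<in> r \<Longrightarrow> x \<in> C i \<Longrightarrow> g j x = g i x"
    and x: "i \<in> I" "x \<in> C i"
  shows "glue C g I x = g i x"
proof -
  define h where "h y = g (SOME j. j \<in> I \<and> y \<in> C j) y" for y
  have "h y = g j y" if j: "j \<in> I" "y \<in> C j" for j y
  proof -
    define k where "k = (SOME j. j \<in> I \<and> y \<in> C j)"
    have k: "k \<in> I" "y \<in> C k"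
      using someI[of "\<lambda>j. j \<in> I \<and> y \<in> C j" j] j by (simp_all add: k_def)
    from limit_set_total[OF I j(1) k(1)] have "g k y = g j y"
      using coherent[OF j(1) k(1) _ j(2)] coherent[OF k(1) j(1) _ k(2)] by auto
    then show ?thesis
      by (simp add: h_def k_def)
  qed
  then have "\<forall>i\<in>I. \<forall>x\<in>C i. h x = g i x"
    by blast
  from someI[of "\<lambda>f. \<forall>i\<in>I. \<forall>x\<in>C i. f x = g i x", OF this] show ?thesis
    using x by (simp add: glue_def)
qed

lemma least_difference:
  assumes "A \<subseteq> Field r" "A' \<subseteq> Field r" "A \<noteq> A'"
  obtains i where "i \<in> A \<union> A'" "i \<in> A \<longleftrightarrow> i \<notin> A'" "A \<inter> underS i = A' \<inter> underS i"
proof -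
  let ?E = "(A - A') \<union> (A' - A)"
  have E: "?E \<subseteq> Field r" "?E \<noteq> {}"
    using assms by auto
  have "j \<notin> ?E" if "j \<in> underS (minim ?E)" for j
    using minim_least[OF E(1), of j] leq_iff_not_underS[of "minim ?E" j] underS_FieldD[OF that] that by blast
  moreover have "minim ?E \<in> ?E"
    by (rule minim_in[OF E])
  ultimately show ?thesis
    using that[of "minim ?E"] by blast
qed

lemma card_Field_leq_strict_chain:
  assumes "\<And>i j. i \<in> underS j \<Longrightarrow> C i \<subset> C j"
  shows "|Field r| \<le>o |\<Union>i\<in>Field r. C i|"
proof -
  have "\<exists>x. x \<in> C (succ i) - C i" if "i \<in> Field r" for i
    using assms[OF in_underS_succ[OF that]] by blast
  then obtain e where e: "\<And>i. i \<in> Field r \<Longrightarrow> e i \<in> C (succ i) - C i"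
    by metis
  have neq: "e i \<noteq> e j" if "i \<in> underS j" for i j
  proof -
    have "C (succ i) \<subseteq> C j"
      using leq_cases[OF succ_leq[OF that]] assms by auto
    then show ?thesis
      using e[OF underS_FieldD(1)[OF that]] e[OF underS_FieldD(2)[OF that]] by auto
  qed
  have "inj_on e (Field r)"
  proof (rule inj_onI)
    fix i j assume ij: "i \<in> Field r" "j \<in> Field r" "e i = e j"
    then have "i \<notin> underS j" "j \<notin> underS i"
      using neq[of i j] neq[of j i] by auto
    then show "i = j"
      using leq_iff_not_underS ij(1,2) leq_antisym by blast
  qed
  moreover have "e ` Field r \<subseteq> (\<Union>i\<in>Field r. C i)"
    using e succ_in_Field by blast
  ultimately show ?thesis
    unfolding card_of_ordLeq[symmetric] by blast
qed

end

section \<open>Images of structures\<close>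

definition image_struct ::
    "('f, 'r) vocabulary \<Rightarrow> ('a \<Rightarrow> 'a) \<Rightarrow> ('a, 'f, 'r) struct \<Rightarrow> ('a, 'f, 'r) struct" where
  "image_struct L h M =
     \<lparr> carrier = h ` carrier M,
       fint = (\<lambda>f xs. if f \<in> funs L \<and> xs \<in> tuples (far L f) (h ` carrier M)
                      then h (fint M f (map (inv_into (carrier M) h) xs)) else undefined),
       rint = (\<lambda>R. map h ` rint M R) \<rparr>"

lemma carrier_image_struct [simp]: "carrier (image_struct L h M) = h ` carrier M"
  by (simp add: image_struct_def)

lemma map_in_tuples: "xs \<in> tuples n A \<Longrightarrow> h ` A \<subseteq> B \<Longrightarrow> map h xs \<in> tuples n B"
  by (auto simp: tuples_def)

lemma map_inv_into_in_tuples: "xs \<in> tuples n (h ` A) \<Longrightarrow> map (inv_into A h) xs \<in> tuples n A"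
  by (auto simp: tuples_def intro: inv_into_into)

lemma map_inv_into_map: "inj_on h A \<Longrightarrow> xs \<in> tuples n A \<Longrightarrow> map (inv_into A h) (map h xs) = xs"
  by (auto simp: tuples_def intro!: map_idI)

lemma map_map_inv_into: "xs \<in> tuples n (h ` A) \<Longrightarrow> map h (map (inv_into A h) xs) = xs"
  by (auto simp: tuples_def f_inv_into_f subset_iff intro!: map_idI)

lemma tuples_imageE:
  assumes "xs \<in> tuples n (h ` A)"
  obtains ys where "ys \<in> tuples n A" "xs = map h ys"
  using that[OF map_inv_into_in_tuples[OF assms] map_map_inv_into[OF assms, symmetric]] .

lemma map_inj_on_tuples:
  "inj_on h A \<Longrightarrow> xs \<in> tuples n A \<Longrightarrow> ys \<in> tuples m A \<Longrightarrow> map h xs = map h ys \<Longrightarrow> xs = ys"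
  unfolding tuples_def by (auto intro: map_inj_on inj_on_subset)

lemma is_struct_image_struct:
  assumes M: "is_struct L M"
  shows "is_struct L (image_struct L h M)"
  unfolding is_struct_def
proof (intro conjI ballI allI impI)
  show "carrier (image_struct L h M) \<noteq> {}"
    using M by (simp add: is_struct_def)
  show "fint (image_struct L h M) f xs \<in> carrier (image_struct L h M)"
    if "f \<in> funs L" "xs \<in> tuples (far L f) (carrier (image_struct L h M))" for f xs
    using that M map_inv_into_in_tuples[of xs _ h "carrier M"]
    by (simp add: image_struct_def is_struct_def)
  show "fint (image_struct L h M) f xs = undefined"
    if "\<not> (f \<in> funs L \<and> xs \<in> tuples (far L f) (carrier (image_struct L h M)))" for f xs
    using that by (auto simp: image_struct_def)
  show "rint (image_struct L h M) R \<subseteq> tuples (rar L R) (carrier (image_struct L h M))"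
    if "R \<in> rels L" for R
  proof -
    have "rint M R \<subseteq> tuples (rar L R) (carrier M)"
      using M that by (simp add: is_struct_def)
    then show ?thesis
      using map_in_tuples[of _ _ "carrier M" h] by (auto simp: image_struct_def)
  qed
  show "rint (image_struct L h M) R = {}" if "R \<notin> rels L" for R
    using M that by (simp add: is_struct_def image_struct_def)
qed

lemma struct_iso_image_struct:
  assumes M: "is_struct L M" and h: "inj_on h (carrier M)"
  shows "struct_iso L h M (image_struct L h M)"
  unfolding struct_iso_def
proof (intro conjI ballI)
  show "bij_betw h (carrier M) (carrier (image_struct L h M))"
    using h by (simp add: bij_betw_def)
next
  fix f xs assume f: "f \<in> funs L" and xs: "xs \<in> tuples (far L f) (carrier M)"
  then show "h (fint M f xs) = fint (image_struct L h M) f (map h xs)"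
    using map_in_tuples[OF xs subset_refl, of h] map_inv_into_map[OF h xs] by (simp add: image_struct_def)
next
  fix R xs assume R: "R \<in> rels L" and xs: "xs \<in> tuples (rar L R) (carrier M)"
  have "rint M R \<subseteq> tuples (rar L R) (carrier M)"
    using M R by (simp add: is_struct_def)
  then show "xs \<in> rint M R \<longleftrightarrow> map h xs \<in> rint (image_struct L h M) R"
    using map_inj_on_tuples[OF h _ xs] by (auto simp: image_struct_def)
qed (use M is_struct_image_struct in auto)

lemma struct_eqI:
  assumes M: "is_struct L M" and N: "is_struct L N" and C: "carrier M = carrier N"
    and f: "\<And>f xs. f \<in> funs L \<Longrightarrow> xs \<in> tuples (far L f) (carrier M) \<Longrightarrow> fint M f xs = fint N f xs"
    and R: "\<And>R xs. R \<in> rels L \<Longrightarrow> xs \<in> tuples (rar L R) (carrier M) \<Longrightarrow> xs \<in> rint M R \<longleftrightarrow> xs \<in> rint N R"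
  shows "M = (N :: ('a, 'f, 'r) struct)"
proof (rule struct.equality)
  show "fint M = fint N"
  proof (intro ext)
    fix g xs show "fint M g xs = fint N g xs"
    proof (cases "g \<in> funs L \<and> xs \<in> tuples (far L g) (carrier M)")
      case False
      then have "fint M g xs = undefined" "fint N g xs = undefined"
        using M N C by (simp_all add: is_struct_def)
      then show ?thesis by simp
    qed (use f in auto)
  qed
  show "rint M = rint N"
  proof (intro ext)
    fix S show "rint M S = rint N S"
    proof (cases "S \<in> rels L")
      case True
      then have "rint M S \<subseteq> tuples (rar L S) (carrier M)" "rint N S \<subseteq> tuples (rar L S) (carrier M)"
        using M N C by (simp_all add: is_struct_def)
      with R[OF True] show ?thesis by blast
    qed (use M N in \<open>simp add: is_struct_def\<close>)
  qed
qed (use C in auto)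

lemma substruct_eqI: "substruct L M N \<Longrightarrow> carrier M = carrier N \<Longrightarrow> M = N"
  by (rule struct_eqI[of L]) (auto simp: substruct_def)

lemma struct_isoD:
  assumes "struct_iso L h M N"
  shows "is_struct L M" "is_struct L N" "inj_on h (carrier M)" "carrier N = h ` carrier M"
  using assms by (auto simp: struct_iso_def bij_betw_def)

lemma struct_iso_unique:
  assumes "struct_iso L h M N" "struct_iso L h' M N'" "\<And>x. x \<in> carrier M \<Longrightarrow> h x = h' x"
  shows "N = N'"
proof (rule struct_eqI[of L])
  have preimage: "\<exists>ys\<in>tuples n (carrier M). xs = map h ys \<and> xs = map h' ys"
    if xs: "xs \<in> tuples n (carrier N)" for n xs
  proof -
    obtain ys where ys: "ys \<in> tuples n (carrier M)" "xs = map h ys"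
      using tuples_imageE xs struct_isoD(4)[OF assms(1)] by metis
    moreover have "map h ys = map h' ys"
      using ys(1) assms(3) by (auto simp: tuples_def)
    ultimately show ?thesis by (intro bexI[of _ ys]) simp_all
  qed
  show "carrier N = carrier N'"
    using struct_isoD(4)[OF assms(1)] struct_isoD(4)[OF assms(2)] assms(3) by auto
  show "fint N f xs = fint N' f xs"
    if f: "f \<in> funs L" and xs: "xs \<in> tuples (far L f) (carrier N)" for f xs
  proof -
    obtain ys where ys: "ys \<in> tuples (far L f) (carrier M)" "xs = map h ys" "xs = map h' ys"
      using preimage[OF xs] by blast
    have "fint M f ys \<in> carrier M"
      using struct_isoD(1)[OF assms(1)] f ys by (simp add: is_struct_def)
    then have "h (fint M f ys) = h' (fint M f ys)" by (rule assms(3))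
    moreover have "h (fint M f ys) = fint N f xs"
      using assms(1) f ys(1) unfolding ys(2) by (simp add: struct_iso_def)
    moreover have "h' (fint M f ys) = fint N' f xs"
      using assms(2) f ys(1) unfolding ys(3) by (simp add: struct_iso_def)
    ultimately show ?thesis by simp
  qed
  show "xs \<in> rint N R \<longleftrightarrow> xs \<in> rint N' R"
    if R: "R \<in> rels L" and xs: "xs \<in> tuples (rar L R) (carrier N)" for R xs
  proof -
    obtain ys where ys: "ys \<in> tuples (rar L R) (carrier M)" "xs = map h ys" "xs = map h' ys"
      using preimage[OF xs] by blast
    have "ys \<in> rint M R \<longleftrightarrow> xs \<in> rint N R"
      using assms(1) R ys(1) unfolding ys(2) by (simp add: struct_iso_def)
    moreover have "ys \<in> rint M R \<longleftrightarrow> xs \<in> rint N' R"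
      using assms(2) R ys(1) unfolding ys(3) by (simp add: struct_iso_def)
    ultimately show ?thesis by simp
  qed
qed (use assms struct_isoD in blast)+

lemma struct_iso_iff:
  "struct_iso L h M N \<longleftrightarrow> is_struct L M \<and> inj_on h (carrier M) \<and> N = image_struct L h M"
  (is "?iso \<longleftrightarrow> ?image")
proof
  assume iso: ?iso
  then have "N = image_struct L h M"
    by (rule struct_iso_unique[OF _ struct_iso_image_struct]) (use struct_isoD[OF iso] in auto)
  with struct_isoD[OF iso] show ?image by blast
next
  assume ?image
  then show ?iso
    using struct_iso_image_struct by blast
qed

lemma image_struct_cong:
  assumes "is_struct L M" "inj_on h (carrier M)" "\<And>x. x \<in> carrier M \<Longrightarrow> h x = h' x"
  shows "image_struct L h M = image_struct L h' M"
proof -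
  have "inj_on h' (carrier M)"
    using assms(2,3) by (simp cong: inj_on_cong)
  then show ?thesis
    by (intro struct_iso_unique[OF struct_iso_image_struct struct_iso_image_struct] assms)
qed

lemma image_struct_id: "is_struct L M \<Longrightarrow> image_struct L id M = M"
  using struct_iso_iff[of L id M M] by (simp add: struct_iso_def)

lemma struct_iso_comp:
  assumes "struct_iso L g M N" "struct_iso L h N P"
  shows "struct_iso L (h \<circ> g) M P"
  unfolding struct_iso_def
proof (intro conjI ballI)
  show "bij_betw (h \<circ> g) (carrier M) (carrier P)"
    using assms bij_betw_trans unfolding struct_iso_def by blast
  have g: "g ` carrier M \<subseteq> carrier N"
    using struct_isoD(4)[OF assms(1)] by simp
  show "(h \<circ> g) (fint M f xs) = fint P f (map (h \<circ> g) xs)"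
    if "f \<in> funs L" "xs \<in> tuples (far L f) (carrier M)" for f xs
    using assms that map_in_tuples[OF that(2) g] by (simp add: struct_iso_def)
  show "xs \<in> rint M R \<longleftrightarrow> map (h \<circ> g) xs \<in> rint P R"
    if "R \<in> rels L" "xs \<in> tuples (rar L R) (carrier M)" for R xs
    using assms that map_in_tuples[OF that(2) g] by (simp add: struct_iso_def)
qed (use assms struct_isoD in blast)+

lemma image_struct_comp:
  assumes "is_struct L M" "inj_on g (carrier M)" "inj_on h (g ` carrier M)"
  shows "image_struct L h (image_struct L g M) = image_struct L (h \<circ> g) M"
proof -
  have "struct_iso L (h \<circ> g) M (image_struct L h (image_struct L g M))"
    by (rule struct_iso_comp) (use assms is_struct_image_struct in \<open>auto intro!: struct_iso_image_struct\<close>)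
  then show ?thesis
    by (simp add: struct_iso_iff)
qed

lemma image_struct_inv_into:
  assumes "is_struct L M" "inj_on h (carrier M)"
  shows "image_struct L (inv_into (carrier M) h) (image_struct L h M) = M"
proof -
  have "inj_on (inv_into (carrier M) h) (h ` carrier M)"
    by (rule inj_on_inv_into) simp
  then have "image_struct L (inv_into (carrier M) h) (image_struct L h M) =
      image_struct L (inv_into (carrier M) h \<circ> h) M"
    by (rule image_struct_comp[OF assms])
  also have "\<dots> = image_struct L id M"
    by (rule image_struct_cong[OF assms(1)]) (use assms(2) in \<open>auto simp: inj_on_def\<close>)
  finally show ?thesis
    using image_struct_id[OF assms(1)] by simp
qed

text \<open>
  Renaming along permutations of the whole universe makes every embedding of a small model into an
  inclusion.
\<close>

lemma inj_on_extends_to_bij: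
  fixes f :: "'a \<Rightarrow> 'a"
  assumes inf: "infinite (UNIV :: 'a set)" and small: "|A| <o |UNIV :: 'a set|" and inj: "inj_on f A"
  obtains \<pi> where "bij \<pi>" "\<And>x. x \<in> A \<Longrightarrow> \<pi> x = f x"
proof -
  have compl: "|- B| =o |UNIV :: 'a set|" if B: "|B| <o |UNIV :: 'a set|" for B :: "'a set"
  proof -
    have "\<not> |- B| <o |UNIV :: 'a set|"
      using card_of_Un_ordLess_infinite[OF inf B, of "- B"] ordLess_irreflexive by (metis Compl_partition)
    moreover have "|- B| \<le>o |UNIV :: 'a set|"
      by (rule card_of_mono1[OF subset_UNIV])
    ultimately show ?thesis
      using ordLeq_iff_ordLess_or_ordIso by blast
  qed
  have "|f ` A| <o |UNIV :: 'a set|"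
    by (rule ordLeq_ordLess_trans[OF card_of_image small])
  then have "|- A| =o |- f ` A|"
    using compl small ordIso_symmetric ordIso_transitive by metis
  then obtain g where g: "bij_betw g (- A) (- f ` A)"
    unfolding card_of_ordIso[symmetric] by blast
  have "bij_betw f A (f ` A)"
    using inj by (simp add: bij_betw_def)
  then have "bij_betw (\<lambda>x. if x \<in> A then f x else g x) (A \<union> - A) (f ` A \<union> - f ` A)"
    by (rule bij_betw_disjoint_Un) (use g in auto)
  then show ?thesis
    using that[of "\<lambda>x. if x \<in> A then f x else g x"] by simp
qed

section \<open>Embeddings and unions of chains\<close>

lemma bij_inj_on: "bij f \<Longrightarrow> inj_on f A"
  using bij_is_inj inj_on_subset by blast

locale aec =
  fixes K :: "('a, 'f, 'r) aclass"
  assumes aec: "AEC K"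
begin

abbreviation emb :: "('a \<Rightarrow> 'a) \<Rightarrow> ('a, 'f, 'r) struct \<Rightarrow> ('a, 'f, 'r) struct \<Rightarrow> bool" where
  "emb \<equiv> K_embedding K"

abbreviation image :: "('a \<Rightarrow> 'a) \<Rightarrow> ('a, 'f, 'r) struct \<Rightarrow> ('a, 'f, 'r) struct" (infixr "\<bullet>" 90) where
  "f \<bullet> M \<equiv> image_struct (voc K) f M"

lemma AEC_unfolded:
  shows "\<forall>M\<in>models K. is_struct (voc K) M"
    and "\<forall>M N. M \<preceq>\<^bsub>K\<^esub> N \<longrightarrow> M \<in> models K \<and> N \<in> models K \<and> substruct (voc K) M N"
    and "\<forall>M\<in>models K. M \<preceq>\<^bsub>K\<^esub> M"
    and "\<forall>M N P. M \<preceq>\<^bsub>K\<^esub> N \<and> N \<preceq>\<^bsub>K\<^esub> P \<longrightarrow> M \<preceq>\<^bsub>K\<^esub> P"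
    and "\<forall>h M M'. M \<in> models K \<and> struct_iso (voc K) h M M' \<longrightarrow> M' \<in> models K"
    and "\<forall>h M N M' N'. M \<preceq>\<^bsub>K\<^esub> N \<and> struct_iso (voc K) h N N' \<and> struct_iso (voc K) h M M' \<longrightarrow> M' \<preceq>\<^bsub>K\<^esub> N'"
    and "\<forall>M0 M1 M2. M0 \<preceq>\<^bsub>K\<^esub> M2 \<and> M1 \<preceq>\<^bsub>K\<^esub> M2 \<and> substruct (voc K) M0 M1 \<longrightarrow> M0 \<preceq>\<^bsub>K\<^esub> M1"
    and "\<forall>(s :: 'a rel) M. limit_order s \<and> (\<forall>x y. (x, y) \<in> s \<longrightarrow> M x \<preceq>\<^bsub>K\<^esub> M y) \<longrightarrow>
        union_struct (M ` Field s) \<in> models K \<and>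
        (\<forall>x\<in>Field s. M x \<preceq>\<^bsub>K\<^esub> union_struct (M ` Field s)) \<and>
        (\<forall>N\<in>models K. (\<forall>x\<in>Field s. M x \<preceq>\<^bsub>K\<^esub> N) \<longrightarrow> union_struct (M ` Field s) \<preceq>\<^bsub>K\<^esub> N)"
    and "\<exists>\<kappa> :: 'a rel. LS_bound K \<kappa>"
  using aec unfolding AEC_def by - (elim conjE, assumption)+

lemma model_is_struct: "M \<in> models K \<Longrightarrow> is_struct (voc K) M"
  using AEC_unfolded(1) by blast

lemma leD:
  assumes "M \<preceq>\<^bsub>K\<^esub> N"
  shows "M \<in> models K" "N \<in> models K" "substruct (voc K) M N" "carrier M \<subseteq> carrier N"
  using AEC_unfolded(2) assms by (auto simp: substruct_def)

lemma le_refl: "M \<in> models K \<Longrightarrow> M \<preceq>\<^bsub>K\<^esub> M"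
  using AEC_unfolded(3) by blast

lemma le_trans: "M \<preceq>\<^bsub>K\<^esub> N \<Longrightarrow> N \<preceq>\<^bsub>K\<^esub> P \<Longrightarrow> M \<preceq>\<^bsub>K\<^esub> P"
  using AEC_unfolded(4) by blast

lemma le_of_subset:
  assumes "M0 \<preceq>\<^bsub>K\<^esub> N" "M1 \<preceq>\<^bsub>K\<^esub> N" "carrier M0 \<subseteq> carrier M1"
  shows "M0 \<preceq>\<^bsub>K\<^esub> M1"
proof -
  have sub: "substruct (voc K) M0 N" "substruct (voc K) M1 N"
    using leD assms by blast+
  have tuples_mono: "tuples n (carrier M0) \<subseteq> tuples n (carrier M1)" for n
    using assms(3) by (auto simp: tuples_def)
  have "substruct (voc K) M0 M1"
    unfolding substruct_def
  proof (intro conjI ballI)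
    show "fint M0 f xs = fint M1 f xs"
      if "f \<in> funs (voc K)" "xs \<in> tuples (far (voc K) f) (carrier M0)" for f xs
      using that sub tuples_mono[of "far (voc K) f"] by (simp add: substruct_def subset_iff)
    show "rint M0 R = rint M1 R \<inter> tuples (rar (voc K) R) (carrier M0)" if "R \<in> rels (voc K)" for R
      using that sub tuples_mono[of "rar (voc K) R"] by (auto simp: substruct_def)
  qed (use sub assms(3) in \<open>auto simp: substruct_def\<close>)
  then show ?thesis
    using AEC_unfolded(7) assms by blast
qed

lemma le_carrier_eqI: "M \<preceq>\<^bsub>K\<^esub> N \<Longrightarrow> carrier N \<subseteq> carrier M \<Longrightarrow> M = N"
  using leD(3,4) substruct_eqI subset_antisym by metis

lemma image_iso: "M \<in> models K \<Longrightarrow> inj_on f (carrier M) \<Longrightarrow> struct_iso (voc K) f M (f \<bullet> M)"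
  by (rule struct_iso_image_struct[OF model_is_struct])

lemma image_model: "M \<in> models K \<Longrightarrow> inj_on f (carrier M) \<Longrightarrow> f \<bullet> M \<in> models K"
  using AEC_unfolded(5) image_iso by blast

lemma image_le:
  assumes "M \<preceq>\<^bsub>K\<^esub> N" "inj_on f (carrier N)"
  shows "f \<bullet> M \<preceq>\<^bsub>K\<^esub> f \<bullet> N"
proof -
  have "struct_iso (voc K) f N (f \<bullet> N)" "struct_iso (voc K) f M (f \<bullet> M)"
    using assms leD[OF assms(1)] inj_on_subset by (blast intro: image_iso)+
  then show ?thesis
    using AEC_unfolded(6) assms(1) by blast
qed

lemma image_model_cong:
  "M \<in> models K \<Longrightarrow> inj_on f (carrier M) \<Longrightarrow> (\<And>x. x \<in> carrier M \<Longrightarrow> f x = g x) \<Longrightarrow> f \<bullet> M = g \<bullet> M"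
  by (rule image_struct_cong[OF model_is_struct])

lemma image_model_id: "M \<in> models K \<Longrightarrow> id \<bullet> M = M"
  by (rule image_struct_id[OF model_is_struct])

lemma image_model_comp:
  "M \<in> models K \<Longrightarrow> inj_on g (carrier M) \<Longrightarrow> inj_on f (g ` carrier M) \<Longrightarrow> f \<bullet> g \<bullet> M = (f \<circ> g) \<bullet> M"
  by (rule image_struct_comp[OF model_is_struct])

lemma image_fixed:
  assumes "M \<in> models K" "fixes_pointwise f M"
  shows "f \<bullet> M = M"
proof -
  have "id \<bullet> M = f \<bullet> M"
    by (rule image_model_cong) (use assms in \<open>simp_all add: fixes_pointwise_def\<close>)
  then show ?thesis
    by (simp add: image_model_id assms(1))
qed

lemma inv_image: "bij \<pi> \<Longrightarrow> M \<in> models K \<Longrightarrow> inv \<pi> \<bullet> \<pi> \<bullet> M = M"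
  using image_model_comp[of M \<pi> "inv \<pi>"] by (simp add: bij_inj_on bij_imp_bij_inv bij_is_inj image_model_id)

lemma emb_iff: "emb f M N \<longleftrightarrow> M \<in> models K \<and> inj_on f (carrier M) \<and> f \<bullet> M \<preceq>\<^bsub>K\<^esub> N"
proof
  assume "emb f M N"
  then have f: "is_struct (voc K) M" "inj_on f (carrier M)" "f \<bullet> M \<preceq>\<^bsub>K\<^esub> N"
    by (auto simp: K_embedding_def struct_iso_iff)
  have "inj_on (inv_into (carrier M) f) (carrier (f \<bullet> M))"
    by (simp add: inj_on_inv_into)
  from image_model[OF leD(1)[OF f(3)] this] show "M \<in> models K \<and> inj_on f (carrier M) \<and> f \<bullet> M \<preceq>\<^bsub>K\<^esub> N"
    using f image_struct_inv_into[OF f(1,2)] by simp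
next
  assume "M \<in> models K \<and> inj_on f (carrier M) \<and> f \<bullet> M \<preceq>\<^bsub>K\<^esub> N"
  then show "emb f M N"
    using image_iso by (auto simp: K_embedding_def)
qed

lemma embD:
  assumes "emb f M N"
  shows "M \<in> models K" "N \<in> models K" "inj_on f (carrier M)" "f ` carrier M \<subseteq> carrier N" "f \<bullet> M \<preceq>\<^bsub>K\<^esub> N"
  using assms leD(2,4)[of "f \<bullet> M" N] by (auto simp: emb_iff)

lemma emb_image: "M \<in> models K \<Longrightarrow> inj_on f (carrier M) \<Longrightarrow> emb f M (f \<bullet> M)"
  by (simp add: emb_iff le_refl image_model)

lemma emb_cong:
  assumes "emb f M N" "\<And>x. x \<in> carrier M \<Longrightarrow> f x = g x"
  shows "emb g M N"
  using embD[OF assms(1)] assms(2) image_model_cong[of M f g] by (simp add: emb_iff cong: inj_on_cong)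

lemma emb_id_iff: "emb id M N \<longleftrightarrow> M \<preceq>\<^bsub>K\<^esub> N"
  using leD(1) by (auto simp: emb_iff image_model_id)

lemma emb_restrict: "emb f M N \<Longrightarrow> M0 \<preceq>\<^bsub>K\<^esub> M \<Longrightarrow> emb f M0 N"
  unfolding emb_iff using image_le leD(1,4) le_trans inj_on_subset by metis

lemma emb_le: "emb f M N \<Longrightarrow> N \<preceq>\<^bsub>K\<^esub> P \<Longrightarrow> emb f M P"
  unfolding emb_iff using le_trans by blast

lemma emb_comp:
  assumes f: "emb f M N" and g: "emb g N P"
  shows "emb (g \<circ> f) M P"
proof -
  have "emb g (f \<bullet> M) P"
    by (rule emb_restrict[OF g embD(5)[OF f]])
  then show ?thesis
    using embD(1,3)[OF f] image_model_comp[of M f g] by (simp add: emb_iff comp_inj_on)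
qed

lemma emb_into: "emb f M N \<Longrightarrow> N0 \<preceq>\<^bsub>K\<^esub> N \<Longrightarrow> f ` carrier M \<subseteq> carrier N0 \<Longrightarrow> emb f M N0"
  using le_of_subset[of "f \<bullet> M" N N0] by (simp add: emb_iff)

lemma emb_inv_into:
  assumes f: "emb f M N" and N0: "N0 \<preceq>\<^bsub>K\<^esub> N" "carrier N0 \<subseteq> f ` carrier M"
  shows "emb (inv_into (carrier M) f) N0 M"
proof -
  have "N0 \<preceq>\<^bsub>K\<^esub> f \<bullet> M"
    by (rule le_of_subset[OF N0(1) embD(5)[OF f]]) (simp add: N0(2))
  moreover have "emb (inv_into (carrier M) f) (f \<bullet> M) M"
    using embD[OF f] image_struct_inv_into[OF model_is_struct, of M f]
    by (simp add: emb_iff image_model inj_on_inv_into le_refl)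
  ultimately show ?thesis
    using emb_restrict by blast
qed

lemma le_of_emb_fixing:
  assumes "emb f N P" "M \<preceq>\<^bsub>K\<^esub> N" "fixes_pointwise f M"
  shows "M \<preceq>\<^bsub>K\<^esub> P"
  using embD(5)[OF emb_restrict[OF assms(1,2)]] image_fixed[OF leD(1)[OF assms(2)] assms(3)] by simp

lemma emb_inv_image: "bij \<pi> \<Longrightarrow> N \<in> models K \<Longrightarrow> emb (inv \<pi>) (\<pi> \<bullet> N) N"
  by (simp add: emb_iff image_model bij_inj_on bij_imp_bij_inv inv_image le_refl)

lemma emb_extends_to_bij:
  assumes inf: "infinite (UNIV :: 'a set)" and small: "|carrier M| <o |UNIV :: 'a set|" and f: "emb f M N"
  obtains \<pi> where "bij \<pi>" "\<And>x. x \<in> carrier M \<Longrightarrow> \<pi> x = f x" "M \<preceq>\<^bsub>K\<^esub> inv \<pi> \<bullet> N"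
proof -
  obtain \<pi> where \<pi>: "bij \<pi>" "\<And>x. x \<in> carrier M \<Longrightarrow> \<pi> x = f x"
    using inj_on_extends_to_bij[OF inf small embD(3)[OF f]] by blast
  have "emb \<pi> M N"
    by (rule emb_cong[OF f]) (simp add: \<pi>(2))
  then have "inv \<pi> \<bullet> \<pi> \<bullet> M \<preceq>\<^bsub>K\<^esub> inv \<pi> \<bullet> N"
    using \<pi>(1) by (simp add: emb_iff image_le bij_inj_on bij_imp_bij_inv)
  then show ?thesis
    using that \<pi> inv_image[OF \<pi>(1) embD(1)[OF f]] by simp
qed

end

lemma limit_order_dir_image:
  assumes r: "limit_order r" and e: "inj_on e (Field r)"
  shows "limit_order (dir_image r e)"
  unfolding limit_order_def
proof (intro conjI ballI)
  have "Well_order r" "Field r \<noteq> {}"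
    using r by (simp_all add: limit_order_def)
  then show "Well_order (dir_image r e)" "Field (dir_image r e) \<noteq> {}"
    using Well_order_dir_image e by (auto simp: dir_image_Field)
  fix x assume "x \<in> Field (dir_image r e)"
  then obtain i where i: "i \<in> Field r" "x = e i"
    by (auto simp: dir_image_Field)
  then obtain j where j: "j \<in> Field r" "i \<in> underS r j"
    using r by (auto simp: limit_order_def)
  then have "x \<in> underS (dir_image r e) (e j)"
    using i e by (auto simp: underS_def dir_image_def dest: inj_onD)
  then show "\<exists>y\<in>Field (dir_image r e). x \<in> underS (dir_image r e) y"
    using j(1) by (auto simp: dir_image_Field)
qed

lemma carrier_union_struct [simp]: "carrier (union_struct S) = (\<Union>M\<in>S. carrier M)"
  by (simp add: union_struct_def)

lemma union_struct_singleton: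
  assumes "is_struct L M"
  shows "union_struct {M} = (M :: ('a, 'f, 'r) struct)"
proof (rule struct.equality)
  show "fint (union_struct {M}) = fint M"
  proof (intro ext)
    fix f xs
    have "fint M f xs = undefined" if "\<not> set xs \<subseteq> carrier M"
      using assms that by (auto simp: is_struct_def tuples_def)
    then show "fint (union_struct {M}) f xs = fint M f xs"
      by (simp add: union_struct_def cong: conj_cong)
  qed
qed (simp_all add: union_struct_def)

context aec begin

lemma union_of_chain:
  fixes r :: "'i rel"
  assumes r: "limit_order r" and card: "|Field r| \<le>o |UNIV :: 'a set|"
    and chain: "\<And>i j. (i, j) \<in> r \<Longrightarrow> M i \<preceq>\<^bsub>K\<^esub> M j"
  shows "union_struct (M ` Field r) \<in> models K"
    and "\<And>i. i \<in> Field r \<Longrightarrow> M i \<preceq>\<^bsub>K\<^esub> union_struct (M ` Field r)"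
    and "\<And>N. (\<And>i. i \<in> Field r \<Longrightarrow> M i \<preceq>\<^bsub>K\<^esub> N) \<Longrightarrow> union_struct (M ` Field r) \<preceq>\<^bsub>K\<^esub> N"
proof -
  obtain e :: "'i \<Rightarrow> 'a" where e: "inj_on e (Field r)"
    using card unfolding card_of_ordLeq[symmetric] by blast
  let ?s = "dir_image r e"
  define M' where "M' x = M (inv_into (Field r) e x)" for x
  have M'_e: "M' (e i) = M i" if "i \<in> Field r" for i
    using e that by (simp add: M'_def)
  have "M' x \<preceq>\<^bsub>K\<^esub> M' y" if "(x, y) \<in> ?s" for x y
    using that chain M'_e[OF FieldI1] M'_e[OF FieldI2] by (auto simp: dir_image_def)
  moreover have "M' ` Field ?s = M ` Field r"
    using M'_e by (auto simp: dir_image_Field image_iff)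
  ultimately have union: "union_struct (M ` Field r) \<in> models K"
    "\<forall>x\<in>Field ?s. M' x \<preceq>\<^bsub>K\<^esub> union_struct (M ` Field r)"
    "\<forall>N\<in>models K. (\<forall>x\<in>Field ?s. M' x \<preceq>\<^bsub>K\<^esub> N) \<longrightarrow> union_struct (M ` Field r) \<preceq>\<^bsub>K\<^esub> N"
    using AEC_unfolded(8)[rule_format, of ?s M'] limit_order_dir_image[OF r e] by auto
  show "union_struct (M ` Field r) \<in> models K"
    by (rule union(1))
  show "M i \<preceq>\<^bsub>K\<^esub> union_struct (M ` Field r)" if "i \<in> Field r" for i
    using union(2) M'_e that by (auto simp: dir_image_Field)
  show "union_struct (M ` Field r) \<preceq>\<^bsub>K\<^esub> N" if N: "\<And>i. i \<in> Field r \<Longrightarrow> M i \<preceq>\<^bsub>K\<^esub> N" for N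
  proof -
    obtain i where "i \<in> Field r"
      using r by (auto simp: limit_order_def)
    then have "N \<in> models K"
      using N leD(2) by blast
    moreover have "\<forall>x\<in>Field ?s. M' x \<preceq>\<^bsub>K\<^esub> N"
      using N M'_e by (auto simp: dir_image_Field)
    ultimately show ?thesis
      using union(3) by blast
  qed
qed

lemma emb_union:
  fixes r :: "'i rel"
  assumes r: "limit_order r" and card: "|Field r| \<le>o |UNIV :: 'a set|"
    and chain: "\<And>i j. (i, j) \<in> r \<Longrightarrow> M i \<preceq>\<^bsub>K\<^esub> M j"
    and f: "\<And>i. i \<in> Field r \<Longrightarrow> emb f (M i) N"
  shows "emb f (union_struct (M ` Field r)) N"
proof -
  let ?U = "union_struct (M ` Field r)" and ?W = "union_struct ((\<lambda>i. f \<bullet> M i) ` Field r)"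
  note U = union_of_chain[OF r card chain]
  have "inj_on f (carrier ?U)"
    unfolding inj_on_def carrier_union_struct
  proof clarify
    fix x y i j
    assume *: "i \<in> Field r" "x \<in> carrier (M i)" "j \<in> Field r" "y \<in> carrier (M j)" "f x = f y"
    have "(i, j) \<in> r \<or> (j, i) \<in> r"
      using r *(1,3) wo_rel.TOTALS[of r] by (simp add: limit_order_def wo_rel_def)
    then obtain k where "k \<in> Field r" "x \<in> carrier (M k)" "y \<in> carrier (M k)"
      using chain[THEN leD(4)] * by blast
    then show "x = y"
      using embD(3)[OF f] *(5) by (auto dest: inj_onD)
  qed
  moreover have "?W = f \<bullet> ?U"
  proof (rule le_carrier_eqI)
    have image_chain: "f \<bullet> M i \<preceq>\<^bsub>K\<^esub> f \<bullet> M j" if "(i, j) \<in> r" for i j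
      by (rule image_le[OF chain[OF that] embD(3)[OF f[OF FieldI2[OF that]]]])
    show "?W \<preceq>\<^bsub>K\<^esub> f \<bullet> ?U"
      by (rule union_of_chain(3)[OF r card image_chain])
        (use image_le[OF U(2)] \<open>inj_on f (carrier ?U)\<close> in auto)
    show "carrier (f \<bullet> ?U) \<subseteq> carrier ?W"
      by auto
  qed
  moreover have "?W \<preceq>\<^bsub>K\<^esub> N"
  proof (rule union_of_chain(3)[OF r card])
    show "f \<bullet> M i \<preceq>\<^bsub>K\<^esub> f \<bullet> M j" if "(i, j) \<in> r" for i j
      by (rule image_le[OF chain[OF that] embD(3)[OF f[OF FieldI2[OF that]]]])
  qed (rule embD(5)[OF f])
  ultimately show ?thesis
    using U(1) by (simp add: emb_iff)
qed

lemma models_of_cardI: "M \<in> models K \<Longrightarrow> |carrier M| \<le>o \<kappa> \<Longrightarrow> \<kappa> \<le>o |carrier M| \<Longrightarrow> M \<in> models_of_card K \<kappa>"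
  by (simp add: models_of_card_def ordIso_iff_ordLeq)

lemma models_of_cardD:
  assumes "M \<in> models_of_card K \<kappa>"
  shows "M \<in> models K" "|carrier M| =o \<kappa>" "|carrier M| \<le>o \<kappa>" "\<kappa> \<le>o |carrier M|"
  using assms ordIso_iff_ordLeq by (auto simp: models_of_card_def)

lemma models_of_card_extension:
  assumes "M \<in> models_of_card K \<kappa>" "M \<preceq>\<^bsub>K\<^esub> N" "|carrier N| \<le>o \<kappa>"
  shows "N \<in> models_of_card K \<kappa>"
proof (rule models_of_cardI[OF leD(2)[OF assms(2)] assms(3)])
  show "\<kappa> \<le>o |carrier N|"
    using ordLeq_transitive[OF models_of_cardD(4)[OF assms(1)] card_of_mono1[OF leD(4)[OF assms(2)]]] .
qed

lemma models_of_card_image: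
  assumes "M \<in> models_of_card K \<kappa>" "inj_on f (carrier M)"
  shows "f \<bullet> M \<in> models_of_card K \<kappa>"
proof -
  have "bij_betw (inv_into (carrier M) f) (f ` carrier M) (carrier M)"
    by (rule bij_betw_inv_into) (use assms(2) in \<open>simp add: bij_betw_def\<close>)
  then have "|f ` carrier M| =o |carrier M|"
    by (rule card_of_ordIsoI)
  then have "|f ` carrier M| =o \<kappa>"
    using models_of_cardD(2)[OF assms(1)] by (rule ordIso_transitive)
  then show ?thesis
    using image_model[OF models_of_cardD(1)[OF assms(1)] assms(2)] by (simp add: models_of_card_def)
qed

lemma models_of_card_same_card:
  "M \<in> models_of_card K \<kappa> \<Longrightarrow> N \<in> models_of_card K \<kappa> \<Longrightarrow> |carrier M| =o |carrier N|"
  using models_of_cardD(2) ordIso_symmetric ordIso_transitive by blast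

lemma models_of_card_enumeration:
  assumes "M \<in> models_of_card K \<kappa>" "Card_order \<kappa>"
  obtains e where "e ` Field \<kappa> = carrier M"
proof -
  have "|Field \<kappa>| =o |carrier M|"
    using card_of_Field_ordIso[OF assms(2)] models_of_cardD(2)[OF assms(1)]
      ordIso_symmetric ordIso_transitive by blast
  then show ?thesis
    using that unfolding card_of_ordIso[symmetric] bij_betw_def by blast
qed

lemma LS_bound_LS: "LS_bound K (LS K)"
proof -
  have "\<exists>\<kappa>\<in>{\<kappa> :: 'a rel. LS_bound K \<kappa>}. \<forall>\<kappa>'\<in>{\<kappa> :: 'a rel. LS_bound K \<kappa>}. \<kappa> \<le>o \<kappa>'"
  proof (rule exists_minim_Card_order)
    show "{\<kappa> :: 'a rel. LS_bound K \<kappa>} \<noteq> {}"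
      using AEC_unfolded(9) by blast
  qed (simp add: LS_bound_def)
  then show ?thesis
    unfolding LS_def by (rule someI2_ex[where Q = "LS_bound K", OF bexE]) auto
qed

lemma infinite_Field_above_LS:
  assumes "LS K \<le>o \<kappa>" "Card_order \<kappa>"
  shows "infinite (Field \<kappa>)"
proof -
  have "natLeq \<le>o |funs (voc K) <+> rels (voc K)| +c natLeq"
    by (rule ordLeq_csum2[OF natLeq_Card_order])
  then have "natLeq \<le>o \<kappa>"
    using LS_bound_LS assms(1) unfolding LS_bound_def by (meson ordLeq_transitive)
  then have "natLeq \<le>o |Field \<kappa>|"
    using assms(2) card_of_Field_ordIso ordIso_symmetric ordLeq_ordIso_trans by blast
  then show ?thesis
    using infinite_iff_natLeq_ordLeq by blast
qed

lemma LS_submodel: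
  assumes \<kappa>: "LS K \<le>o \<kappa>" "Card_order \<kappa>" and A: "M \<in> models K" "A \<subseteq> carrier M" "|A| \<le>o \<kappa>"
  obtains N where "N \<preceq>\<^bsub>K\<^esub> M" "A \<subseteq> carrier N" "|carrier N| \<le>o \<kappa>"
proof -
  obtain N where N: "N \<preceq>\<^bsub>K\<^esub> M" "A \<subseteq> carrier N" "|carrier N| \<le>o |A| +c LS K"
    using LS_bound_LS A unfolding LS_bound_def by blast
  have "Cinfinite \<kappa>"
    using infinite_Field_above_LS[OF \<kappa>] \<kappa>(2) by (simp add: cinfinite_def)
  then have "|A| +c LS K \<le>o \<kappa>"
    using A(3) \<kappa> LS_bound_LS csum_cinfinite_bound[of "|A|" \<kappa> "LS K"]
    by (simp add: LS_bound_def card_of_Card_order)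
  then show ?thesis
    using that N ordLeq_transitive by blast
qed

lemma LS_submodel_of_card:
  assumes \<kappa>: "LS K \<le>o \<kappa>" "Card_order \<kappa>" and A: "M \<in> models K" "A \<subseteq> carrier M" "|A| \<le>o \<kappa>"
    and M: "\<kappa> \<le>o |carrier M|"
  obtains N where "N \<preceq>\<^bsub>K\<^esub> M" "A \<subseteq> carrier N" "N \<in> models_of_card K \<kappa>"
proof -
  have "|Field \<kappa>| \<le>o |carrier M|"
    using M \<kappa>(2) card_of_Field_ordIso ordIso_ordLeq_trans by blast
  then obtain e where e: "inj_on e (Field \<kappa>)" "e ` Field \<kappa> \<subseteq> carrier M"
    unfolding card_of_ordLeq[symmetric] by blast
  have "|e ` Field \<kappa>| \<le>o \<kappa>"
    using card_of_image card_of_Field_ordIso[OF \<kappa>(2)] ordLeq_ordIso_trans by blast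
  then have "|A \<union> e ` Field \<kappa>| \<le>o \<kappa>"
    using card_of_Un_ordLeq_infinite_Field[OF infinite_Field_above_LS[OF \<kappa>] A(3)] \<kappa>(2) by blast
  then obtain N where N: "N \<preceq>\<^bsub>K\<^esub> M" "A \<union> e ` Field \<kappa> \<subseteq> carrier N" "|carrier N| \<le>o \<kappa>"
    using LS_submodel[OF \<kappa> A(1)] A(2) e(2) by (metis Un_least)
  have "|Field \<kappa>| \<le>o |carrier N|"
    using e(1) N(2) unfolding card_of_ordLeq[symmetric] by blast
  then have "\<kappa> \<le>o |carrier N|"
    using card_of_Field_ordIso[OF \<kappa>(2)] ordIso_symmetric ordIso_ordLeq_trans by blast
  then show ?thesis
    using that N models_of_cardI leD(1) by blast
qed

end

section \<open>Galois types\<close>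

lemma trancl_map:
  assumes "(x, y) \<in> R\<^sup>+" and "\<And>x y. (x, y) \<in> R \<Longrightarrow> (f x, f y) \<in> S"
  shows "(f x, f y) \<in> S\<^sup>+"
  using assms(1) by (induction rule: trancl_induct) (use assms(2) in \<open>auto intro: trancl_into_trancl\<close>)

context aec begin

lemma E_atI:
  assumes "M \<preceq>\<^bsub>K\<^esub> N1" "M \<preceq>\<^bsub>K\<^esub> N2" "a1 \<in> carrier N1" "a2 \<in> carrier N2"
    and "emb f1 N1 N" "emb f2 N2 N" "fixes_pointwise f1 M" "fixes_pointwise f2 M" "f1 a1 = f2 a2"
  shows "((a1, M, N1), (a2, M, N2)) \<in> E_at K"
  using assms embD(2)[OF assms(5)] unfolding E_at_def triples_def by blast

lemma E_atE:
  assumes "((a1, M1, N1), (a2, M2, N2)) \<in> E_at K"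
  obtains f1 f2 N where "M2 = M1" "M1 \<preceq>\<^bsub>K\<^esub> N1" "M1 \<preceq>\<^bsub>K\<^esub> N2" "a1 \<in> carrier N1" "a2 \<in> carrier N2"
    "emb f1 N1 N" "emb f2 N2 N" "fixes_pointwise f1 M1" "fixes_pointwise f2 M1" "f1 a1 = f2 a2"
  using assms that unfolding E_at_def triples_def by blast

lemma sym_E_at: "sym (E_at K)"
proof (rule symI)
  fix s t assume "(s, t) \<in> E_at K"
  then show "(t, s) \<in> E_at K"
    by (cases s; cases t) (auto elim!: E_atE intro: E_atI)
qed

lemma E_at_emb:
  assumes "M \<preceq>\<^bsub>K\<^esub> N" "a \<in> carrier N" "emb f N P" "fixes_pointwise f M"
  shows "((a, M, N), (f a, M, P)) \<in> E_at K"
proof (rule E_atI)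
  show "M \<preceq>\<^bsub>K\<^esub> P"
    by (rule le_of_emb_fixing[OF assms(3,1,4)])
  show "emb id P P"
    using embD(2)[OF assms(3)] by (simp add: emb_id_iff le_refl)
  show "f a \<in> carrier P"
    using embD(4)[OF assms(3)] assms(2) by blast
qed (use assms in \<open>auto simp: fixes_pointwise_def\<close>)

lemma E_at_refl: "M \<preceq>\<^bsub>K\<^esub> N \<Longrightarrow> a \<in> carrier N \<Longrightarrow> ((a, M, N), (a, M, N)) \<in> E_at K"
  using E_at_emb[of M N a id N] by (simp add: emb_id_iff le_refl leD fixes_pointwise_def)

lemma E_at_image:
  assumes \<pi>: "bij \<pi>" and E: "((a, M, N), (b, M', P)) \<in> E_at K"
  shows "((\<pi> a, \<pi> \<bullet> M, \<pi> \<bullet> N), (\<pi> b, \<pi> \<bullet> M', \<pi> \<bullet> P)) \<in> E_at K"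
  using E
proof (rule E_atE)
  fix f g Q
  assume fg: "M' = M" "M \<preceq>\<^bsub>K\<^esub> N" "M \<preceq>\<^bsub>K\<^esub> P" "a \<in> carrier N" "b \<in> carrier P" "emb f N Q" "emb g P Q"
    "fixes_pointwise f M" "fixes_pointwise g M" "f a = g b"
  have emb_conj: "emb (\<pi> \<circ> (h \<circ> inv \<pi>)) (\<pi> \<bullet> R) (\<pi> \<bullet> Q)" if "emb h R Q" for h R
    using emb_comp[OF emb_comp[OF emb_inv_image[OF \<pi> embD(1)[OF that]] that]
        emb_image[OF embD(2)[OF that] bij_inj_on[OF \<pi>]]] .
  show ?thesis
    unfolding fg(1)
    by (rule E_atI[OF _ _ _ _ emb_conj[OF fg(6)] emb_conj[OF fg(7)]])
      (use fg \<pi> in \<open>auto simp: fixes_pointwise_def bij_is_inj intro!: image_le bij_inj_on\<close>)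
qed

lemma trancl_E_at_triple:
  assumes "(s, t) \<in> (E_at K)\<^sup>+"
  shows "t \<in> triples K" "fst (snd t) = fst (snd s)"
  using assms by (induction rule: trancl_induct) (auto simp: E_at_def)

lemma in_gtp_iff: "(b, M', P) \<in> gtp K a M N \<longleftrightarrow> ((a, M, N), (b, M', P)) \<in> (E_at K)\<^sup>+"
  by (simp add: gtp_def)

lemma gtp_eqI: "((a, M, N), (b, M, P)) \<in> (E_at K)\<^sup>+ \<Longrightarrow> gtp K a M N = gtp K b M P"
  unfolding gtp_def using sym_trancl[OF sym_E_at] by (auto dest: symD intro: trancl_trans)

lemma gtp_eqD:
  assumes "M \<preceq>\<^bsub>K\<^esub> P" "b \<in> carrier P" "gtp K a M N = gtp K b M P"
  shows "((a, M, N), (b, M, P)) \<in> (E_at K)\<^sup>+"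
  using assms E_at_refl[OF assms(1,2)] in_gtp_iff by blast

lemma gtp_emb:
  "M \<preceq>\<^bsub>K\<^esub> N \<Longrightarrow> a \<in> carrier N \<Longrightarrow> emb f N P \<Longrightarrow> fixes_pointwise f M \<Longrightarrow> gtp K a M N = gtp K (f a) M P"
  using gtp_eqI E_at_emb by blast

lemma restrict_gtp:
  assumes N1: "N1 \<preceq>\<^bsub>K\<^esub> N" and P: "N \<preceq>\<^bsub>K\<^esub> P" "a \<in> carrier P"
  shows "restrict_type K (gtp K a N P) N1 = gtp K a N1 P"
  unfolding restrict_type_def
proof (rule the_equality)
  have "(a, N, P) \<in> gtp K a N P"
    using E_at_refl[OF P] by (auto simp: in_gtp_iff)
  then show "\<exists>b M Q. (b, M, Q) \<in> gtp K a N P \<and> gtp K a N1 P = gtp K b N1 Q"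
    by blast
next
  define restrict where
    "restrict t = (fst t, if fst (snd t) = N then N1 else fst (snd t), snd (snd t))" for t :: "('a, 'f, 'r) triple"
  have E_at_restrict: "(restrict s, restrict t) \<in> E_at K" if "(s, t) \<in> E_at K" for s t
  proof (cases s, cases t)
    fix c R M d S M' assume st: "s = (c, M, R)" "t = (d, M', S)"
    from that[unfolded st] show ?thesis
    proof (rule E_atE)
      fix f g T
      assume fg: "M' = M" "M \<preceq>\<^bsub>K\<^esub> R" "M \<preceq>\<^bsub>K\<^esub> S" "c \<in> carrier R" "d \<in> carrier S" "emb f R T" "emb g S T"
        "fixes_pointwise f M" "fixes_pointwise g M" "f c = g d"
      have "((c, N1, R), (d, N1, S)) \<in> E_at K" if "M = N"
        by (rule E_atI[OF _ _ fg(4-7)])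
          (use fg leD(4)[OF N1] le_trans[OF N1] that in \<open>auto simp: fixes_pointwise_def\<close>)
      then show ?thesis
        using that st fg(1) by (auto simp: restrict_def)
    qed
  qed
  fix q assume "\<exists>b M Q. (b, M, Q) \<in> gtp K a N P \<and> q = gtp K b N1 Q"
  then obtain b M Q where b: "((a, N, P), (b, M, Q)) \<in> (E_at K)\<^sup>+" "q = gtp K b N1 Q"
    by (auto simp: in_gtp_iff)
  have "((a, N1, P), (b, N1, Q)) \<in> (E_at K)\<^sup>+"
    using trancl_map[OF b(1), of restrict, OF E_at_restrict] trancl_E_at_triple(2)[OF b(1)]
    by (simp add: restrict_def)
  then show "q = gtp K a N1 P"
    using b(2) gtp_eqI by simp
qed

lemma map_gtp:
  assumes N1: "N1 \<preceq>\<^bsub>K\<^esub> P" "a \<in> carrier P" and \<pi>: "bij \<pi>" "\<And>x. x \<in> carrier N1 \<Longrightarrow> \<pi> x = h x"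
  shows "map_type K h N1 (\<pi> \<bullet> N1) (gtp K a N1 P) = gtp K (\<pi> a) (\<pi> \<bullet> N1) (\<pi> \<bullet> P)"
  unfolding map_type_def
proof (rule the_equality)
  have "(a, N1, P) \<in> gtp K a N1 P"
    using E_at_refl[OF N1] by (auto simp: in_gtp_iff)
  then show "\<exists>b Q Q' h'. (b, N1, Q) \<in> gtp K a N1 P \<and> struct_iso (voc K) h' Q Q' \<and>
      (\<forall>x\<in>carrier N1. h' x = h x) \<and> gtp K (\<pi> a) (\<pi> \<bullet> N1) (\<pi> \<bullet> P) = gtp K (h' b) (\<pi> \<bullet> N1) Q'"
    using image_iso[OF leD(2)[OF N1(1)] bij_inj_on[OF \<pi>(1)]] \<pi>(2) by blast
next
  fix q assume "\<exists>b Q Q' h'. (b, N1, Q) \<in> gtp K a N1 P \<and> struct_iso (voc K) h' Q Q' \<and>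
      (\<forall>x\<in>carrier N1. h' x = h x) \<and> q = gtp K (h' b) (\<pi> \<bullet> N1) Q'"
  then obtain b Q Q' h' where b: "((a, N1, P), (b, N1, Q)) \<in> (E_at K)\<^sup>+" and h': "struct_iso (voc K) h' Q Q'"
    "\<And>x. x \<in> carrier N1 \<Longrightarrow> h' x = h x" and q: "q = gtp K (h' b) (\<pi> \<bullet> N1) Q'"
    by (auto simp: in_gtp_iff)
  have Q: "N1 \<preceq>\<^bsub>K\<^esub> Q" "b \<in> carrier Q"
    using trancl_E_at_triple(1)[OF b] by (simp_all add: triples_def)
  have "emb h' Q Q'"
    using emb_image[OF leD(2)[OF Q(1)]] h'(1) by (auto simp: struct_iso_iff)
  then have emb: "emb (h' \<circ> inv \<pi>) (\<pi> \<bullet> Q) Q'"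
    by (rule emb_comp[OF emb_inv_image[OF \<pi>(1) leD(2)[OF Q(1)]]])
  have "gtp K (\<pi> a) (\<pi> \<bullet> N1) (\<pi> \<bullet> P) = gtp K (\<pi> b) (\<pi> \<bullet> N1) (\<pi> \<bullet> Q)"
    using trancl_map[OF b, of "\<lambda>(c, M, N). (\<pi> c, \<pi> \<bullet> M, \<pi> \<bullet> N)"] E_at_image[OF \<pi>(1)]
    by (intro gtp_eqI) auto
  also have "\<dots> = gtp K ((h' \<circ> inv \<pi>) (\<pi> b)) (\<pi> \<bullet> N1) Q'"
  proof (rule gtp_emb[OF _ _ emb])
    show "\<pi> \<bullet> N1 \<preceq>\<^bsub>K\<^esub> \<pi> \<bullet> Q"
      by (rule image_le[OF Q(1) bij_inj_on[OF \<pi>(1)]])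
    show "fixes_pointwise (h' \<circ> inv \<pi>) (\<pi> \<bullet> N1)"
      using h'(2) \<pi>(2)[symmetric] \<pi>(1) by (simp add: fixes_pointwise_def bij_is_inj)
  qed (use Q(2) in simp)
  finally show "q = gtp K (\<pi> a) (\<pi> \<bullet> N1) (\<pi> \<bullet> P)"
    using q \<pi>(1) by (simp add: bij_is_inj)
qed

end

section \<open>Chains of models and of embeddings\<close>

lemma limit_order_infinite_Card_order:
  assumes "Card_order r" "infinite (Field r)"
  shows "limit_order r"
  unfolding limit_order_def
proof (intro conjI ballI)
  show "Well_order r"
    using assms(1) by (simp add: card_order_on_def)
  show "Field r \<noteq> {}"
    using assms(2) by auto
  show "\<exists>j\<in>Field r. i \<in> underS r j" if "i \<in> Field r" for i
    using infinite_Card_order_limit[OF assms that] by (auto simp: underS_def)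
qed

locale aec_card = aec K for K :: "('a, 'f, 'r) aclass" +
  fixes \<kappa> :: "'c rel"
  assumes card_order: "Card_order \<kappa>" and LS_le: "LS K \<le>o \<kappa>"
    and universe: "cardSuc \<kappa> \<le>o |UNIV :: 'a set|"
begin

abbreviation K\<^sub>\<kappa> :: "('a, 'f, 'r) struct set" where "K\<^sub>\<kappa> \<equiv> models_of_card K \<kappa>"

lemma infinite_Field: "infinite (Field \<kappa>)"
  by (rule infinite_Field_above_LS[OF LS_le card_order])

lemma less_card_UNIV: "\<kappa> <o |UNIV :: 'a set|"
  by (rule ordLess_ordLeq_trans[OF cardSuc_greater[OF card_order] universe])

lemma card_Field_leq: "|Field \<kappa>| \<le>o \<kappa>"
  using card_of_Field_ordIso[OF card_order] ordIso_imp_ordLeq by blast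

lemma small: "|A :: 'a set| \<le>o \<kappa> \<Longrightarrow> |A| <o |UNIV :: 'a set|"
  by (rule ordLeq_ordLess_trans[OF _ less_card_UNIV])

lemma infinite_UNIV: "infinite (UNIV :: 'a set)"
proof -
  have "|Field \<kappa>| \<le>o |UNIV :: 'a set|"
    by (rule ordLeq_transitive[OF card_Field_leq ordLess_imp_ordLeq[OF less_card_UNIV]])
  then show ?thesis
    using card_of_ordLeq_infinite infinite_Field by blast
qed

lemma card_Un: "|A| \<le>o \<kappa> \<Longrightarrow> |B| \<le>o \<kappa> \<Longrightarrow> |A \<union> B| \<le>o \<kappa>"
  using card_of_Un_ordLeq_infinite_Field[OF infinite_Field _ _ card_order] by blast

lemma card_UN: "|I| \<le>o \<kappa> \<Longrightarrow> (\<And>i. i \<in> I \<Longrightarrow> |A i| \<le>o \<kappa>) \<Longrightarrow> |\<Union>i\<in>I. A i| \<le>o \<kappa>"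
  using card_of_UNION_ordLeq_infinite_Field[OF infinite_Field card_order] by blast

lemma card_image: "|A| \<le>o \<kappa> \<Longrightarrow> |f ` A| \<le>o \<kappa>"
  by (rule ordLeq_transitive[OF card_of_image])

lemma card_singleton: "|{x}| \<le>o \<kappa>"
  by (rule Card_order_singl_ordLeq[OF card_order]) (use infinite_Field in auto)

lemma card_model: "M \<in> K\<^sub>\<kappa> \<Longrightarrow> |carrier M| \<le>o \<kappa>"
  by (rule models_of_cardD)

lemma model_in_models: "M \<in> K\<^sub>\<kappa> \<Longrightarrow> M \<in> models K"
  by (rule models_of_cardD)

lemma submodel_containing:
  assumes "M \<in> K\<^sub>\<kappa>" "M \<preceq>\<^bsub>K\<^esub> P" "A \<subseteq> carrier P" "|A| \<le>o \<kappa>"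
  obtains N where "N \<in> K\<^sub>\<kappa>" "M \<preceq>\<^bsub>K\<^esub> N" "N \<preceq>\<^bsub>K\<^esub> P" "A \<subseteq> carrier N"
proof -
  have "carrier M \<union> A \<subseteq> carrier P"
    using leD(4)[OF assms(2)] assms(3) by blast
  moreover have "|carrier M \<union> A| \<le>o \<kappa>"
    by (rule card_Un[OF card_model[OF assms(1)] assms(4)])
  moreover have "\<kappa> \<le>o |carrier P|"
    by (rule ordLeq_transitive[OF models_of_cardD(4)[OF assms(1)] card_of_mono1[OF leD(4)[OF assms(2)]]])
  ultimately obtain N where N: "N \<preceq>\<^bsub>K\<^esub> P" "carrier M \<union> A \<subseteq> carrier N" "N \<in> K\<^sub>\<kappa>"
    by (rule LS_submodel_of_card[OF LS_le card_order leD(2)[OF assms(2)]])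
  then show ?thesis
    using that le_of_subset[OF assms(2) N(1)] by simp
qed

lemma submodel_containing_element:
  assumes "M \<in> K\<^sub>\<kappa>" "M \<preceq>\<^bsub>K\<^esub> P" "x \<in> carrier P"
  obtains N where "N \<in> K\<^sub>\<kappa>" "M \<preceq>\<^bsub>K\<^esub> N" "N \<preceq>\<^bsub>K\<^esub> P" "x \<in> carrier N"
  using submodel_containing[OF assms(1,2) _ card_singleton, of x] assms(3) by auto

text \<open>
  Renaming by permutations turns both the given embedding and the first leg of the amalgam into
  inclusions.
\<close>

lemma embedding_amalgamation:
  assumes ap: "amalgamation_in K \<kappa>" and M: "M0 \<in> K\<^sub>\<kappa>" "M1 \<in> K\<^sub>\<kappa>" "M0 \<preceq>\<^bsub>K\<^esub> M1"
    and N: "N \<in> K\<^sub>\<kappa>" and f: "emb f M0 N"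
  obtains N' f' where "N' \<in> K\<^sub>\<kappa>" "N \<preceq>\<^bsub>K\<^esub> N'" "emb f' M1 N'" "\<And>x. x \<in> carrier M0 \<Longrightarrow> f' x = f x"
proof -
  obtain \<pi> where \<pi>: "bij \<pi>" "\<And>x. x \<in> carrier M0 \<Longrightarrow> \<pi> x = f x" "M0 \<preceq>\<^bsub>K\<^esub> inv \<pi> \<bullet> N"
    using emb_extends_to_bij[OF infinite_UNIV small[OF card_model[OF M(1)]] f] by blast
  have inv\<pi>: "bij (inv \<pi>)"
    by (rule bij_imp_bij_inv[OF \<pi>(1)])
  have "inv \<pi> \<bullet> N \<in> K\<^sub>\<kappa>"
    by (rule models_of_card_image[OF N bij_inj_on[OF inv\<pi>]])
  then obtain Q f1 f2 where Q: "emb f1 (inv \<pi> \<bullet> N) Q" "emb f2 M1 Q" "fixes_pointwise f1 M0" "fixes_pointwise f2 M0"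
    using ap M \<pi>(3) unfolding amalgamation_in_def by metis
  have "emb (f1 \<circ> inv \<pi>) N Q"
    by (rule emb_comp[OF emb_image[OF model_in_models[OF N] bij_inj_on[OF inv\<pi>]] Q(1)])
  then obtain \<rho> where \<rho>: "bij \<rho>" "\<And>x. x \<in> carrier N \<Longrightarrow> \<rho> x = (f1 \<circ> inv \<pi>) x" "N \<preceq>\<^bsub>K\<^esub> inv \<rho> \<bullet> Q"
    using emb_extends_to_bij[OF infinite_UNIV small[OF card_model[OF N]]] by blast
  let ?f = "inv \<rho> \<circ> f2"
  have emb: "emb ?f M1 (inv \<rho> \<bullet> Q)"
    by (rule emb_comp[OF Q(2) emb_image[OF embD(2)[OF Q(2)] bij_inj_on[OF bij_imp_bij_inv[OF \<rho>(1)]]]])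
  have agree: "?f x = f x" if x: "x \<in> carrier M0" for x
  proof -
    have "f x \<in> carrier N"
      using embD(4)[OF f] x by blast
    then have "\<rho> (f x) = f1 (inv \<pi> (\<pi> x))"
      using \<rho>(2) \<pi>(2)[OF x] by simp
    also have "\<dots> = f2 x"
      using \<pi>(1) Q(3,4) x by (simp add: bij_is_inj fixes_pointwise_def)
    finally show ?thesis
      using \<rho>(1) by (metis bij_inv_eq_iff comp_apply)
  qed
  obtain N' where N': "N' \<in> K\<^sub>\<kappa>" "N \<preceq>\<^bsub>K\<^esub> N'" "N' \<preceq>\<^bsub>K\<^esub> inv \<rho> \<bullet> Q" "?f ` carrier M1 \<subseteq> carrier N'"
    by (rule submodel_containing[OF N \<rho>(3) embD(4)[OF emb] card_image[OF card_model[OF M(2)]]])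
  show ?thesis
    by (rule that[OF N'(1,2) emb_into[OF emb N'(3,4)] agree])
qed

end

locale aec_chain = aec_card K \<kappa> + index_order r
  for K :: "('a, 'f, 'r) aclass" and \<kappa> :: "'c rel" and r :: "'i rel" +
  assumes card_underS: "\<And>i. i \<in> Field r \<Longrightarrow> |underS i| \<le>o \<kappa>"
    and card_Field: "|Field r| \<le>o |UNIV :: 'a set|"
begin

lemma
  assumes I: "limit_set I" and chain: "\<And>i j. i \<in> I \<Longrightarrow> j \<in> I \<Longrightarrow> (i, j) \<in> r \<Longrightarrow> M i \<preceq>\<^bsub>K\<^esub> M j"
  shows le_chain_union: "i \<in> I \<Longrightarrow> M i \<preceq>\<^bsub>K\<^esub> union_struct (M ` I)"
    and chain_union_le: "(\<And>i. i \<in> I \<Longrightarrow> M i \<preceq>\<^bsub>K\<^esub> N) \<Longrightarrow> union_struct (M ` I) \<preceq>\<^bsub>K\<^esub> N"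
    and emb_chain_union: "(\<And>i. i \<in> I \<Longrightarrow> emb f (M i) N) \<Longrightarrow> emb f (union_struct (M ` I)) N"
proof -
  have "|I| \<le>o |UNIV :: 'a set|"
    using I card_of_mono1 card_Field ordLeq_transitive unfolding limit_set_def by blast
  then have card: "|Field (Restr r I)| \<le>o |UNIV :: 'a set|"
    by (simp add: Field_Restr[OF I])
  have restr: "M i \<preceq>\<^bsub>K\<^esub> M j" if "(i, j) \<in> Restr r I" for i j
    using that chain by blast
  note union = union_of_chain[OF limit_order_Restr[OF I] card restr, unfolded Field_Restr[OF I]]
    and emb = emb_union[OF limit_order_Restr[OF I] card restr, unfolded Field_Restr[OF I]]
  show "M i \<preceq>\<^bsub>K\<^esub> union_struct (M ` I)" if "i \<in> I"
    by (rule union(2)[OF _ that])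
  show "union_struct (M ` I) \<preceq>\<^bsub>K\<^esub> N" if "\<And>i. i \<in> I \<Longrightarrow> M i \<preceq>\<^bsub>K\<^esub> N"
    by (rule union(3)[OF _ that])
  show "emb f (union_struct (M ` I)) N" if "\<And>i. i \<in> I \<Longrightarrow> emb f (M i) N"
    by (rule emb[OF _ that])
qed

lemma chain_union_of_card:
  assumes I: "limit_set I" "|I| \<le>o \<kappa>" and M: "\<And>i. i \<in> I \<Longrightarrow> M i \<in> K\<^sub>\<kappa>"
    and chain: "\<And>i j. i \<in> I \<Longrightarrow> j \<in> I \<Longrightarrow> (i, j) \<in> r \<Longrightarrow> M i \<preceq>\<^bsub>K\<^esub> M j"
  shows "union_struct (M ` I) \<in> K\<^sub>\<kappa>"
proof -
  obtain i where i: "i \<in> I"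
    using I(1) by (auto simp: limit_set_def)
  have "|\<Union>i\<in>I. carrier (M i)| \<le>o \<kappa>"
    by (rule card_UN[OF I(2) card_model[OF M]])
  then show ?thesis
    using models_of_card_extension[OF M[OF i] le_chain_union[where M = M, OF I(1) chain i]] by simp
qed

definition continuous_chain :: "('i \<Rightarrow> ('a, 'f, 'r) struct) \<Rightarrow> bool" where
  "continuous_chain M \<longleftrightarrow> (\<forall>i\<in>Field r. M i \<in> K\<^sub>\<kappa>) \<and> (\<forall>i j. (i, j) \<in> r \<longrightarrow> M i \<preceq>\<^bsub>K\<^esub> M j) \<and>
    (\<forall>d. limit_elem r d \<longrightarrow> M d = union_struct (M ` underS d))"

lemma continuous_chainD:
  assumes "continuous_chain M"
  shows "\<And>i. i \<in> Field r \<Longrightarrow> M i \<in> K\<^sub>\<kappa>" "\<And>i j. (i, j) \<in> r \<Longrightarrow> M i \<preceq>\<^bsub>K\<^esub> M j"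
    "\<And>d. limit_elem r d \<Longrightarrow> M d = union_struct (M ` underS d)"
    "\<And>i j. (i, j) \<in> r \<Longrightarrow> carrier (M i) \<subseteq> carrier (M j)"
  using assms leD(4) by (auto simp: continuous_chain_def)

lemma limit_elem_card_underS: "limit_elem r d \<Longrightarrow> |underS d| \<le>o \<kappa>"
  by (rule card_underS) (simp add: limit_elem_def)

lemma model_chain:
  assumes M0: "M0 \<in> K\<^sub>\<kappa>" "P M0"
    and step: "\<And>i M. i \<in> Field r \<Longrightarrow> M \<in> K\<^sub>\<kappa> \<Longrightarrow> P M \<Longrightarrow> \<exists>M'\<in>K\<^sub>\<kappa>. M \<preceq>\<^bsub>K\<^esub> M' \<and> P M' \<and> St i M M'"
    and union: "\<And>d M. limit_elem r d \<Longrightarrow> (\<And>i. i \<in> underS d \<Longrightarrow> P (M i)) \<Longrightarrow>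
      (\<And>N. (\<And>i. i \<in> underS d \<Longrightarrow> M i \<preceq>\<^bsub>K\<^esub> N) \<Longrightarrow> union_struct (M ` underS d) \<preceq>\<^bsub>K\<^esub> N) \<Longrightarrow>
      P (union_struct (M ` underS d))"
  obtains M where "continuous_chain M" "M zero = M0" "\<And>i. i \<in> Field r \<Longrightarrow> P (M i)"
    "\<And>i. i \<in> Field r \<Longrightarrow> St i (M i) (M (succ i))"
proof -
  let ?P = "\<lambda>i M. M \<in> K\<^sub>\<kappa> \<and> P M"
  obtain M where M: "M zero = M0" "\<And>i. i \<in> Field r \<Longrightarrow> ?P i (M i)" "\<And>i j. (i, j) \<in> r \<Longrightarrow> M i \<preceq>\<^bsub>K\<^esub> M j"
    "\<And>i. i \<in> Field r \<Longrightarrow> St i (M i) (M (succ i))"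
    "\<And>d. limit_elem r d \<Longrightarrow> M d = union_struct (M ` underS d)"
  proof (rule transfinite_chain[where P = ?P and R = "\<lambda>_. le K" and St = St
        and L = "\<lambda>d M. union_struct (M ` underS d)"])
    show "?P zero M0"
      using M0 by simp
    show "\<exists>M'. ?P (succ i) M' \<and> M \<preceq>\<^bsub>K\<^esub> M' \<and> St i M M'" if "i \<in> Field r" "?P i M" for i M
      using step[of i M] that by blast
    show "union_struct (g ` underS d) = union_struct (g' ` underS d)"
      if "\<And>i. i \<in> underS d \<Longrightarrow> g i = g' i" for d g g'
      using that by (simp cong: image_cong)
    show "?P d (union_struct (g ` underS d)) \<and> (\<forall>i\<in>underS d. g i \<preceq>\<^bsub>K\<^esub> union_struct (g ` underS d))"
      if d: "limit_elem r d" and P: "\<And>i. i \<in> underS d \<Longrightarrow> ?P i (g i)"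
        and inc: "\<And>i j. (i, j) \<in> r \<Longrightarrow> j \<in> underS d \<Longrightarrow> g i \<preceq>\<^bsub>K\<^esub> g j" for d g
    proof (intro conjI ballI)
      show "union_struct (g ` underS d) \<in> K\<^sub>\<kappa>"
        by (rule chain_union_of_card[OF limit_set_underS[OF d] limit_elem_card_underS[OF d]])
          (use P inc in auto)
      show "P (union_struct (g ` underS d))"
        by (rule union[OF d]) (use P inc in \<open>auto intro: chain_union_le[OF limit_set_underS[OF d]]\<close>)
      show "g i \<preceq>\<^bsub>K\<^esub> union_struct (g ` underS d)" if "i \<in> underS d" for i
        by (rule le_chain_union[OF limit_set_underS[OF d] inc that])
    qed
  qed (auto intro: le_refl model_in_models le_trans)
  then have "continuous_chain M"
    by (simp add: continuous_chain_def)
  then show ?thesis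
    using that M by blast
qed

abbreviation glued :: "('i \<Rightarrow> ('a, 'f, 'r) struct) \<Rightarrow> ('i \<Rightarrow> 'a \<Rightarrow> 'a) \<Rightarrow> 'i set \<Rightarrow> 'a \<Rightarrow> 'a" where
  "glued M \<equiv> glue (\<lambda>i. carrier (M i))"

lemma emb_glued:
  assumes I: "limit_set I" and chain: "\<And>i j. i \<in> I \<Longrightarrow> j \<in> I \<Longrightarrow> (i, j) \<in> r \<Longrightarrow> M i \<preceq>\<^bsub>K\<^esub> M j"
    and f: "\<And>i. i \<in> I \<Longrightarrow> emb (f i) (M i) N"
    and coherent: "\<And>i j x. i \<in> I \<Longrightarrow> j \<in> I \<Longrightarrow> (i, j) \<in> r \<Longrightarrow> x \<in> carrier (M i) \<Longrightarrow> f j x = f i x"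
  shows "emb (glued M f I) (union_struct (M ` I)) N"
proof (rule emb_chain_union[OF I chain])
  fix i assume "i \<in> I"
  then show "emb (glued M f I) (M i) N"
    using emb_cong[OF f[of i], of "glued M f I"] glue_eq[OF I, of "\<lambda>i. carrier (M i)" f i] coherent by simp
qed

lemma embedding_chain_limit:
  assumes M: "continuous_chain M" and d: "limit_elem r d"
    and f: "\<And>i. i \<in> underS d \<Longrightarrow> emb (f i) (M i) (N i)"
    and N: "\<And>i j. (i, j) \<in> r \<Longrightarrow> j \<in> underS d \<Longrightarrow> N i \<preceq>\<^bsub>K\<^esub> N j"
    and coherent: "\<And>i j x. (i, j) \<in> r \<Longrightarrow> j \<in> underS d \<Longrightarrow> x \<in> carrier (M i) \<Longrightarrow> f j x = f i x"
  shows "emb (glued M f (underS d)) (M d) (union_struct (N ` underS d))"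
    and "i \<in> underS d \<Longrightarrow> N i \<preceq>\<^bsub>K\<^esub> union_struct (N ` underS d)"
    and "i \<in> underS d \<Longrightarrow> x \<in> carrier (M i) \<Longrightarrow> glued M f (underS d) x = f i x"
proof -
  note I = limit_set_underS[OF d]
  show N_le: "N i \<preceq>\<^bsub>K\<^esub> union_struct (N ` underS d)" if "i \<in> underS d" for i
    by (rule le_chain_union[OF I N that])
  show "glued M f (underS d) x = f i x" if "i \<in> underS d" "x \<in> carrier (M i)"
    using glue_eq[OF I, of "\<lambda>i. carrier (M i)" f] coherent that by simp
  have "emb (glued M f (underS d)) (union_struct (M ` underS d)) (union_struct (N ` underS d))"
    by (rule emb_glued[OF I]) (use continuous_chainD(2)[OF M] emb_le[OF f N_le] coherent in blast)+
  then show "emb (glued M f (underS d)) (M d) (union_struct (N ` underS d))"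
    by (simp add: continuous_chainD(3)[OF M d])
qed

lemma embedding_chain:
  assumes M: "continuous_chain M" and N0: "G N0" "emb f0 (M zero) N0"
    and step: "\<And>i f N. i \<in> Field r \<Longrightarrow> G N \<Longrightarrow> emb f (M i) N \<Longrightarrow>
      \<exists>f' N'. G N' \<and> N \<preceq>\<^bsub>K\<^esub> N' \<and> emb f' (M (succ i)) N' \<and> (\<forall>x\<in>carrier (M i). f' x = f x)"
    and union: "\<And>d N. limit_elem r d \<Longrightarrow> (\<And>i. i \<in> underS d \<Longrightarrow> G (N i)) \<Longrightarrow>
      (\<And>i j. (i, j) \<in> r \<Longrightarrow> j \<in> underS d \<Longrightarrow> N i \<preceq>\<^bsub>K\<^esub> N j) \<Longrightarrow> G (union_struct (N ` underS d))"
  obtains f N where "N zero = N0" "\<And>x. x \<in> carrier (M zero) \<Longrightarrow> f x = f0 x"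
    "\<And>i. i \<in> Field r \<Longrightarrow> G (N i) \<and> emb f (M i) (N i)" "\<And>i j. (i, j) \<in> r \<Longrightarrow> N i \<preceq>\<^bsub>K\<^esub> N j"
proof -
  note MD = continuous_chainD[OF M]
  let ?P = "\<lambda>i s. G (snd s) \<and> emb (fst s) (M i) (snd s)"
  let ?R = "\<lambda>i s t. (\<forall>x\<in>carrier (M i). fst t x = fst s x) \<and> snd s \<preceq>\<^bsub>K\<^esub> snd t"
  let ?L = "\<lambda>d g. (glued M (\<lambda>i. fst (g i)) (underS d), union_struct ((\<lambda>i. snd (g i)) ` underS d))"
  have limit_step: "?P d (?L d g) \<and> (\<forall>i\<in>underS d. ?R i (g i) (?L d g))"
    if d: "limit_elem r d" and P: "\<And>i. i \<in> underS d \<Longrightarrow> ?P i (g i)"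
      and R: "\<And>i j. (i, j) \<in> r \<Longrightarrow> j \<in> underS d \<Longrightarrow> ?R i (g i) (g j)" for d g
    using embedding_chain_limit[OF M d, of "\<lambda>i. fst (g i)" "\<lambda>i. snd (g i)"] P R
      union[OF d, of "\<lambda>i. snd (g i)"] by simp
  obtain g where g: "g zero = (f0, N0)" "\<And>i. i \<in> Field r \<Longrightarrow> ?P i (g i)" "\<And>i j. (i, j) \<in> r \<Longrightarrow> ?R i (g i) (g j)"
  proof (rule transfinite_chain[where P = ?P and R = ?R and St = "\<lambda>_ _ _. True" and L = ?L])
    show "?P zero (f0, N0)"
      using N0 by simp
    show "?R i s s" if "?P i s" for i s
      using that embD(2) le_refl by blast
    show "?R i s u" if "(i, j) \<in> r" "?R i s t" "?R j t u" for i j s t u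
      using that MD(4)[OF that(1)] le_trans[of "snd s" "snd t" "snd u"] by (simp add: subset_iff)
    show "\<exists>s'. ?P (succ i) s' \<and> ?R i s s' \<and> True" if "i \<in> Field r" "?P i s" for i s
      using step[of i "snd s" "fst s"] that by auto
    show "?L d g = ?L d g'" if "\<And>i. i \<in> underS d \<Longrightarrow> g i = g' i" for d g g'
      using that glue_cong[of "underS d" "\<lambda>i. fst (g i)" "\<lambda>i. fst (g' i)"] by (simp cong: image_cong)
  qed (rule limit_step, simp_all)
  let ?f = "glued M (\<lambda>i. fst (g i)) (Field r)"
  have f: "?f x = fst (g i) x" if "i \<in> Field r" "x \<in> carrier (M i)" for i x
    using glue_eq[OF limit_set_Field, of "\<lambda>i. carrier (M i)" "\<lambda>i. fst (g i)"] g(3) that by simp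
  show ?thesis
  proof (rule that[of "\<lambda>i. snd (g i)" ?f])
    show "G (snd (g i)) \<and> emb ?f (M i) (snd (g i))" if i: "i \<in> Field r" for i
      using g(2)[OF i] emb_cong[of "fst (g i)" "M i" "snd (g i)" ?f] f[OF i] by simp
  qed (use f[OF zero_in_Field] g(1,3) in simp_all)
qed

end

sublocale aec_card \<subseteq> short: aec_chain K \<kappa> \<kappa>
proof unfold_locales
  show "limit_order \<kappa>"
    by (rule limit_order_infinite_Card_order[OF card_order infinite_Field])
  show "|underS \<kappa> i| \<le>o \<kappa>" if "i \<in> Field \<kappa>" for i
    by (rule ordLess_imp_ordLeq[OF card_of_underS[OF card_order that]])
  show "|Field \<kappa>| \<le>o |UNIV :: 'a set|"
    by (rule ordLeq_transitive[OF card_Field_leq ordLess_imp_ordLeq[OF less_card_UNIV]])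
qed

sublocale aec_card \<subseteq> long: aec_chain K \<kappa> "cardSuc \<kappa>"
proof unfold_locales
  have cardSuc: "Card_order (cardSuc \<kappa>)"
    by (rule cardSuc_Card_order[OF card_order])
  show "limit_order (cardSuc \<kappa>)"
    by (rule limit_order_infinite_Card_order[OF cardSuc])
      (simp add: cardSuc_finite[OF card_order] infinite_Field)
  show "|underS (cardSuc \<kappa>) i| \<le>o \<kappa>" if "i \<in> Field (cardSuc \<kappa>)" for i
    using card_of_underS[OF cardSuc that] cardSuc_ordLeq_ordLess[OF card_order card_of_Card_order] by blast
  show "|Field (cardSuc \<kappa>)| \<le>o |UNIV :: 'a set|"
    using universe card_of_Field_ordIso[OF cardSuc] ordIso_ordLeq_trans by blast
qed

context aec_card begin

lemma cardSuc_not_leq: "\<not> cardSuc \<kappa> \<le>o \<kappa>"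
  using cardSuc_greater[OF card_order] not_ordLess_ordLeq by blast

lemma card_long_chain_union:
  assumes "long.continuous_chain M"
  shows "|\<Union>i\<in>Field (cardSuc \<kappa>). carrier (M i)| \<le>o cardSuc \<kappa>"
proof (rule card_of_UNION_ordLeq_infinite_Field)
  show "infinite (Field (cardSuc \<kappa>))"
    by (simp add: cardSuc_finite[OF card_order] infinite_Field)
  show "Card_order (cardSuc \<kappa>)"
    by (rule cardSuc_Card_order[OF card_order])
  then show "|Field (cardSuc \<kappa>)| \<le>o cardSuc \<kappa>"
    using card_of_Field_ordIso ordIso_imp_ordLeq by blast
  show "\<forall>i\<in>Field (cardSuc \<kappa>). |carrier (M i)| \<le>o cardSuc \<kappa>"
    using long.continuous_chainD(1)[OF assms] card_model cardSuc_ordLeq[OF card_order] ordLeq_transitive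
    by blast
qed

lemma model_of_cardSuc:
  assumes "K\<^sub>\<kappa> \<noteq> {}" "no_maximal_model_in K \<kappa>"
  shows "models_of_card K (cardSuc \<kappa>) \<noteq> {}"
proof -
  obtain M0 where M0: "M0 \<in> K\<^sub>\<kappa>"
    using assms(1) by blast
  obtain M where M: "long.continuous_chain M" "\<And>i. i \<in> Field (cardSuc \<kappa>) \<Longrightarrow> M i \<noteq> M (long.succ i)"
    by (rule long.model_chain[OF M0, of "\<lambda>_. True" "\<lambda>_ M N. M \<noteq> N"])
      (use assms(2) in \<open>auto simp: no_maximal_model_in_def\<close>)
  note MD = long.continuous_chainD[OF M(1)]
  let ?U = "union_struct (M ` Field (cardSuc \<kappa>))"
  have "carrier (M i) \<subset> carrier (M j)" if "i \<in> long.underS j" for i j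
  proof -
    have i: "i \<in> Field (cardSuc \<kappa>)"
      by (rule long.underS_FieldD(1)[OF that])
    have "\<not> carrier (M (long.succ i)) \<subseteq> carrier (M i)"
      using le_carrier_eqI[OF MD(2)[OF long.leq_succ[OF i]]] M(2)[OF i] by blast
    then show ?thesis
      using MD(4)[OF long.leq_succ[OF i]] MD(4)[OF long.succ_leq[OF that]] by blast
  qed
  then have "|Field (cardSuc \<kappa>)| \<le>o |carrier ?U|"
    using long.card_Field_leq_strict_chain[of "\<lambda>i. carrier (M i)"] by simp
  then have "cardSuc \<kappa> \<le>o |carrier ?U|"
    using card_of_Field_ordIso[OF cardSuc_Card_order[OF card_order]] ordIso_symmetric ordIso_ordLeq_trans
    by blast
  moreover have "?U \<in> models K"
    using leD(2)[OF long.le_chain_union[OF long.limit_set_Field MD(2) long.zero_in_Field]] .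
  ultimately have "?U \<in> models_of_card K (cardSuc \<kappa>)"
    using card_long_chain_union[OF M(1)] by (intro models_of_cardI) simp_all
  then show ?thesis by blast
qed

lemma filtration:
  assumes B: "B \<in> models_of_card K (cardSuc \<kappa>)" and M0: "M0 \<in> K\<^sub>\<kappa>" "M0 \<preceq>\<^bsub>K\<^esub> B"
    and extension: "\<And>M. M \<in> K\<^sub>\<kappa> \<Longrightarrow> M \<preceq>\<^bsub>K\<^esub> B \<Longrightarrow> \<exists>M'\<in>K\<^sub>\<kappa>. M \<preceq>\<^bsub>K\<^esub> M' \<and> M' \<preceq>\<^bsub>K\<^esub> B \<and> St M M'"
    and mono: "\<And>M M' M''. M \<in> K\<^sub>\<kappa> \<Longrightarrow> M'' \<in> K\<^sub>\<kappa> \<Longrightarrow> St M M' \<Longrightarrow> M' \<preceq>\<^bsub>K\<^esub> M'' \<Longrightarrow> St M M''"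
  obtains M where "long.continuous_chain M" "M long.zero = M0" "\<And>i. i \<in> Field (cardSuc \<kappa>) \<Longrightarrow> M i \<preceq>\<^bsub>K\<^esub> B"
    "\<And>i. i \<in> Field (cardSuc \<kappa>) \<Longrightarrow> St (M i) (M (long.succ i))" "B = union_struct (M ` Field (cardSuc \<kappa>))"
proof -
  let ?r = "cardSuc \<kappa>"
  obtain e where e: "e ` Field ?r = carrier B"
    by (rule models_of_card_enumeration[OF B cardSuc_Card_order[OF card_order]])
  obtain M where M: "long.continuous_chain M" "M long.zero = M0" "\<And>i. i \<in> Field ?r \<Longrightarrow> M i \<preceq>\<^bsub>K\<^esub> B"
    "\<And>i. i \<in> Field ?r \<Longrightarrow> St (M i) (M (long.succ i)) \<and> e i \<in> carrier (M (long.succ i))"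
  proof (rule long.model_chain[of M0 "\<lambda>M. M \<preceq>\<^bsub>K\<^esub> B" "\<lambda>i M M'. St M M' \<and> e i \<in> carrier M'"])
    show "\<exists>M'\<in>K\<^sub>\<kappa>. M \<preceq>\<^bsub>K\<^esub> M' \<and> M' \<preceq>\<^bsub>K\<^esub> B \<and> St M M' \<and> e i \<in> carrier M'"
      if i: "i \<in> Field ?r" and M: "M \<in> K\<^sub>\<kappa>" "M \<preceq>\<^bsub>K\<^esub> B" for i M
    proof -
      obtain M1 where M1: "M1 \<in> K\<^sub>\<kappa>" "M \<preceq>\<^bsub>K\<^esub> M1" "M1 \<preceq>\<^bsub>K\<^esub> B" "St M M1"
        using extension[OF M] by blast
      have "e i \<in> carrier B"
        using e i by blast
      then obtain M2 where M2: "M2 \<in> K\<^sub>\<kappa>" "M1 \<preceq>\<^bsub>K\<^esub> M2" "M2 \<preceq>\<^bsub>K\<^esub> B" "e i \<in> carrier M2"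
        by (rule submodel_containing_element[OF M1(1,3)])
      have "St M M2"
        by (rule mono[OF M(1) M2(1) M1(4) M2(2)])
      then show ?thesis
        using M2 le_trans[OF M1(2) M2(2)] by blast
    qed
  qed (use M0 in simp_all)
  let ?U = "union_struct (M ` Field ?r)"
  have "?U \<preceq>\<^bsub>K\<^esub> B"
    by (rule long.chain_union_le[OF long.limit_set_Field long.continuous_chainD(2)[OF M(1)] M(3)])
  moreover have "carrier B \<subseteq> carrier ?U"
    unfolding e[symmetric] using M(4) long.succ_in_Field by fastforce
  ultimately have "?U = B"
    by (rule le_carrier_eqI)
  then show ?thesis
    using that M by blast
qed

end

section \<open>Homogeneous models\<close>

definition (in aec) automorphism :: "('a, 'f, 'r) struct \<Rightarrow> ('a \<Rightarrow> 'a) \<Rightarrow> bool" where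
  "automorphism M \<sigma> \<longleftrightarrow> bij \<sigma> \<and> \<sigma> \<bullet> M = M"

locale homogeneous_model = aec_card K \<kappa> for K :: "('a, 'f, 'r) aclass" and \<kappa> :: "'c rel" +
  fixes B :: "('a, 'f, 'r) struct"
  assumes B_model: "B \<in> models K"
    and extension_embeds: "\<And>M N. M \<in> K\<^sub>\<kappa> \<Longrightarrow> M \<preceq>\<^bsub>K\<^esub> B \<Longrightarrow> N \<in> K\<^sub>\<kappa> \<Longrightarrow> M \<preceq>\<^bsub>K\<^esub> N \<Longrightarrow>
      \<exists>g. emb g N B \<and> fixes_pointwise g M"
    and emb_extends: "\<And>M f. M \<in> K\<^sub>\<kappa> \<Longrightarrow> M \<preceq>\<^bsub>K\<^esub> B \<Longrightarrow> emb f M B \<Longrightarrow>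
      \<exists>\<sigma>. automorphism B \<sigma> \<and> (\<forall>x\<in>carrier M. \<sigma> x = f x)"
begin

abbreviation aut :: "('a \<Rightarrow> 'a) \<Rightarrow> bool" where "aut \<equiv> automorphism B"

lemma aut_bij: "aut \<sigma> \<Longrightarrow> bij \<sigma>"
  by (simp add: automorphism_def)

lemma aut_id: "aut id"
  by (simp add: automorphism_def image_model_id B_model)

lemma aut_comp: "aut \<sigma> \<Longrightarrow> aut \<tau> \<Longrightarrow> aut (\<sigma> \<circ> \<tau>)"
  using image_model_comp[of B \<tau> \<sigma>] by (simp add: automorphism_def B_model bij_inj_on bij_comp)

lemma aut_inv: "aut \<sigma> \<Longrightarrow> aut (inv \<sigma>)"
  using inv_image[of \<sigma> B] by (simp add: automorphism_def B_model bij_imp_bij_inv)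

lemma aut_inv_simps [simp]: "aut \<sigma> \<Longrightarrow> inv \<sigma> (\<sigma> x) = x" "aut \<sigma> \<Longrightarrow> \<sigma> (inv \<sigma> x) = x"
  using aut_bij by (simp_all add: bij_is_inj bij_is_surj surj_f_inv_f)

lemma aut_in_B: "aut \<sigma> \<Longrightarrow> \<sigma> x \<in> carrier B \<longleftrightarrow> x \<in> carrier B"
  using inj_image_mem_iff[of \<sigma> x "carrier B"] carrier_image_struct[of "voc K" \<sigma> B]
  by (simp add: automorphism_def bij_is_inj)

lemma aut_image_le: "aut \<sigma> \<Longrightarrow> N \<preceq>\<^bsub>K\<^esub> B \<Longrightarrow> \<sigma> \<bullet> N \<preceq>\<^bsub>K\<^esub> B"
  using image_le[of N B \<sigma>] by (simp add: automorphism_def bij_inj_on)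

lemma aut_emb: "aut \<sigma> \<Longrightarrow> N \<preceq>\<^bsub>K\<^esub> B \<Longrightarrow> emb \<sigma> N B"
  using aut_image_le leD(1) aut_bij by (simp add: emb_iff bij_inj_on)

lemma aut_image_card: "aut \<sigma> \<Longrightarrow> N \<in> K\<^sub>\<kappa> \<Longrightarrow> \<sigma> \<bullet> N \<in> K\<^sub>\<kappa>"
  by (rule models_of_card_image) (simp_all add: aut_bij bij_inj_on)

definition conjugate :: "'a set \<Rightarrow> 'a \<Rightarrow> 'a \<Rightarrow> bool" where
  "conjugate A a b \<longleftrightarrow> (\<exists>\<sigma>. aut \<sigma> \<and> (\<forall>x\<in>A. \<sigma> x = x) \<and> \<sigma> a = b)"

lemma conjugateI: "aut \<sigma> \<Longrightarrow> (\<And>x. x \<in> A \<Longrightarrow> \<sigma> x = x) \<Longrightarrow> \<sigma> a = b \<Longrightarrow> conjugate A a b"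
  by (auto simp: conjugate_def)

lemma conjugateE:
  assumes "conjugate A a b"
  obtains \<sigma> where "aut \<sigma>" "\<forall>x\<in>A. \<sigma> x = x" "\<sigma> a = b"
  using assms by (auto simp: conjugate_def)

lemma conjugate_agree:
  assumes "aut \<sigma>" "aut \<tau>" "\<And>x. x \<in> A \<Longrightarrow> \<sigma> x = \<tau> x"
  shows "conjugate (\<tau> ` A) (\<sigma> a) (\<tau> a)"
proof (rule conjugateI)
  show "aut (\<tau> \<circ> inv \<sigma>)"
    by (intro aut_comp aut_inv assms(1,2))
  show "(\<tau> \<circ> inv \<sigma>) y = y" if "y \<in> \<tau> ` A" for y
    using that assms(3)[symmetric] assms(1) by auto
qed (simp add: assms(1))

lemma conjugate_sym:
  assumes "conjugate A a b"
  shows "conjugate A b a"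
proof -
  obtain \<sigma> where "aut \<sigma>" "\<forall>x\<in>A. \<sigma> x = x" "\<sigma> a = b"
    by (rule conjugateE[OF assms])
  then show ?thesis
    using conjugate_agree[OF _ aut_id, of \<sigma> A a] by simp
qed

lemma conjugate_trans:
  assumes "conjugate A a b" "conjugate A b c"
  shows "conjugate A a c"
proof -
  obtain \<sigma> where "aut \<sigma>" "\<forall>x\<in>A. \<sigma> x = x" "\<sigma> a = b"
    by (rule conjugateE[OF assms(1)])
  moreover obtain \<tau> where "aut \<tau>" "\<forall>x\<in>A. \<tau> x = x" "\<tau> b = c"
    by (rule conjugateE[OF assms(2)])
  ultimately show ?thesis
    using conjugateI[OF aut_comp, of \<tau> \<sigma> A a c] by simp
qed

lemma conjugate_mono: "conjugate A a b \<Longrightarrow> A' \<subseteq> A \<Longrightarrow> conjugate A' a b"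
  by (auto simp: conjugate_def)

lemma conjugate_image:
  assumes "aut \<rho>" "conjugate A a b"
  shows "conjugate (\<rho> ` A) (\<rho> a) (\<rho> b)"
proof -
  obtain \<sigma> where \<sigma>: "aut \<sigma>" "\<forall>x\<in>A. \<sigma> x = x" "\<sigma> a = b"
    by (rule conjugateE[OF assms(2)])
  show ?thesis
  proof (rule conjugateI)
    show "aut (\<rho> \<circ> \<sigma> \<circ> inv \<rho>)"
      by (intro aut_comp aut_inv assms(1) \<sigma>(1))
    show "(\<rho> \<circ> \<sigma> \<circ> inv \<rho>) y = y" if "y \<in> \<rho> ` A" for y
      using that \<sigma>(2) assms(1) by auto
  qed (simp add: assms(1) \<sigma>(3))
qed

lemma conjugate_inv_image: "aut \<rho> \<Longrightarrow> conjugate (\<rho> ` A) a b \<Longrightarrow> conjugate A (inv \<rho> a) (inv \<rho> b)"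
  using conjugate_image[OF aut_inv, of \<rho> "\<rho> ` A" a b] by (simp add: image_image)

lemma embeddings_conjugate:
  assumes P: "P \<in> K\<^sub>\<kappa>" "N \<preceq>\<^bsub>K\<^esub> P" and c: "c \<in> carrier P"
    and g: "emb g P B" "fixes_pointwise g N" and h: "emb h P B" "fixes_pointwise h N"
  shows "conjugate (carrier N) (g c) (h c)"
proof -
  let ?k = "h \<circ> inv_into (carrier P) g"
  have gP: "g \<bullet> P \<in> K\<^sub>\<kappa>" "g \<bullet> P \<preceq>\<^bsub>K\<^esub> B"
    using models_of_card_image[OF P(1)] embD(3,5)[OF g(1)] by blast+
  have "emb ?k (g \<bullet> P) B"
    using emb_comp[OF emb_inv_into[OF g(1) gP(2)] h(1)] by simp
  then obtain \<sigma> where \<sigma>: "aut \<sigma>" "\<forall>y\<in>carrier (g \<bullet> P). \<sigma> y = ?k y"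
    using emb_extends[OF gP] by blast
  have \<sigma>g: "\<sigma> (g x) = h x" if "x \<in> carrier P" for x
    using \<sigma>(2) embD(3)[OF g(1)] that by simp
  show ?thesis
  proof (rule conjugateI[OF \<sigma>(1)])
    show "\<sigma> x = x" if "x \<in> carrier N" for x
      using \<sigma>g[of x] leD(4)[OF P(2)] g(2) h(2) that by (auto simp: fixes_pointwise_def)
  qed (rule \<sigma>g[OF c])
qed

text \<open>
  Since \<open>P\<close> may have any cardinality, only a submodel \<open>P0\<close> of cardinality \<open>\<kappa>\<close> is embedded into \<open>B\<close>.
\<close>

definition realization :: "('a, 'f, 'r) struct \<Rightarrow> ('a, 'f, 'r) struct \<Rightarrow> 'a \<Rightarrow> 'a \<Rightarrow> bool" where
  "realization N P c c' \<longleftrightarrow> (\<exists>P0 g. P0 \<in> K\<^sub>\<kappa> \<and> N \<preceq>\<^bsub>K\<^esub> P0 \<and> P0 \<preceq>\<^bsub>K\<^esub> P \<and> c \<in> carrier P0 \<and>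
     emb g P0 B \<and> fixes_pointwise g N \<and> g c = c')"

lemma realizationE:
  assumes "realization N P c c'"
  obtains P0 g where "P0 \<in> K\<^sub>\<kappa>" "N \<preceq>\<^bsub>K\<^esub> P0" "P0 \<preceq>\<^bsub>K\<^esub> P" "c \<in> carrier P0"
    "emb g P0 B" "fixes_pointwise g N" "g c = c'"
  using assms by (auto simp: realization_def)

lemma realization_exists:
  assumes N: "N \<in> K\<^sub>\<kappa>" "N \<preceq>\<^bsub>K\<^esub> B" and P: "N \<preceq>\<^bsub>K\<^esub> P" "c \<in> carrier P"
  obtains c' where "realization N P c c'"
proof -
  obtain P0 where P0: "P0 \<in> K\<^sub>\<kappa>" "N \<preceq>\<^bsub>K\<^esub> P0" "P0 \<preceq>\<^bsub>K\<^esub> P" "c \<in> carrier P0"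
    by (rule submodel_containing_element[OF N(1) P])
  then show ?thesis
    using that extension_embeds[OF N P0(1,2)] unfolding realization_def by blast
qed

lemma realization_self:
  assumes "N \<in> K\<^sub>\<kappa>" "N \<preceq>\<^bsub>K\<^esub> B" "a \<in> carrier B"
  shows "realization N B a a"
proof -
  obtain P0 where P0: "P0 \<in> K\<^sub>\<kappa>" "N \<preceq>\<^bsub>K\<^esub> P0" "P0 \<preceq>\<^bsub>K\<^esub> B" "a \<in> carrier P0"
    by (rule submodel_containing_element[OF assms])
  then have "emb id P0 B" "fixes_pointwise id N"
    by (simp_all add: emb_id_iff fixes_pointwise_def)
  with P0 show ?thesis
    unfolding realization_def by (intro exI[of _ P0] exI[of _ id]) simp
qed

lemma realizations_conjugate:
  assumes N: "N \<in> K\<^sub>\<kappa>" "N \<preceq>\<^bsub>K\<^esub> B" and E: "((c, N, P), (d, N, Q)) \<in> E_at K"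
    and c': "realization N P c c'" and d': "realization N Q d d'"
  shows "conjugate (carrier N) c' d'"
proof -
  obtain P0 g where P0: "P0 \<in> K\<^sub>\<kappa>" "N \<preceq>\<^bsub>K\<^esub> P0" "P0 \<preceq>\<^bsub>K\<^esub> P" "c \<in> carrier P0"
    and g: "emb g P0 B" "fixes_pointwise g N" "g c = c'"
    using c' by (rule realizationE)
  obtain Q0 h where Q0: "Q0 \<in> K\<^sub>\<kappa>" "N \<preceq>\<^bsub>K\<^esub> Q0" "Q0 \<preceq>\<^bsub>K\<^esub> Q" "d \<in> carrier Q0"
    and h: "emb h Q0 B" "fixes_pointwise h N" "h d = d'"
    using d' by (rule realizationE)
  obtain f1 f2 R where R: "emb f1 P R" "emb f2 Q R" "fixes_pointwise f1 N" "fixes_pointwise f2 N" "f1 c = f2 d"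
    using E by (rule E_atE)
  have f: "emb f1 P0 R" "emb f2 Q0 R"
    using emb_restrict R(1,2) P0(3) Q0(3) by blast+
  have NR: "N \<preceq>\<^bsub>K\<^esub> R"
    by (rule le_of_emb_fixing[OF f(1) P0(2) R(3)])
  have "f1 ` carrier P0 \<union> f2 ` carrier Q0 \<subseteq> carrier R"
    using embD(4)[OF f(1)] embD(4)[OF f(2)] by blast
  moreover have "|f1 ` carrier P0 \<union> f2 ` carrier Q0| \<le>o \<kappa>"
    by (intro card_Un card_image card_model P0(1) Q0(1))
  ultimately obtain R0 where R0: "R0 \<in> K\<^sub>\<kappa>" "N \<preceq>\<^bsub>K\<^esub> R0" "R0 \<preceq>\<^bsub>K\<^esub> R"
    "f1 ` carrier P0 \<union> f2 ` carrier Q0 \<subseteq> carrier R0"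
    by (rule submodel_containing[OF N(1) NR])
  obtain k where k: "emb k R0 B" "fixes_pointwise k N"
    using extension_embeds[OF N R0(1,2)] by blast
  have kf: "emb (k \<circ> f1) P0 B" "emb (k \<circ> f2) Q0 B"
    using emb_comp[OF emb_into[OF f(1) R0(3)] k(1)] emb_comp[OF emb_into[OF f(2) R0(3)] k(1)] R0(4) by simp_all
  have kf_fixes: "fixes_pointwise (k \<circ> f1) N" "fixes_pointwise (k \<circ> f2) N"
    using R(3,4) k(2) by (simp_all add: fixes_pointwise_def)
  have "conjugate (carrier N) c' ((k \<circ> f1) c)"
    using embeddings_conjugate[OF P0(1,2,4) g(1,2) kf(1) kf_fixes(1)] g(3) by simp
  moreover have "conjugate (carrier N) ((k \<circ> f2) d) d'"
    using embeddings_conjugate[OF Q0(1,2,4) kf(2) kf_fixes(2) h(1,2)] h(3) by simp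
  ultimately show ?thesis
    using conjugate_trans R(5) by simp
qed

lemma gtp_eq_iff_conjugate:
  assumes N: "N \<in> K\<^sub>\<kappa>" "N \<preceq>\<^bsub>K\<^esub> B" and ab: "a \<in> carrier B" "b \<in> carrier B"
  shows "gtp K a N B = gtp K b N B \<longleftrightarrow> conjugate (carrier N) a b"
proof
  assume "conjugate (carrier N) a b"
  then obtain \<sigma> where "aut \<sigma>" "fixes_pointwise \<sigma> N" "\<sigma> a = b"
    by (auto simp: conjugate_def fixes_pointwise_def)
  then show "gtp K a N B = gtp K b N B"
    using gtp_emb[OF N(2) ab(1) aut_emb] le_refl[OF B_model] by metis
next
  assume "gtp K a N B = gtp K b N B"
  then have "((a, N, B), (b, N, B)) \<in> (E_at K)\<^sup>+"
    using gtp_eqD N(2) ab(2) by blast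
  moreover have "conjugate (carrier N) a c'"
    if "((a, N, B), t) \<in> (E_at K)\<^sup>+" "realization N (snd (snd t)) (fst t) c'" for t c'
    using that
  proof (induction t arbitrary: c' rule: trancl_induct)
    case (base t)
    then obtain c P where "t = (c, N, P)"
      by (cases t) (auto elim!: E_atE)
    then show ?case
      using realizations_conjugate[OF N _ realization_self[OF N ab(1)]] base by simp
  next
    case (step t u)
    then obtain c P d Q where tu: "t = (c, N, P)" "u = (d, N, Q)"
      using trancl_E_at_triple(2)[OF step.hyps(1)] by (cases t; cases u) (auto elim!: E_atE)
    then have P: "N \<preceq>\<^bsub>K\<^esub> P" "c \<in> carrier P"
      using trancl_E_at_triple(1)[OF step.hyps(1)] by (simp_all add: triples_def)
    obtain c'' where c'': "realization N P c c''"
      by (rule realization_exists[OF N P])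
    then have "conjugate (carrier N) a c''"
      using step.IH tu(1) by simp
    moreover have "conjugate (carrier N) c'' c'"
      using realizations_conjugate[OF N _ c''] step.hyps(2) step.prems tu by simp
    ultimately show ?case
      by (rule conjugate_trans)
  qed
  ultimately show "conjugate (carrier N) a b"
    using realization_self[OF N ab(2)] by force
qed

section \<open>Non-splitting types\<close>

text \<open>
  Over submodels of \<open>B\<close> an isomorphism \<open>N\<^sub>1 \<cong> N\<^sub>2\<close> is the restriction of an automorphism \<open>\<sigma>\<close>, and then
  \<open>\<sigma>(p \<restriction> N\<^sub>1) = p \<restriction> N\<^sub>2\<close>, for \<open>p\<close> the type of \<open>a\<close>, says that \<open>\<sigma> a\<close> and \<open>a\<close> are conjugate over \<open>N\<^sub>2\<close>.
\<close>

definition nonsplit :: "'a \<Rightarrow> ('a, 'f, 'r) struct \<Rightarrow> ('a, 'f, 'r) struct \<Rightarrow> bool" where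
  "nonsplit a N M \<longleftrightarrow> (\<forall>N1 \<sigma>. N1 \<in> K\<^sub>\<kappa> \<longrightarrow> M \<preceq>\<^bsub>K\<^esub> N1 \<longrightarrow> N1 \<preceq>\<^bsub>K\<^esub> N \<longrightarrow> aut \<sigma> \<longrightarrow> fixes_pointwise \<sigma> M \<longrightarrow>
     \<sigma> ` carrier N1 \<subseteq> carrier N \<longrightarrow> conjugate (\<sigma> ` carrier N1) (\<sigma> a) a)"

lemma nonsplitD:
  assumes "nonsplit a N M" "N1 \<in> K\<^sub>\<kappa>" "M \<preceq>\<^bsub>K\<^esub> N1" "N1 \<preceq>\<^bsub>K\<^esub> N" "aut \<sigma>" "fixes_pointwise \<sigma> M"
    "\<sigma> ` carrier N1 \<subseteq> carrier N"
  shows "conjugate (\<sigma> ` carrier N1) (\<sigma> a) a"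
  using assms unfolding nonsplit_def by blast

lemma map_restrict_gtp_eq_iff:
  assumes N: "N \<preceq>\<^bsub>K\<^esub> B" and a: "a \<in> carrier B" and N1: "N1 \<in> K\<^sub>\<kappa>" "N1 \<preceq>\<^bsub>K\<^esub> N"
    and \<sigma>: "aut \<sigma>" "\<And>x. x \<in> carrier N1 \<Longrightarrow> \<sigma> x = h x" "\<sigma> \<bullet> N1 \<preceq>\<^bsub>K\<^esub> N"
  shows "map_type K h N1 (\<sigma> \<bullet> N1) (restrict_type K (gtp K a N B) N1) =
      restrict_type K (gtp K a N B) (\<sigma> \<bullet> N1) \<longleftrightarrow>
    conjugate (\<sigma> ` carrier N1) (\<sigma> a) a"
proof -
  have "map_type K h N1 (\<sigma> \<bullet> N1) (gtp K a N1 B) = gtp K (\<sigma> a) (\<sigma> \<bullet> N1) B"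
    using map_gtp[OF le_trans[OF N1(2) N] a aut_bij[OF \<sigma>(1)] \<sigma>(2)] \<sigma>(1) by (simp add: automorphism_def)
  then show ?thesis
    using gtp_eq_iff_conjugate[OF aut_image_card[OF \<sigma>(1) N1(1)] le_trans[OF \<sigma>(3) N], of "\<sigma> a" a]
    by (simp add: restrict_gtp[OF N1(2) N a] restrict_gtp[OF \<sigma>(3) N a] aut_in_B[OF \<sigma>(1)] a)
qed

lemma not_splits_over_imp_nonsplit:
  assumes N: "N \<preceq>\<^bsub>K\<^esub> B" and a: "a \<in> carrier B"
    and not_splits: "\<not> splits_over K \<kappa> (gtp K a N B) N M"
  shows "nonsplit a N M"
  unfolding nonsplit_def
proof (intro allI impI)
  fix N1 \<sigma>
  assume N1: "N1 \<in> K\<^sub>\<kappa>" "M \<preceq>\<^bsub>K\<^esub> N1" "N1 \<preceq>\<^bsub>K\<^esub> N"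
    and \<sigma>: "aut \<sigma>" "fixes_pointwise \<sigma> M" "\<sigma> ` carrier N1 \<subseteq> carrier N"
  have N1B: "N1 \<preceq>\<^bsub>K\<^esub> B"
    by (rule le_trans[OF N1(3) N])
  have "\<sigma> \<bullet> N1 \<preceq>\<^bsub>K\<^esub> N"
    by (rule le_of_subset[OF aut_image_le[OF \<sigma>(1) N1B] N]) (simp add: \<sigma>(3))
  moreover have "M \<preceq>\<^bsub>K\<^esub> \<sigma> \<bullet> N1"
    by (rule le_of_emb_fixing[OF emb_image N1(2) \<sigma>(2)])
      (use model_in_models[OF N1(1)] aut_bij[OF \<sigma>(1)] in \<open>auto intro: bij_inj_on\<close>)
  moreover have "struct_iso (voc K) \<sigma> N1 (\<sigma> \<bullet> N1)"
    by (rule image_iso[OF model_in_models[OF N1(1)] bij_inj_on[OF aut_bij[OF \<sigma>(1)]]])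
  ultimately show "conjugate (\<sigma> ` carrier N1) (\<sigma> a) a"
    using not_splits N1 aut_image_card[OF \<sigma>(1) N1(1)] \<sigma>(2) map_restrict_gtp_eq_iff[OF N a N1(1,3) \<sigma>(1) refl]
    unfolding splits_over_def by blast
qed

lemma nonsplit_imp_not_splits_over:
  assumes N: "N \<preceq>\<^bsub>K\<^esub> B" and a: "a \<in> carrier B" and ns: "nonsplit a N M"
  shows "\<not> splits_over K \<kappa> (gtp K a N B) N M"
proof
  assume "splits_over K \<kappa> (gtp K a N B) N M"
  then obtain N1 N2 h where N1: "N1 \<in> K\<^sub>\<kappa>" "M \<preceq>\<^bsub>K\<^esub> N1" "N1 \<preceq>\<^bsub>K\<^esub> N" and N2: "N2 \<preceq>\<^bsub>K\<^esub> N"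
    and h: "struct_iso (voc K) h N1 N2" "fixes_pointwise h M"
    and neq: "map_type K h N1 N2 (restrict_type K (gtp K a N B) N1) \<noteq> restrict_type K (gtp K a N B) N2"
    unfolding splits_over_def by blast
  have hN1: "inj_on h (carrier N1)" "N2 = h \<bullet> N1"
    using h(1) by (simp_all add: struct_iso_iff)
  then have "emb h N1 B"
    using le_trans[OF N2 N] model_in_models[OF N1(1)] by (simp add: emb_iff)
  then obtain \<sigma> where \<sigma>: "aut \<sigma>" "\<And>x. x \<in> carrier N1 \<Longrightarrow> \<sigma> x = h x"
    using emb_extends[OF N1(1) le_trans[OF N1(3) N]] by blast
  have N2_eq: "N2 = \<sigma> \<bullet> N1"
    using image_model_cong[OF model_in_models[OF N1(1)] hN1(1), of \<sigma>] \<sigma>(2) hN1(2) by simp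
  then have "\<sigma> ` carrier N1 \<subseteq> carrier N"
    using leD(4)[OF N2] by simp
  moreover have "fixes_pointwise \<sigma> M"
    using h(2) \<sigma>(2) leD(4)[OF N1(2)] by (auto simp: fixes_pointwise_def)
  ultimately have "conjugate (\<sigma> ` carrier N1) (\<sigma> a) a"
    by (intro nonsplitD[OF ns N1 \<sigma>(1)])
  then show False
    using neq map_restrict_gtp_eq_iff[OF N a N1(1,3) \<sigma>] N2 unfolding N2_eq by blast
qed

lemma nonsplit_restrict:
  assumes "nonsplit a N M" "N' \<preceq>\<^bsub>K\<^esub> N"
  shows "nonsplit a N' M"
  unfolding nonsplit_def
proof (intro allI impI)
  fix N1 \<sigma>
  assume "N1 \<in> K\<^sub>\<kappa>" "M \<preceq>\<^bsub>K\<^esub> N1" "N1 \<preceq>\<^bsub>K\<^esub> N'" "aut \<sigma>" "fixes_pointwise \<sigma> M" "\<sigma> ` carrier N1 \<subseteq> carrier N'"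
  then show "conjugate (\<sigma> ` carrier N1) (\<sigma> a) a"
    using nonsplitD[OF assms(1)] le_trans[OF _ assms(2)] subset_trans[OF _ leD(4)[OF assms(2)]] by simp
qed

lemma nonsplit_conjugate:
  assumes ns: "nonsplit a N M" and ab: "conjugate (carrier N) a b"
  shows "nonsplit b N M"
  unfolding nonsplit_def
proof (intro allI impI)
  fix N1 \<sigma>
  assume N1: "N1 \<in> K\<^sub>\<kappa>" "M \<preceq>\<^bsub>K\<^esub> N1" "N1 \<preceq>\<^bsub>K\<^esub> N"
    and \<sigma>: "aut \<sigma>" "fixes_pointwise \<sigma> M" "\<sigma> ` carrier N1 \<subseteq> carrier N"
  have "conjugate (\<sigma> ` carrier N1) (\<sigma> b) (\<sigma> a)"
    by (rule conjugate_image[OF \<sigma>(1) conjugate_mono[OF conjugate_sym[OF ab] leD(4)[OF N1(3)]]])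
  moreover have "conjugate (\<sigma> ` carrier N1) (\<sigma> a) a"
    by (rule nonsplitD[OF ns N1 \<sigma>])
  moreover have "conjugate (\<sigma> ` carrier N1) a b"
    by (rule conjugate_mono[OF ab \<sigma>(3)])
  ultimately show "conjugate (\<sigma> ` carrier N1) (\<sigma> b) b"
    using conjugate_trans by blast
qed

lemma universal_over_mono:
  assumes "universal_over K N M" "N \<preceq>\<^bsub>K\<^esub> N'" "M \<in> K\<^sub>\<kappa>" "N' \<in> K\<^sub>\<kappa>"
  shows "universal_over K N' M"
  unfolding universal_over_def
proof (intro conjI ballI impI)
  show "M \<preceq>\<^bsub>K\<^esub> N'"
    using assms(1) by (intro le_trans[OF _ assms(2)]) (simp add: universal_over_def)
  show "|carrier N'| =o |carrier M|"
    by (rule models_of_card_same_card[OF assms(4,3)])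
  fix P assume "P \<in> models_of_card K |carrier M|" "M \<preceq>\<^bsub>K\<^esub> P"
  then obtain f where "emb f P N" "fixes_pointwise f M"
    using assms(1) unfolding universal_over_def by blast
  then show "\<exists>f. emb f P N' \<and> fixes_pointwise f M"
    using emb_le assms(2) by blast
qed

lemma universal_overE:
  assumes "universal_over K N M" "M \<in> K\<^sub>\<kappa>" "N' \<in> K\<^sub>\<kappa>" "M \<preceq>\<^bsub>K\<^esub> N'"
  obtains f where "emb f N' N" "fixes_pointwise f M"
proof -
  have "N' \<in> models_of_card K |carrier M|"
    using model_in_models[OF assms(3)] models_of_card_same_card[OF assms(3,2)] by (simp add: models_of_card_def)
  then show ?thesis
    using assms(1,4) that unfolding universal_over_def by blast
qed

lemma nonsplit_inv_image:
  assumes ns: "nonsplit a N' M" and \<sigma>: "aut \<sigma>" "fixes_pointwise \<sigma> M" "\<sigma> ` carrier N \<subseteq> carrier N'"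
    and N: "N \<preceq>\<^bsub>K\<^esub> B" "N' \<preceq>\<^bsub>K\<^esub> B"
  shows "nonsplit (inv \<sigma> a) N M"
  unfolding nonsplit_def
proof (intro allI impI)
  fix N1 \<tau>
  assume N1: "N1 \<in> K\<^sub>\<kappa>" "M \<preceq>\<^bsub>K\<^esub> N1" "N1 \<preceq>\<^bsub>K\<^esub> N"
    and \<tau>: "aut \<tau>" "fixes_pointwise \<tau> M" "\<tau> ` carrier N1 \<subseteq> carrier N"
  let ?\<tau> = "\<sigma> \<circ> \<tau> \<circ> inv \<sigma>"
  have image: "?\<tau> ` carrier (\<sigma> \<bullet> N1) = \<sigma> ` \<tau> ` carrier N1"
    using \<sigma>(1) by (simp add: image_image)
  have "conjugate (?\<tau> ` carrier (\<sigma> \<bullet> N1)) (?\<tau> a) a"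
  proof (rule nonsplitD[OF ns])
    show "\<sigma> \<bullet> N1 \<in> K\<^sub>\<kappa>"
      by (rule aut_image_card[OF \<sigma>(1) N1(1)])
    show "M \<preceq>\<^bsub>K\<^esub> \<sigma> \<bullet> N1"
      by (rule le_of_emb_fixing[OF emb_image[OF model_in_models[OF N1(1)]] N1(2) \<sigma>(2)])
        (rule bij_inj_on[OF aut_bij[OF \<sigma>(1)]])
    show "\<sigma> \<bullet> N1 \<preceq>\<^bsub>K\<^esub> N'"
      by (rule le_of_subset[OF aut_image_le[OF \<sigma>(1) le_trans[OF N1(3) N(1)]] N(2)])
        (use \<sigma>(3) leD(4)[OF N1(3)] in auto)
    show "?\<tau> ` carrier (\<sigma> \<bullet> N1) \<subseteq> carrier N'"
      unfolding image using \<sigma>(3) \<tau>(3) by blast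
    have "inv \<sigma> x = x" if "x \<in> carrier M" for x
      using aut_inv_simps(1)[OF \<sigma>(1), of x] \<sigma>(2) that by (simp add: fixes_pointwise_def)
    then show "fixes_pointwise ?\<tau> M"
      using \<sigma>(2) \<tau>(2) by (simp add: fixes_pointwise_def)
    show "aut ?\<tau>"
      by (intro aut_comp aut_inv \<sigma>(1) \<tau>(1))
  qed
  then have "conjugate (\<sigma> ` \<tau> ` carrier N1) (\<sigma> (\<tau> (inv \<sigma> a))) a"
    unfolding image by simp
  from conjugate_inv_image[OF \<sigma>(1) this]
  show "conjugate (\<tau> ` carrier N1) (\<tau> (inv \<sigma> a)) (inv \<sigma> a)"
    by (simp add: \<sigma>(1))
qed

text \<open>
  An automorphism \<open>\<sigma>\<close> over \<open>M0\<close> that maps \<open>M2\<close> into \<open>M1\<close> pulls the type of \<open>a\<close> over \<open>M1\<close> back to a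
  type over \<open>M2\<close>; it extends the type over \<open>M1\<close> since the latter does not split over \<open>M0\<close>.
\<close>

lemma nonsplit_extension:
  assumes univ: "universal_over K M1 M0" and M0: "M0 \<in> K\<^sub>\<kappa>" and M1: "M1 \<in> K\<^sub>\<kappa>" "M1 \<preceq>\<^bsub>K\<^esub> B"
    and a: "a \<in> carrier B" "a \<notin> carrier M1" "nonsplit a M1 M0"
    and M2: "M2 \<in> K\<^sub>\<kappa>" "M0 \<preceq>\<^bsub>K\<^esub> M2" "M2 \<preceq>\<^bsub>K\<^esub> B"
  obtains b where "b \<in> carrier B" "b \<notin> carrier M2" "nonsplit b M2 M0"
    "M1 \<preceq>\<^bsub>K\<^esub> M2 \<Longrightarrow> conjugate (carrier M1) a b"
proof -
  obtain f where f: "emb f M2 M1" "fixes_pointwise f M0"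
    by (rule universal_overE[OF univ M0 M2(1,2)])
  obtain \<sigma> where \<sigma>: "aut \<sigma>" "\<And>x. x \<in> carrier M2 \<Longrightarrow> \<sigma> x = f x"
    using emb_extends[OF M2(1,3) emb_le[OF f(1) M1(2)]] by blast
  have \<sigma>_M2: "\<sigma> ` carrier M2 \<subseteq> carrier M1"
    using embD(4)[OF f(1)] \<sigma>(2) by auto
  have \<sigma>_M0: "fixes_pointwise \<sigma> M0"
    using f(2) \<sigma>(2) leD(4)[OF M2(2)] by (auto simp: fixes_pointwise_def)
  show ?thesis
  proof (rule that[of "inv \<sigma> a"])
    show "inv \<sigma> a \<in> carrier B"
      by (simp add: aut_in_B[OF aut_inv[OF \<sigma>(1)]] a(1))
    show "inv \<sigma> a \<notin> carrier M2"
      using \<sigma>_M2 a(2) aut_inv_simps(2)[OF \<sigma>(1), of a] by (metis image_subset_iff)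
    show "nonsplit (inv \<sigma> a) M2 M0"
      by (rule nonsplit_inv_image[OF a(3) \<sigma>(1) \<sigma>_M0 \<sigma>_M2 M2(3) M1(2)])
  next
    assume M12: "M1 \<preceq>\<^bsub>K\<^esub> M2"
    have M01: "M0 \<preceq>\<^bsub>K\<^esub> M1"
      using univ by (simp add: universal_over_def)
    have "conjugate (\<sigma> ` carrier M1) (\<sigma> a) a"
      by (rule nonsplitD[OF a(3) M1(1) M01 le_refl[OF model_in_models[OF M1(1)]] \<sigma>(1) \<sigma>_M0])
        (use \<sigma>_M2 leD(4)[OF M12] in blast)
    from conjugate_inv_image[OF \<sigma>(1) this] show "conjugate (carrier M1) a (inv \<sigma> a)"
      by (simp add: \<sigma>(1))
  qed
qed

end

section \<open>Chains of automorphisms\<close>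

locale homogeneous_chain = homogeneous_model K \<kappa> B + aec_chain K \<kappa> r
  for K :: "('a, 'f, 'r) aclass" and \<kappa> :: "'c rel" and B and r :: "'i rel"
begin

definition submodel_chain :: "('i \<Rightarrow> ('a, 'f, 'r) struct) \<Rightarrow> bool" where
  "submodel_chain M \<longleftrightarrow> continuous_chain M \<and> (\<forall>i\<in>Field r. M i \<preceq>\<^bsub>K\<^esub> B)"

lemma submodel_chainD:
  assumes "submodel_chain M"
  shows "continuous_chain M" "i \<in> Field r \<Longrightarrow> M i \<in> K\<^sub>\<kappa>" "i \<in> Field r \<Longrightarrow> M i \<preceq>\<^bsub>K\<^esub> B"
    "(i, j) \<in> r \<Longrightarrow> M i \<preceq>\<^bsub>K\<^esub> M j" "(i, j) \<in> r \<Longrightarrow> carrier (M i) \<subseteq> carrier (M j)"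
    "limit_elem r d \<Longrightarrow> M d = union_struct (M ` underS d)"
  using assms continuous_chainD[of M] by (auto simp: submodel_chain_def)

definition aut_limit ::
    "('i \<Rightarrow> ('a, 'f, 'r) struct) \<Rightarrow> 'i \<Rightarrow> ('i \<Rightarrow> 'a \<Rightarrow> 'a) \<Rightarrow> 'a \<Rightarrow> 'a" where
  "aut_limit M d \<phi> = (SOME \<tau>. aut \<tau> \<and> (\<forall>x\<in>carrier (M d). \<tau> x = glued M \<phi> (underS d) x))"

lemma emb_glued_auts:
  assumes M: "submodel_chain M" and I: "limit_set I"
    and \<phi>: "\<And>i. i \<in> I \<Longrightarrow> aut (\<phi> i)"
    and coherent: "\<And>i j x. (i, j) \<in> r \<Longrightarrow> j \<in> I \<Longrightarrow> x \<in> carrier (M i) \<Longrightarrow> \<phi> j x = \<phi> i x"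
  shows "emb (glued M \<phi> I) (union_struct (M ` I)) B"
    and "i \<in> I \<Longrightarrow> x \<in> carrier (M i) \<Longrightarrow> glued M \<phi> I x = \<phi> i x"
proof -
  have "emb (\<phi> i) (M i) B" if "i \<in> I" for i
    using aut_emb[OF \<phi>[OF that]] submodel_chainD(3)[OF M] I that by (auto simp: limit_set_def)
  then show "emb (glued M \<phi> I) (union_struct (M ` I)) B"
    by (intro emb_glued[OF I]) (use submodel_chainD(4)[OF M] coherent in blast)+
  show "glued M \<phi> I x = \<phi> i x" if "i \<in> I" "x \<in> carrier (M i)"
    using glue_eq[OF I _ that(1), where C = "\<lambda>i. carrier (M i)" and g = \<phi>] coherent that(2) by simp
qed

lemma aut_limit:
  assumes M: "submodel_chain M" and d: "limit_elem r d"
    and \<phi>: "\<And>i. i \<in> underS d \<Longrightarrow> aut (\<phi> i)"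
    and coherent: "\<And>i j x. (i, j) \<in> r \<Longrightarrow> j \<in> underS d \<Longrightarrow> x \<in> carrier (M i) \<Longrightarrow> \<phi> j x = \<phi> i x"
  shows "aut (aut_limit M d \<phi>)"
    and "i \<in> underS d \<Longrightarrow> x \<in> carrier (M i) \<Longrightarrow> aut_limit M d \<phi> x = \<phi> i x"
proof -
  have dF: "d \<in> Field r"
    using d by (simp add: limit_elem_def)
  have glued: "emb (glued M \<phi> (underS d)) (M d) B"
    "\<And>i x. i \<in> underS d \<Longrightarrow> x \<in> carrier (M i) \<Longrightarrow> glued M \<phi> (underS d) x = \<phi> i x"
    using emb_glued_auts[OF M limit_set_underS[OF d], of \<phi>] \<phi> coherent submodel_chainD(6)[OF M d]
    by simp_all
  from someI_ex[OF emb_extends[OF submodel_chainD(2,3)[OF M dF] glued(1)]]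
  have limit: "aut (aut_limit M d \<phi>)" "\<And>x. x \<in> carrier (M d) \<Longrightarrow> aut_limit M d \<phi> x = glued M \<phi> (underS d) x"
    by (simp_all add: aut_limit_def)
  show "aut (aut_limit M d \<phi>)"
    by (rule limit(1))
  show "aut_limit M d \<phi> x = \<phi> i x" if "i \<in> underS d" "x \<in> carrier (M i)"
    using limit(2) glued(2)[OF that] submodel_chainD(5)[OF M underS_leq[OF that(1)]] that(2) by auto
qed

lemma automorphism_chain:
  assumes M: "submodel_chain M" and base: "aut \<phi>0" "Q zero \<phi>0"
    and step: "\<And>i \<phi>. i \<in> Field r \<Longrightarrow> aut \<phi> \<Longrightarrow> Q i \<phi> \<Longrightarrow>
      \<exists>\<phi>'. aut \<phi>' \<and> Q (succ i) \<phi>' \<and> (\<forall>x\<in>carrier (M i). \<phi>' x = \<phi> x) \<and> St i \<phi> \<phi>'"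
    and limit: "\<And>d \<phi> \<psi>. limit_elem r d \<Longrightarrow> aut \<psi> \<Longrightarrow> (\<And>i. i \<in> underS d \<Longrightarrow> aut (\<phi> i) \<and> Q i (\<phi> i)) \<Longrightarrow>
      (\<And>i x. i \<in> underS d \<Longrightarrow> x \<in> carrier (M i) \<Longrightarrow> \<psi> x = \<phi> i x) \<Longrightarrow> Q d \<psi>"
  obtains \<phi> where "\<phi> zero = \<phi>0" "\<And>i. i \<in> Field r \<Longrightarrow> aut (\<phi> i)" "\<And>i. i \<in> Field r \<Longrightarrow> Q i (\<phi> i)"
    "\<And>i j x. (i, j) \<in> r \<Longrightarrow> x \<in> carrier (M i) \<Longrightarrow> \<phi> j x = \<phi> i x"
    "\<And>i. i \<in> Field r \<Longrightarrow> St i (\<phi> i) (\<phi> (succ i))" "\<And>d. limit_elem r d \<Longrightarrow> \<phi> d = aut_limit M d \<phi>"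
proof -
  let ?P = "\<lambda>i \<phi>. aut \<phi> \<and> Q i \<phi>" and ?R = "\<lambda>i \<phi> \<psi>. \<forall>x\<in>carrier (M i). \<psi> x = \<phi> x"
  obtain \<phi> where \<phi>: "\<phi> zero = \<phi>0" "\<And>i. i \<in> Field r \<Longrightarrow> ?P i (\<phi> i)"
    "\<And>i j. (i, j) \<in> r \<Longrightarrow> ?R i (\<phi> i) (\<phi> j)" "\<And>i. i \<in> Field r \<Longrightarrow> St i (\<phi> i) (\<phi> (succ i))"
    "\<And>d. limit_elem r d \<Longrightarrow> \<phi> d = aut_limit M d \<phi>"
  proof (rule transfinite_chain[where P = ?P and R = ?R and St = St and L = "aut_limit M"])
    show "?P zero \<phi>0"
      using base by simp
    show "?R i \<phi> \<chi>" if "(i, j) \<in> r" "?R i \<phi> \<psi>" "?R j \<psi> \<chi>" for i j \<phi> \<psi> \<chi>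
      using that submodel_chainD(5)[OF M that(1)] by (simp add: subset_iff)
    show "\<exists>\<psi>. ?P (succ i) \<psi> \<and> ?R i \<phi> \<psi> \<and> St i \<phi> \<psi>" if "i \<in> Field r" "?P i \<phi>" for i \<phi>
      using step[OF that(1), of \<phi>] that(2) by blast
    show "aut_limit M d \<phi> = aut_limit M d \<psi>" if "\<And>i. i \<in> underS d \<Longrightarrow> \<phi> i = \<psi> i" for d \<phi> \<psi>
      using glue_cong[of "underS d" \<phi> \<psi>] that by (simp add: aut_limit_def)
    show "?P d (aut_limit M d \<phi>) \<and> (\<forall>i\<in>underS d. ?R i (\<phi> i) (aut_limit M d \<phi>))"
      if d: "limit_elem r d" and P: "\<And>i. i \<in> underS d \<Longrightarrow> ?P i (\<phi> i)"
        and R: "\<And>i j. (i, j) \<in> r \<Longrightarrow> j \<in> underS d \<Longrightarrow> ?R i (\<phi> i) (\<phi> j)" for d \<phi>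
    proof -
      have L: "aut (aut_limit M d \<phi>)"
        "\<And>i x. i \<in> underS d \<Longrightarrow> x \<in> carrier (M i) \<Longrightarrow> aut_limit M d \<phi> x = \<phi> i x"
        using aut_limit[OF M d] P R by simp_all
      then show ?thesis
        using limit[OF d L(1) P L(2)] by simp
    qed
  qed (simp, rule that)
  then show ?thesis
    using that[of \<phi>] by simp
qed

definition tower :: "('i \<Rightarrow> ('a, 'f, 'r) struct) \<Rightarrow> ('i \<Rightarrow> 'a \<Rightarrow> 'a) \<Rightarrow> ('i \<Rightarrow> 'a \<Rightarrow> 'a) \<Rightarrow> bool" where
  "tower M \<sigma> \<phi> \<longleftrightarrow> \<phi> zero = id \<and> (\<forall>i\<in>Field r. \<phi> (succ i) = \<phi> i \<circ> \<sigma> i) \<and>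
     (\<forall>d. limit_elem r d \<longrightarrow> \<phi> d = aut_limit M d \<phi>)"

lemma tower_exists:
  assumes M: "submodel_chain M"
    and \<sigma>: "\<And>i. i \<in> Field r \<Longrightarrow> aut (\<sigma> i)" "\<And>i. i \<in> Field r \<Longrightarrow> fixes_pointwise (\<sigma> i) (M i)"
  obtains \<phi> where "tower M \<sigma> \<phi>" "\<And>i. i \<in> Field r \<Longrightarrow> aut (\<phi> i)"
    "\<And>i j x. (i, j) \<in> r \<Longrightarrow> x \<in> carrier (M i) \<Longrightarrow> \<phi> j x = \<phi> i x"
proof -
  obtain \<phi> where "\<phi> zero = id" "\<And>i. i \<in> Field r \<Longrightarrow> aut (\<phi> i)"
    "\<And>i j x. (i, j) \<in> r \<Longrightarrow> x \<in> carrier (M i) \<Longrightarrow> \<phi> j x = \<phi> i x"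
    "\<And>i. i \<in> Field r \<Longrightarrow> \<phi> (succ i) = \<phi> i \<circ> \<sigma> i" "\<And>d. limit_elem r d \<Longrightarrow> \<phi> d = aut_limit M d \<phi>"
  proof (rule automorphism_chain[OF M aut_id, where Q = "\<lambda>_ _. True" and St = "\<lambda>i \<phi> \<psi>. \<psi> = \<phi> \<circ> \<sigma> i"])
    show "\<exists>\<psi>. aut \<psi> \<and> True \<and> (\<forall>x\<in>carrier (M i). \<psi> x = \<phi> x) \<and> \<psi> = \<phi> \<circ> \<sigma> i"
      if "i \<in> Field r" "aut \<phi>" for i \<phi>
      using that \<sigma>[OF that(1)] aut_comp by (simp add: fixes_pointwise_def)
  qed (rule TrueI, rule TrueI, rule that)
  then show ?thesis
    using that[of \<phi>] by (simp add: tower_def)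
qed

lemma tower_unique:
  assumes "tower M \<sigma> \<phi>" "tower M \<sigma>' \<phi>'" and "k \<in> Field r" "\<And>i. i \<in> underS k \<Longrightarrow> \<sigma> i = \<sigma>' i"
  shows "\<phi> k = \<phi>' k"
  using assms(3,4)
proof (induction k rule: transfinite_induct)
  case zero
  then show ?case
    using assms(1,2) by (simp add: tower_def)
next
  case (succ i)
  then have "\<phi> i = \<phi>' i" "\<sigma> i = \<sigma>' i"
    by (simp_all add: underS_succ)
  then show ?case
    using assms(1,2) succ.hyps by (simp add: tower_def)
next
  case (limit d)
  have "\<phi> i = \<phi>' i" if "i \<in> underS d" for i
    using limit.IH[OF that] limit.prems underS_leq_trans[OF _ underS_leq[OF that]] by blast
  then have "aut_limit M d \<phi> = aut_limit M d \<phi>'"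
    using glue_cong[of "underS d" \<phi> \<phi>'] by (simp add: aut_limit_def)
  then show ?case
    using assms(1,2) limit.hyps by (simp add: tower_def)
qed

lemma conjugate_branches:
  assumes M: "submodel_chain M" and i: "i \<in> underS d"
    and \<phi>: "tower M \<sigma> \<phi>" "\<And>j. j \<in> Field r \<Longrightarrow> aut (\<phi> j)"
      "\<And>j k x. (j, k) \<in> r \<Longrightarrow> x \<in> carrier (M j) \<Longrightarrow> \<phi> k x = \<phi> j x"
    and \<psi>: "tower M \<tau> \<psi>" "\<And>j. j \<in> Field r \<Longrightarrow> aut (\<psi> j)"
      "\<And>j k x. (j, k) \<in> r \<Longrightarrow> x \<in> carrier (M j) \<Longrightarrow> \<psi> k x = \<psi> j x"
    and \<sigma>\<tau>: "\<And>j. j \<in> underS i \<Longrightarrow> \<sigma> j = \<tau> j" "\<tau> i = id"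
    and C: "C \<subseteq> carrier (M (succ i))" "\<sigma> i ` C \<subseteq> carrier (M (succ i))"
    and conj: "conjugate D (\<phi> d a) (\<psi> d a)" "\<phi> i ` carrier (M (succ i)) \<subseteq> D"
    and \<sigma>i: "aut (\<sigma> i)"
  shows "conjugate (\<sigma> i ` C) (\<sigma> i a) a"
proof -
  have iF: "i \<in> Field r" and dF: "d \<in> Field r"
    using underS_FieldD[OF i] by blast+
  have \<psi>i: "\<psi> i = \<phi> i"
    by (rule tower_unique[OF \<phi>(1) \<psi>(1) iF \<sigma>\<tau>(1), symmetric])
  have \<phi>_succ: "\<phi> (succ i) = \<phi> i \<circ> \<sigma> i" and \<psi>_succ: "\<psi> (succ i) = \<phi> i"
    using \<phi>(1) \<psi>(1) iF \<sigma>\<tau>(2) \<psi>i by (simp_all add: tower_def)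
  have "conjugate ((\<phi> i \<circ> \<sigma> i) ` C) (\<phi> d a) ((\<phi> i \<circ> \<sigma> i) a)"
    by (rule conjugate_agree[OF \<phi>(2)[OF dF] aut_comp[OF \<phi>(2)[OF iF] \<sigma>i]])
      (use \<phi>(3)[OF succ_leq[OF i]] \<phi>_succ C(1) in auto)
  then have "conjugate (\<phi> i ` \<sigma> i ` C) (\<phi> i (\<sigma> i a)) (\<phi> d a)"
    by (simp add: image_comp conjugate_sym)
  moreover have "conjugate (\<phi> i ` \<sigma> i ` C) (\<phi> d a) (\<psi> d a)"
    by (rule conjugate_mono[OF conj(1)]) (use conj(2) C(2) in blast)
  moreover have "conjugate (\<phi> i ` \<sigma> i ` C) (\<psi> d a) (\<phi> i a)"
    by (rule conjugate_agree[OF \<psi>(2)[OF dF] \<phi>(2)[OF iF]])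
      (use \<psi>(3)[OF succ_leq[OF i]] \<psi>_succ C(2) in auto)
  ultimately have "conjugate (\<phi> i ` \<sigma> i ` C) (\<phi> i (\<sigma> i a)) (\<phi> i a)"
    using conjugate_trans by blast
  from conjugate_inv_image[OF \<phi>(2)[OF iF] this] show ?thesis
    by (simp add: \<phi>(2)[OF iF])
qed

end

section \<open>Stable homogeneous models\<close>

sublocale homogeneous_model \<subseteq> short: homogeneous_chain K \<kappa> B \<kappa> ..

sublocale homogeneous_model \<subseteq> long: homogeneous_chain K \<kappa> B "cardSuc \<kappa>" ..

definition (in homogeneous_model) realizes_types ::
    "('a, 'f, 'r) struct \<Rightarrow> ('a, 'f, 'r) struct \<Rightarrow> bool" where
  "realizes_types N M \<longleftrightarrow> (\<forall>b\<in>carrier B. \<exists>c\<in>carrier N. conjugate (carrier M) c b)"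

lemma (in homogeneous_chain) emb_of_realizing_chain_onto:
  assumes M: "submodel_chain M" "\<And>i. i \<in> Field r \<Longrightarrow> realizes_types (M (succ i)) (M i)"
    and e: "e ` Field r \<subseteq> carrier B"
  obtains f where "emb f (union_struct (M ` Field r)) B" "fixes_pointwise f (M zero)"
    "e ` Field r \<subseteq> f ` carrier (union_struct (M ` Field r))"
proof -
  obtain \<phi> where \<phi>: "\<phi> zero = id" "\<And>i. i \<in> Field r \<Longrightarrow> aut (\<phi> i)"
    "\<And>i j x. (i, j) \<in> r \<Longrightarrow> x \<in> carrier (M i) \<Longrightarrow> \<phi> j x = \<phi> i x"
    "\<And>i. i \<in> Field r \<Longrightarrow> e i \<in> \<phi> (succ i) ` carrier (M (succ i))"
  proof (rule automorphism_chain[OF M(1) aut_id, where Q = "\<lambda>_ _. True"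
        and St = "\<lambda>i \<phi> \<psi>. e i \<in> \<psi> ` carrier (M (succ i))"])
    show "\<exists>\<psi>. aut \<psi> \<and> True \<and> (\<forall>x\<in>carrier (M i). \<psi> x = \<phi> x) \<and> e i \<in> \<psi> ` carrier (M (succ i))"
      if i: "i \<in> Field r" and \<phi>: "aut \<phi>" for i \<phi>
    proof -
      have "inv \<phi> (e i) \<in> carrier B"
        using aut_in_B[OF aut_inv[OF \<phi>]] e i by blast
      then obtain c where c: "c \<in> carrier (M (succ i))" "conjugate (carrier (M i)) c (inv \<phi> (e i))"
        using M(2)[OF i] by (auto simp: realizes_types_def)
      obtain \<rho> where \<rho>: "aut \<rho>" "\<forall>x\<in>carrier (M i). \<rho> x = x" "\<rho> c = inv \<phi> (e i)"
        by (rule conjugateE[OF c(2)])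
      have "e i = (\<phi> \<circ> \<rho>) c"
        using \<rho>(3) \<phi> by simp
      then have "e i \<in> (\<phi> \<circ> \<rho>) ` carrier (M (succ i))"
        using c(1) by (rule image_eqI)
      then show ?thesis
        using aut_comp[OF \<phi> \<rho>(1)] \<rho>(2) by (intro exI[of _ "\<phi> \<circ> \<rho>"]) simp
    qed
  qed (rule TrueI, rule TrueI, rule that)
  let ?f = "glued M \<phi> (Field r)"
  have f: "emb ?f (union_struct (M ` Field r)) B" "\<And>i x. i \<in> Field r \<Longrightarrow> x \<in> carrier (M i) \<Longrightarrow> ?f x = \<phi> i x"
    using emb_glued_auts[OF M(1) limit_set_Field, of \<phi>] \<phi>(2,3) by simp_all
  have "e i \<in> ?f ` carrier (union_struct (M ` Field r))" if i: "i \<in> Field r" for i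
  proof -
    have "\<phi> (succ i) ` carrier (M (succ i)) = ?f ` carrier (M (succ i))"
      using f(2)[OF succ_in_Field[OF i]] by simp
    then show ?thesis
      using \<phi>(4)[OF i] succ_in_Field[OF i] by auto
  qed
  moreover have "fixes_pointwise ?f (M zero)"
    using f(2)[OF zero_in_Field] \<phi>(1) by (simp add: fixes_pointwise_def)
  ultimately show ?thesis
    using that f(1) by blast
qed

locale stable_homogeneous_model = homogeneous_model K \<kappa> B
  for K :: "('a, 'f, 'r) aclass" and \<kappa> :: "'c rel" and B +
  assumes stable: "stable_in K \<kappa>"
begin

lemma card_gtp_image:
  assumes "P \<in> K\<^sub>\<kappa>" "P \<preceq>\<^bsub>K\<^esub> B" "A \<subseteq> carrier B"
  shows "|(\<lambda>b. gtp K b P B) ` A| \<le>o \<kappa>"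
proof -
  have "(\<lambda>b. gtp K b P B) ` A \<subseteq> gS K P"
    using assms(2,3) by (auto simp: gS_def)
  moreover have "|gS K P| \<le>o \<kappa>"
    using stable assms(1) by (simp add: stable_in_def)
  ultimately show ?thesis
    by (rule ordLeq_transitive[OF card_of_mono1])
qed

lemma submodel_realizing_types:
  assumes M: "M \<in> K\<^sub>\<kappa>" "M \<preceq>\<^bsub>K\<^esub> B"
  obtains N where "N \<in> K\<^sub>\<kappa>" "M \<preceq>\<^bsub>K\<^esub> N" "N \<preceq>\<^bsub>K\<^esub> B" "realizes_types N M"
proof -
  let ?tp = "\<lambda>b. gtp K b M B"
  define rep where "rep = inv_into (carrier B) ?tp"
  have rep: "rep p \<in> carrier B" "?tp (rep p) = p" if "p \<in> ?tp ` carrier B" for p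
    using inv_into_into[OF that] f_inv_into_f[OF that] by (simp_all add: rep_def)
  have "|rep ` ?tp ` carrier B| \<le>o \<kappa>"
    by (intro card_image card_gtp_image M subset_refl)
  moreover have "rep ` ?tp ` carrier B \<subseteq> carrier B"
    using rep(1) by blast
  ultimately obtain N where N: "N \<in> K\<^sub>\<kappa>" "M \<preceq>\<^bsub>K\<^esub> N" "N \<preceq>\<^bsub>K\<^esub> B" "rep ` ?tp ` carrier B \<subseteq> carrier N"
    using submodel_containing[OF M, of "rep ` ?tp ` carrier B"] by metis
  have "conjugate (carrier M) (rep (?tp b)) b" if "b \<in> carrier B" for b
    using rep[of "?tp b"] gtp_eq_iff_conjugate[OF M, of "rep (?tp b)" b] that by simp
  then have "realizes_types N M"
    using N(4) unfolding realizes_types_def by blast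
  then show ?thesis
    using that N by blast
qed

lemma universal_over_chain_union:
  assumes M: "short.submodel_chain M"
    "\<And>i. i \<in> Field \<kappa> \<Longrightarrow> realizes_types (M (short.succ i)) (M i)"
  shows "universal_over K (union_struct (M ` Field \<kappa>)) (M short.zero)"
  unfolding universal_over_def
proof (intro conjI ballI impI)
  let ?U = "union_struct (M ` Field \<kappa>)"
  have U: "?U \<in> K\<^sub>\<kappa>"
    by (rule short.chain_union_of_card[OF short.limit_set_Field card_Field_leq])
      (use short.submodel_chainD(2,4)[OF M(1)] in blast)+
  have M0: "M short.zero \<in> K\<^sub>\<kappa>" "M short.zero \<preceq>\<^bsub>K\<^esub> B"
    using short.submodel_chainD(2,3)[OF M(1) short.zero_in_Field] .
  show M0U: "M short.zero \<preceq>\<^bsub>K\<^esub> ?U"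
    using short.le_chain_union[OF short.limit_set_Field short.submodel_chainD(4)[OF M(1)] short.zero_in_Field] .
  show "|carrier ?U| =o |carrier (M short.zero)|"
    by (rule models_of_card_same_card[OF U M0(1)])
  fix N assume N: "N \<in> models_of_card K |carrier (M short.zero)|" "M short.zero \<preceq>\<^bsub>K\<^esub> N"
  have NK: "N \<in> K\<^sub>\<kappa>"
    using N(1) models_of_cardD(2)[OF M0(1)] ordIso_transitive unfolding models_of_card_def by blast
  obtain g where g: "emb g N B" "fixes_pointwise g (M short.zero)"
    using extension_embeds[OF M0 NK N(2)] by blast
  obtain e where e: "e ` Field \<kappa> = carrier (g \<bullet> N)"
    by (rule models_of_card_enumeration[OF models_of_card_image[OF NK embD(3)[OF g(1)]] card_order])
  obtain f where f: "emb f ?U B" "fixes_pointwise f (M short.zero)" "carrier (g \<bullet> N) \<subseteq> f ` carrier ?U"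
    using short.emb_of_realizing_chain_onto[OF M, of e] leD(4)[OF embD(5)[OF g(1)]] e by metis
  let ?f' = "inv_into (carrier ?U) f"
  have "emb (?f' \<circ> g) N ?U"
    by (rule emb_comp[OF emb_image[OF embD(1,3)[OF g(1)]] emb_inv_into[OF f(1) embD(5)[OF g(1)] f(3)]])
  moreover have "?f' x = x" if "x \<in> carrier (M short.zero)" for x
    using inv_into_f_f[OF embD(3)[OF f(1)], of x] f(2) leD(4)[OF M0U] that
    by (auto simp: fixes_pointwise_def)
  then have "fixes_pointwise (?f' \<circ> g) (M short.zero)"
    using g(2) by (simp add: fixes_pointwise_def)
  ultimately show "\<exists>f. emb f N ?U \<and> fixes_pointwise f (M short.zero)"
    by blast
qed

lemma universal_extension:
  assumes M0: "M0 \<in> K\<^sub>\<kappa>" "M0 \<preceq>\<^bsub>K\<^esub> B"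
  obtains M1 where "M1 \<in> K\<^sub>\<kappa>" "M0 \<preceq>\<^bsub>K\<^esub> M1" "M1 \<preceq>\<^bsub>K\<^esub> B" "universal_over K M1 M0"
proof -
  obtain M where M: "short.continuous_chain M" "M short.zero = M0" "\<And>i. i \<in> Field \<kappa> \<Longrightarrow> M i \<preceq>\<^bsub>K\<^esub> B"
    "\<And>i. i \<in> Field \<kappa> \<Longrightarrow> realizes_types (M (short.succ i)) (M i)"
  proof (rule short.model_chain[of M0 "\<lambda>M. M \<preceq>\<^bsub>K\<^esub> B" "\<lambda>_ M M'. realizes_types M' M"])
    show "\<exists>M'\<in>K\<^sub>\<kappa>. M \<preceq>\<^bsub>K\<^esub> M' \<and> M' \<preceq>\<^bsub>K\<^esub> B \<and> realizes_types M' M" if "M \<in> K\<^sub>\<kappa>" "M \<preceq>\<^bsub>K\<^esub> B" for M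
      using submodel_realizing_types[OF that] by metis
  qed (use M0 in simp_all)
  let ?U = "union_struct (M ` Field \<kappa>)"
  have univ: "universal_over K ?U M0"
    using universal_over_chain_union[of M] M by (simp add: short.submodel_chain_def)
  then have "M0 \<preceq>\<^bsub>K\<^esub> ?U" "|carrier ?U| =o |carrier M0|"
    by (simp_all add: universal_over_def)
  then have "?U \<in> K\<^sub>\<kappa>"
    using models_of_card_extension[OF M0(1)] ordIso_ordLeq_trans[OF _ card_model[OF M0(1)]] by blast
  moreover have "?U \<preceq>\<^bsub>K\<^esub> B"
    by (rule short.chain_union_le[OF short.limit_set_Field short.continuous_chainD(2)[OF M(1)] M(3)])
  ultimately show ?thesis
    using that univ \<open>M0 \<preceq>\<^bsub>K\<^esub> ?U\<close> by blast
qed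

end

lemma (in aec_card) exists_least_large_Pow:
  obtains d where "d \<in> Field (cardSuc \<kappa>)" "\<not> |Pow (long.underS d)| \<le>o \<kappa>"
    "\<And>i. i \<in> long.underS d \<Longrightarrow> |Pow (long.underS i)| \<le>o \<kappa>"
proof -
  let ?r = "cardSuc \<kappa>"
  let ?D = "{d \<in> Field ?r. \<not> |Pow (long.underS d)| \<le>o \<kappa>}"
  have "Well_order \<kappa>"
    using card_order by (simp add: card_order_on_def)
  then obtain d0 where d0: "d0 \<in> Field ?r" "\<kappa> =o Restr ?r (long.underS d0)"
    using cardSuc_greater[OF card_order] ordLess_iff_ordIso_Restr[OF long.WELL] by blast
  have "Field (Restr ?r (long.underS d0)) = long.underS d0"
    by (rule Refl_Field_Restr2[OF long.REFL Order_Relation.underS_Field])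
  then have "|Field \<kappa>| =o |long.underS d0|"
    using card_of_cong[OF d0(2)] by simp
  then have "\<kappa> =o |long.underS d0|"
    using card_of_Field_ordIso[OF card_order] ordIso_symmetric ordIso_transitive by blast
  then have "\<kappa> <o |Pow (long.underS d0)|"
    using card_of_Pow ordIso_ordLess_trans by blast
  then have D: "?D \<subseteq> Field ?r" "?D \<noteq> {}"
    using d0(1) not_ordLess_ordLeq by blast+
  let ?d = "long.minim ?D"
  have d: "?d \<in> ?D"
    by (rule long.minim_in[OF D])
  have "|Pow (long.underS i)| \<le>o \<kappa>" if i: "i \<in> long.underS ?d" for i
  proof (rule ccontr)
    assume "\<not> |Pow (long.underS i)| \<le>o \<kappa>"
    then have "(?d, i) \<in> ?r"
      using long.minim_least[OF D(1)] long.underS_FieldD(1)[OF i] by simp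
    then show False
      using long.leq_iff_not_underS[of ?d i] long.underS_FieldD[OF i] i by simp
  qed
  then show ?thesis
    using that d by blast
qed

lemma (in homogeneous_chain) twisted_towers:
  assumes M: "submodel_chain M" and d: "d \<in> Field r"
    and \<sigma>: "\<And>i. i \<in> underS d \<Longrightarrow> aut (\<sigma> i)" "\<And>i. i \<in> underS d \<Longrightarrow> fixes_pointwise (\<sigma> i) (M i)"
    and C: "\<And>i. i \<in> underS d \<Longrightarrow> C i \<subseteq> carrier (M (succ i))"
      "\<And>i. i \<in> underS d \<Longrightarrow> \<sigma> i ` C i \<subseteq> carrier (M (succ i))"
    and split: "\<And>i. i \<in> underS d \<Longrightarrow> \<not> conjugate (\<sigma> i ` C i) (\<sigma> i a) a"
  obtains \<phi> where "\<And>A i. i \<in> Field r \<Longrightarrow> aut (\<phi> A i)"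
    "\<And>A i. i \<in> Field r \<Longrightarrow> \<phi> (A \<inter> underS i) i = \<phi> A i"
    "\<And>A A' i D. i \<in> underS d \<Longrightarrow> i \<in> A \<Longrightarrow> i \<notin> A' \<Longrightarrow> A \<inter> underS i = A' \<inter> underS i \<Longrightarrow>
      \<phi> A i ` carrier (M (succ i)) \<subseteq> D \<Longrightarrow> \<not> conjugate D (\<phi> A d a) (\<phi> A' d a)"
proof -
  define twist where "twist A i = (if i \<in> A \<inter> underS d then \<sigma> i else id)" for A i
  have "aut (twist A i)" "fixes_pointwise (twist A i) (M i)" for A i
    using \<sigma>[of i] aut_id by (simp_all add: twist_def fixes_pointwise_def)
  then have "\<exists>\<phi>. tower M (twist A) \<phi> \<and> (\<forall>i\<in>Field r. aut (\<phi> i)) \<and>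
      (\<forall>i j. (i, j) \<in> r \<longrightarrow> (\<forall>x\<in>carrier (M i). \<phi> j x = \<phi> i x))" for A
    using tower_exists[OF M, of "twist A"] by metis
  then obtain \<phi> where tower: "\<And>A. tower M (twist A) (\<phi> A)"
    and aut: "\<And>A i. i \<in> Field r \<Longrightarrow> aut (\<phi> A i)"
    and coherent: "\<And>A i j x. (i, j) \<in> r \<Longrightarrow> x \<in> carrier (M i) \<Longrightarrow> \<phi> A j x = \<phi> A i x"
    by metis
  show ?thesis
  proof (rule that[of \<phi>])
    show "\<phi> (A \<inter> underS i) i = \<phi> A i" if "i \<in> Field r" for A i
      by (rule tower_unique[OF tower tower that]) (simp add: twist_def)
    show "\<not> conjugate D (\<phi> A d a) (\<phi> A' d a)"
      if i: "i \<in> underS d" "i \<in> A" "i \<notin> A'" and below: "A \<inter> underS i = A' \<inter> underS i"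
        and D: "\<phi> A i ` carrier (M (succ i)) \<subseteq> D" for A A' i D
    proof
      assume conj: "conjugate D (\<phi> A d a) (\<phi> A' d a)"
      have twist_i: "twist A i = \<sigma> i" "twist A' i = id"
        using i by (simp_all add: twist_def)
      have "twist A j = twist A' j" if "j \<in> underS i" for j
        using below that by (auto simp: twist_def)
      then have "conjugate (twist A i ` C i) (twist A i a) a"
        using conjugate_branches[OF M i(1) tower[of A] aut[of _ A] coherent[of _ _ _ A]
            tower[of A'] aut[of _ A'] coherent[of _ _ _ A'], of "C i" D a]
          C[OF i(1)] \<sigma>(1)[OF i(1)] twist_i conj D by simp
      then show False
        using split[OF i(1)] twist_i(1) by simp
    qed
  qed (rule aut)
qed

context stable_homogeneous_model begin

lemma card_Pow_leq_of_branching: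
  assumes P: "P \<in> K\<^sub>\<kappa>" "P \<preceq>\<^bsub>K\<^esub> B" and c: "\<And>A. c A \<in> carrier B"
    and branch: "\<And>A A' i. i \<in> long.underS d \<Longrightarrow> i \<in> A \<Longrightarrow> i \<notin> A' \<Longrightarrow>
      A \<inter> long.underS i = A' \<inter> long.underS i \<Longrightarrow> \<not> conjugate (carrier P) (c A) (c A')"
  shows "|Pow (long.underS d)| \<le>o \<kappa>"
proof -
  have "inj_on (\<lambda>A. gtp K (c A) P B) (Pow (long.underS d))"
  proof (rule inj_onI, rule ccontr)
    fix A A'
    assume A: "A \<in> Pow (long.underS d)" "A' \<in> Pow (long.underS d)" "A \<noteq> A'"
      and "gtp K (c A) P B = gtp K (c A') P B"
    then have conj: "conjugate (carrier P) (c A) (c A')" "conjugate (carrier P) (c A') (c A)"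
      using gtp_eq_iff_conjugate[OF P c c] conjugate_sym by blast+
    have "A \<subseteq> Field (cardSuc \<kappa>)" "A' \<subseteq> Field (cardSuc \<kappa>)"
      using A(1,2) long.underS_FieldD(1) by blast+
    then obtain i where i: "i \<in> A \<union> A'" "i \<in> A \<longleftrightarrow> i \<notin> A'" "A \<inter> long.underS i = A' \<inter> long.underS i"
      using A(3) by (rule long.least_difference)
    then have "i \<in> long.underS d"
      using A by blast
    then show False
      using branch[of i A A'] branch[of i A' A] i(2,3) conj by auto
  qed
  then have "|Pow (long.underS d)| \<le>o |(\<lambda>A. gtp K (c A) P B) ` Pow (long.underS d)|"
    unfolding card_of_ordLeq[symmetric] by blast
  moreover have "(\<lambda>A. gtp K (c A) P B) ` Pow (long.underS d) = (\<lambda>b. gtp K b P B) ` c ` Pow (long.underS d)"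
    by (simp add: image_image)
  moreover have "|(\<lambda>b. gtp K b P B) ` c ` Pow (long.underS d)| \<le>o \<kappa>"
    by (rule card_gtp_image[OF P]) (use c in blast)
  ultimately show ?thesis
    using ordLeq_transitive by simp
qed

lemma submodel_containing_images:
  assumes M: "long.submodel_chain M" and d: "d \<in> Field (cardSuc \<kappa>)"
    and small: "\<And>i. i \<in> long.underS d \<Longrightarrow> |Pow (long.underS i)| \<le>o \<kappa>"
    and \<phi>: "\<And>A i. i \<in> long.underS d \<Longrightarrow> aut (\<phi> A i)"
  obtains P where "P \<in> K\<^sub>\<kappa>" "P \<preceq>\<^bsub>K\<^esub> B"
    "\<forall>i\<in>long.underS d. \<forall>A. \<phi> (A \<inter> long.underS i) i ` carrier (M (long.succ i)) \<subseteq> carrier P"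
proof -
  note MD = long.submodel_chainD[OF M]
  have iS: "long.succ i \<in> Field (cardSuc \<kappa>)" if "i \<in> long.underS d" for i
    by (rule long.succ_in_Field[OF long.underS_FieldD(1)[OF that]])
  let ?S = "\<Union>i\<in>long.underS d. \<Union>A\<in>Pow (long.underS i). \<phi> A i ` carrier (M (long.succ i))"
  have "\<phi> A i ` carrier (M (long.succ i)) \<subseteq> carrier B" if "i \<in> long.underS d" for A i
    by (rule embD(4)[OF aut_emb[OF \<phi>[OF that] MD(3)[OF iS[OF that]]]])
  then have "?S \<subseteq> carrier B"
    by blast
  moreover have "|?S| \<le>o \<kappa>"
    by (intro card_UN[OF long.card_underS[OF d]] card_UN[OF small] card_image card_model MD(2) iS)
  ultimately obtain P where P: "P \<in> K\<^sub>\<kappa>" "P \<preceq>\<^bsub>K\<^esub> B" "?S \<subseteq> carrier P"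
    by (rule submodel_containing[OF MD(2)[OF long.zero_in_Field] MD(3)[OF long.zero_in_Field]])
  have "\<phi> (A \<inter> long.underS i) i ` carrier (M (long.succ i)) \<subseteq> ?S" if "i \<in> long.underS d" for i A
    using that by blast
  then show ?thesis
    using that[OF P(1,2)] subset_trans[OF _ P(3)] by simp
qed

lemma card_Pow_underS_leq:
  assumes M: "long.submodel_chain M" and d: "d \<in> Field (cardSuc \<kappa>)"
    and small: "\<And>i. i \<in> long.underS d \<Longrightarrow> |Pow (long.underS i)| \<le>o \<kappa>"
    and a: "a \<in> carrier B"
    and splits: "\<And>i. i \<in> long.underS d \<Longrightarrow> \<not> nonsplit a (M (long.succ i)) (M i)"
  shows "|Pow (long.underS d)| \<le>o \<kappa>"
proof -
  have "\<exists>C \<sigma>. aut \<sigma> \<and> fixes_pointwise \<sigma> (M i) \<and> C \<subseteq> carrier (M (long.succ i)) \<and>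
      \<sigma> ` C \<subseteq> carrier (M (long.succ i)) \<and> \<not> conjugate (\<sigma> ` C) (\<sigma> a) a" if i: "i \<in> long.underS d" for i
  proof -
    obtain N \<sigma> where "N \<preceq>\<^bsub>K\<^esub> M (long.succ i)" "aut \<sigma>" "fixes_pointwise \<sigma> (M i)"
      "\<sigma> ` carrier N \<subseteq> carrier (M (long.succ i))" "\<not> conjugate (\<sigma> ` carrier N) (\<sigma> a) a"
      using splits[OF i] unfolding nonsplit_def by blast
    then show ?thesis
      using leD(4) by (intro exI[of _ "carrier N"] exI[of _ \<sigma>]) simp
  qed
  then obtain C \<sigma> where witness: "\<And>i. i \<in> long.underS d \<Longrightarrow> aut (\<sigma> i) \<and> fixes_pointwise (\<sigma> i) (M i) \<and>
      C i \<subseteq> carrier (M (long.succ i)) \<and> \<sigma> i ` C i \<subseteq> carrier (M (long.succ i)) \<and>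
      \<not> conjugate (\<sigma> i ` C i) (\<sigma> i a) a"
    by metis
  obtain \<phi> where \<phi>: "\<And>A i. i \<in> Field (cardSuc \<kappa>) \<Longrightarrow> aut (\<phi> A i)"
      "\<And>A i. i \<in> Field (cardSuc \<kappa>) \<Longrightarrow> \<phi> (A \<inter> long.underS i) i = \<phi> A i"
    and branch: "\<And>A A' i D. i \<in> long.underS d \<Longrightarrow> i \<in> A \<Longrightarrow> i \<notin> A' \<Longrightarrow>
      A \<inter> long.underS i = A' \<inter> long.underS i \<Longrightarrow> \<phi> A i ` carrier (M (long.succ i)) \<subseteq> D \<Longrightarrow>
      \<not> conjugate D (\<phi> A d a) (\<phi> A' d a)"
  proof (rule long.twisted_towers[OF M d, of \<sigma> C a])
    fix i assume "i \<in> long.underS d"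
    from witness[OF this] show "aut (\<sigma> i)" "fixes_pointwise (\<sigma> i) (M i)" "C i \<subseteq> carrier (M (long.succ i))"
      "\<sigma> i ` C i \<subseteq> carrier (M (long.succ i))" "\<not> conjugate (\<sigma> i ` C i) (\<sigma> i a) a"
      by simp_all
  qed (rule that)
  obtain P where P: "P \<in> K\<^sub>\<kappa>" "P \<preceq>\<^bsub>K\<^esub> B"
    "\<forall>i\<in>long.underS d. \<forall>A. \<phi> (A \<inter> long.underS i) i ` carrier (M (long.succ i)) \<subseteq> carrier P"
    using submodel_containing_images[OF M d small, of \<phi>] \<phi>(1) long.underS_FieldD(1) by metis
  have in_P: "\<phi> A i ` carrier (M (long.succ i)) \<subseteq> carrier P" if "i \<in> long.underS d" for A i
    using bspec[OF P(3) that] \<phi>(2)[OF long.underS_FieldD(1)[OF that]] by metis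
  show ?thesis
  proof (rule card_Pow_leq_of_branching[OF P(1,2), of "\<lambda>A. \<phi> A d a"])
    show "\<phi> A d a \<in> carrier B" for A
      by (simp add: aut_in_B[OF \<phi>(1)[OF d]] a)
  qed (rule branch[OF _ _ _ _ in_P])
qed

text \<open>
  Otherwise every element of \<open>B\<close> outside the \<open>d\<close>-th model of a universal chain, where
  \<open>2^|d| > \<kappa> \<ge> 2^|i|\<close> for \<open>i < d\<close>, splits at each stage below \<open>d\<close>, and the towers twisted at
  arbitrary subsets of \<open>d\<close> yield \<open>2^|d|\<close> types over a model of cardinality \<open>\<kappa>\<close>.
\<close>

lemma exists_nonsplit:
  assumes B_large: "cardSuc \<kappa> \<le>o |carrier B|"
  obtains M0 M1 a where "M0 \<in> K\<^sub>\<kappa>" "M1 \<in> K\<^sub>\<kappa>" "M0 \<preceq>\<^bsub>K\<^esub> B" "M1 \<preceq>\<^bsub>K\<^esub> B" "universal_over K M1 M0"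
    "a \<in> carrier B" "a \<notin> carrier M1" "nonsplit a M1 M0"
proof -
  have "\<kappa> \<le>o |carrier B|"
    by (rule ordLeq_transitive[OF cardSuc_ordLeq[OF card_order] B_large])
  then obtain M0 where M0: "M0 \<preceq>\<^bsub>K\<^esub> B" "M0 \<in> K\<^sub>\<kappa>"
    using LS_submodel_of_card[OF LS_le card_order B_model empty_subsetI]
      ordLeq_transitive[OF card_of_empty card_singleton] by metis
  obtain M where M: "long.continuous_chain M" "\<And>i. i \<in> Field (cardSuc \<kappa>) \<Longrightarrow> M i \<preceq>\<^bsub>K\<^esub> B"
    "\<And>i. i \<in> Field (cardSuc \<kappa>) \<Longrightarrow> universal_over K (M (long.succ i)) (M i)"
  proof (rule long.model_chain[of M0 "\<lambda>M. M \<preceq>\<^bsub>K\<^esub> B" "\<lambda>_ M M'. universal_over K M' M"])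
    show "\<exists>M'\<in>K\<^sub>\<kappa>. M \<preceq>\<^bsub>K\<^esub> M' \<and> M' \<preceq>\<^bsub>K\<^esub> B \<and> universal_over K M' M" if "M \<in> K\<^sub>\<kappa>" "M \<preceq>\<^bsub>K\<^esub> B" for M
      using universal_extension[OF that] by metis
  qed (use M0 in simp_all)
  obtain d where d: "d \<in> Field (cardSuc \<kappa>)" "\<not> |Pow (long.underS d)| \<le>o \<kappa>"
    "\<And>i. i \<in> long.underS d \<Longrightarrow> |Pow (long.underS i)| \<le>o \<kappa>"
    using exists_least_large_Pow by blast
  have "\<not> carrier B \<subseteq> carrier (M d)"
    using cardSuc_not_leq ordLeq_transitive[OF B_large ordLeq_transitive[OF card_of_mono1]]
      card_model[OF long.continuous_chainD(1)[OF M(1) d(1)]] by blast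
  then obtain a where a: "a \<in> carrier B" "a \<notin> carrier (M d)"
    by blast
  have "long.submodel_chain M"
    using M(1,2) by (simp add: long.submodel_chain_def)
  then obtain i where i: "i \<in> long.underS d" "nonsplit a (M (long.succ i)) (M i)"
    using card_Pow_underS_leq[OF _ d(1,3) a(1)] d(2) by blast
  have iF: "i \<in> Field (cardSuc \<kappa>)" "long.succ i \<in> Field (cardSuc \<kappa>)"
    using long.underS_FieldD(1)[OF i(1)] long.succ_in_Field by simp_all
  show ?thesis
  proof (rule that[of "M i" "M (long.succ i)" a])
    show "a \<notin> carrier (M (long.succ i))"
      using long.continuous_chainD(4)[OF M(1) long.succ_leq[OF i(1)]] a(2) by blast
  qed (use M(2,3) long.continuous_chainD(1)[OF M(1)] iF a(1) i(2) in simp_all)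
qed

end

section \<open>Maximal models of successor cardinality\<close>

locale maximal_model = aec_card K \<kappa> for K :: "('a, 'f, 'r) aclass" and \<kappa> :: "'c rel" +
  fixes B :: "('a, 'f, 'r) struct"
  assumes universe_cardSuc: "cardSuc (cardSuc \<kappa>) \<le>o |UNIV :: 'a set|"
    and amalgamation: "amalgamation_in K \<kappa>"
    and B: "B \<in> models_of_card K (cardSuc \<kappa>)"
    and maximal: "\<And>N. N \<in> models_of_card K (cardSuc \<kappa>) \<Longrightarrow> B \<preceq>\<^bsub>K\<^esub> N \<Longrightarrow> N = B"
begin

sublocale plus: aec_card K "cardSuc \<kappa>"
proof unfold_locales
  show "Card_order (cardSuc \<kappa>)"
    by (rule cardSuc_Card_order[OF card_order])
  show "LS K \<le>o cardSuc \<kappa>"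
    by (rule ordLeq_transitive[OF LS_le cardSuc_ordLeq[OF card_order]])
qed (rule universe_cardSuc)

lemma emb_onto:
  assumes f: "emb f B N"
  shows "f ` carrier B = carrier N"
proof -
  obtain \<pi> where \<pi>: "bij \<pi>" "\<And>x. x \<in> carrier B \<Longrightarrow> \<pi> x = f x" "B \<preceq>\<^bsub>K\<^esub> inv \<pi> \<bullet> N"
    using emb_extends_to_bij[OF infinite_UNIV plus.small[OF models_of_cardD(3)[OF B]] f] by blast
  have "x \<in> carrier B" if x: "x \<in> carrier (inv \<pi> \<bullet> N)" for x
  proof -
    obtain N' where "N' \<in> models_of_card K (cardSuc \<kappa>)" "B \<preceq>\<^bsub>K\<^esub> N'" "x \<in> carrier N'"
      by (rule plus.submodel_containing_element[OF B \<pi>(3) x])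
    then show ?thesis
      using maximal by blast
  qed
  then have "carrier B = inv \<pi> ` carrier N"
    using leD(4)[OF \<pi>(3)] by auto
  then have "\<pi> ` carrier B = carrier N"
    using \<pi>(1) by (simp add: image_image bij_is_surj surj_f_inv_f)
  then show ?thesis
    using \<pi>(2) by simp
qed

lemma filtration_B:
  assumes "M0 \<in> K\<^sub>\<kappa>" "M0 \<preceq>\<^bsub>K\<^esub> B"
  obtains M where "long.continuous_chain M" "M long.zero = M0" "\<And>i. i \<in> Field (cardSuc \<kappa>) \<Longrightarrow> M i \<preceq>\<^bsub>K\<^esub> B"
    "B = union_struct (M ` Field (cardSuc \<kappa>))"
proof (rule filtration[OF B assms, of "\<lambda>_ _. True"])
  show "\<exists>M'\<in>K\<^sub>\<kappa>. M \<preceq>\<^bsub>K\<^esub> M' \<and> M' \<preceq>\<^bsub>K\<^esub> B \<and> True" if "M \<in> K\<^sub>\<kappa>" "M \<preceq>\<^bsub>K\<^esub> B" for M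
    using that le_refl model_in_models by blast
qed (rule TrueI, rule that)

lemma extension_embeds_into_maximal:
  assumes M0: "M0 \<in> K\<^sub>\<kappa>" "M0 \<preceq>\<^bsub>K\<^esub> B" and N0: "N0 \<in> K\<^sub>\<kappa>" "M0 \<preceq>\<^bsub>K\<^esub> N0"
  shows "\<exists>g. emb g N0 B \<and> fixes_pointwise g M0"
proof -
  obtain M where M: "long.continuous_chain M" "M long.zero = M0" "B = union_struct (M ` Field (cardSuc \<kappa>))"
    using filtration_B[OF M0] by metis
  note MD = long.continuous_chainD[OF M(1)]
  have "emb id (M long.zero) N0"
    using M(2) N0(2) by (simp add: emb_id_iff)
  then obtain f N where fN: "N long.zero = N0" "\<And>x. x \<in> carrier (M long.zero) \<Longrightarrow> f x = id x"
    "\<And>i. i \<in> Field (cardSuc \<kappa>) \<Longrightarrow> N i \<in> K\<^sub>\<kappa> \<and> emb f (M i) (N i)"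
    "\<And>i j. (i, j) \<in> cardSuc \<kappa> \<Longrightarrow> N i \<preceq>\<^bsub>K\<^esub> N j"
  proof (rule long.embedding_chain[OF M(1), of "\<lambda>N. N \<in> K\<^sub>\<kappa>", OF N0(1)])
    show "\<exists>f' N'. N' \<in> K\<^sub>\<kappa> \<and> N \<preceq>\<^bsub>K\<^esub> N' \<and> emb f' (M (long.succ i)) N' \<and> (\<forall>x\<in>carrier (M i). f' x = f x)"
      if i: "i \<in> Field (cardSuc \<kappa>)" and N: "N \<in> K\<^sub>\<kappa>" "emb f (M i) N" for i f N
      using embedding_amalgamation[OF amalgamation MD(1)[OF i] MD(1)[OF long.succ_in_Field[OF i]]
          MD(2)[OF long.leq_succ[OF i]] N] by metis
    show "union_struct (N ` long.underS d) \<in> K\<^sub>\<kappa>"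
      if d: "limit_elem (cardSuc \<kappa>) d" and N: "\<And>i. i \<in> long.underS d \<Longrightarrow> N i \<in> K\<^sub>\<kappa>"
        "\<And>i j. (i, j) \<in> cardSuc \<kappa> \<Longrightarrow> j \<in> long.underS d \<Longrightarrow> N i \<preceq>\<^bsub>K\<^esub> N j" for d N
      by (rule long.chain_union_of_card[OF long.limit_set_underS[OF d] long.limit_elem_card_underS[OF d]])
        (use N in blast)+
  qed (rule that)
  let ?T = "union_struct (N ` Field (cardSuc \<kappa>))"
  have NT: "N i \<preceq>\<^bsub>K\<^esub> ?T" if "i \<in> Field (cardSuc \<kappa>)" for i
    by (rule long.le_chain_union[OF long.limit_set_Field fN(4) that])
  have emb_T: "emb f (M i) ?T" if "i \<in> Field (cardSuc \<kappa>)" for i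
    using fN(3)[OF that] emb_le NT[OF that] by blast
  have "emb f (union_struct (M ` Field (cardSuc \<kappa>))) ?T"
    by (rule long.emb_chain_union[OF long.limit_set_Field MD(2) emb_T])
  then have f: "emb f B ?T"
    using M(3) by simp
  have N0T: "N0 \<preceq>\<^bsub>K\<^esub> ?T"
    using NT[OF long.zero_in_Field] fN(1) by simp
  have "emb (inv_into (carrier B) f) N0 B"
    by (rule emb_inv_into[OF f N0T]) (use leD(4)[OF N0T] emb_onto[OF f] in simp)
  moreover have "inv_into (carrier B) f x = x" if "x \<in> carrier M0" for x
    using inv_into_f_f[OF embD(3)[OF f], of x] fN(2) M(2) leD(4)[OF M0(2)] that by auto
  ultimately show ?thesis
    by (auto simp: fixes_pointwise_def)
qed

lemma emb_into_maximal_extends: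
  assumes M: "M0 \<in> K\<^sub>\<kappa>" "M1 \<in> K\<^sub>\<kappa>" "M0 \<preceq>\<^bsub>K\<^esub> M1" and f: "emb f M0 B"
  shows "\<exists>f'. emb f' M1 B \<and> (\<forall>x\<in>carrier M0. f' x = f x)"
proof -
  have fM0: "f \<bullet> M0 \<in> K\<^sub>\<kappa>" "f \<bullet> M0 \<preceq>\<^bsub>K\<^esub> B"
    using models_of_card_image[OF M(1) embD(3)[OF f]] embD(5)[OF f] .
  obtain N f' where N: "N \<in> K\<^sub>\<kappa>" "f \<bullet> M0 \<preceq>\<^bsub>K\<^esub> N" "emb f' M1 N" "\<And>x. x \<in> carrier M0 \<Longrightarrow> f' x = f x"
    using embedding_amalgamation[OF amalgamation M fM0(1) emb_image[OF embD(1,3)[OF f]]] by blast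
  obtain g where g: "emb g N B" "fixes_pointwise g (f \<bullet> M0)"
    using extension_embeds_into_maximal[OF fM0 N(1,2)] by blast
  have "\<forall>x\<in>carrier M0. (g \<circ> f') x = f x"
    using N(4) g(2) by (simp add: fixes_pointwise_def)
  then show ?thesis
    using emb_comp[OF N(3) g(1)] by blast
qed

lemma self_emb_agrees_with_automorphism:
  assumes f: "emb f B B"
  shows "\<exists>\<sigma>. automorphism B \<sigma> \<and> (\<forall>x\<in>carrier B. \<sigma> x = f x)"
proof -
  define \<sigma> where "\<sigma> x = (if x \<in> carrier B then f x else x)" for x
  have "bij_betw f (carrier B) (carrier B)"
    using embD(3)[OF f] emb_onto[OF f] by (simp add: bij_betw_def)
  then have "bij_betw \<sigma> (carrier B \<union> - carrier B) (carrier B \<union> - carrier B)"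
    unfolding \<sigma>_def by (rule bij_betw_disjoint_Un[OF _ bij_betw_id[unfolded id_def]]) auto
  then have "bij \<sigma>"
    by simp
  moreover have "emb \<sigma> B B"
    by (rule emb_cong[OF f]) (simp add: \<sigma>_def)
  then have "\<sigma> \<bullet> B = B"
    using le_carrier_eqI[of "\<sigma> \<bullet> B" B] emb_onto[of \<sigma> B] by (simp add: emb_iff)
  ultimately show ?thesis
    by (auto simp: automorphism_def \<sigma>_def)
qed

lemma emb_into_maximal_extends_to_automorphism:
  assumes M0: "M0 \<in> K\<^sub>\<kappa>" "M0 \<preceq>\<^bsub>K\<^esub> B" and f0: "emb f0 M0 B"
  shows "\<exists>\<sigma>. automorphism B \<sigma> \<and> (\<forall>x\<in>carrier M0. \<sigma> x = f0 x)"
proof -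
  obtain M where M: "long.continuous_chain M" "M long.zero = M0" "B = union_struct (M ` Field (cardSuc \<kappa>))"
    using filtration_B[OF M0] by metis
  note MD = long.continuous_chainD[OF M(1)]
  have "emb f0 (M long.zero) B"
    using M(2) f0 by simp
  then obtain f N where f: "\<And>x. x \<in> carrier (M long.zero) \<Longrightarrow> f x = f0 x"
    "\<And>i. i \<in> Field (cardSuc \<kappa>) \<Longrightarrow> N i = B \<and> emb f (M i) (N i)"
  proof (rule long.embedding_chain[OF M(1), of "\<lambda>N. N = B", OF refl])
    show "\<exists>f' N'. N' = B \<and> N \<preceq>\<^bsub>K\<^esub> N' \<and> emb f' (M (long.succ i)) N' \<and> (\<forall>x\<in>carrier (M i). f' x = f x)"
      if i: "i \<in> Field (cardSuc \<kappa>)" and f: "N = B" "emb f (M i) N" for i f N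
      using emb_into_maximal_extends[OF MD(1)[OF i] MD(1)[OF long.succ_in_Field[OF i]]
          MD(2)[OF long.leq_succ[OF i]]] f le_refl[OF models_of_cardD(1)[OF B]] by blast
    show "union_struct (N ` long.underS d) = B"
      if d: "limit_elem (cardSuc \<kappa>) d" and N: "\<And>i. i \<in> long.underS d \<Longrightarrow> N i = B" for d N
    proof -
      have "N ` long.underS d = {B}"
        using d N by (auto simp: limit_elem_def)
      then show ?thesis
        using union_struct_singleton[OF model_is_struct[OF models_of_cardD(1)[OF B]]] by simp
    qed
  next
    fix f N
    assume "\<And>x. x \<in> carrier (M long.zero) \<Longrightarrow> f x = f0 x"
      "\<And>i. i \<in> Field (cardSuc \<kappa>) \<Longrightarrow> N i = B \<and> emb f (M i) (N i)"
    then show thesis by (rule that)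
  qed
  have "emb f (union_struct (M ` Field (cardSuc \<kappa>))) B"
    by (rule long.emb_chain_union[OF long.limit_set_Field MD(2)]) (use f(2) in auto)
  then have "emb f B B"
    using M(3) by simp
  then obtain \<sigma> where \<sigma>: "automorphism B \<sigma>" "\<forall>x\<in>carrier B. \<sigma> x = f x"
    using self_emb_agrees_with_automorphism by blast
  have "\<sigma> x = f0 x" if "x \<in> carrier M0" for x
    using \<sigma>(2) f(1)[unfolded M(2)] leD(4)[OF M0(2)] that by auto
  then show ?thesis
    using \<sigma>(1) by blast
qed

sublocale homogeneous_model K \<kappa> B
proof unfold_locales
  show "B \<in> models K"
    by (rule models_of_cardD(1)[OF B])
qed (rule extension_embeds_into_maximal emb_into_maximal_extends_to_automorphism; assumption)+

end

locale stable_maximal_model = maximal_model K \<kappa> B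
  for K :: "('a, 'f, 'r) aclass" and \<kappa> :: "'c rel" and B +
  assumes stable: "stable_in K \<kappa>"
begin

sublocale stable_homogeneous_model K \<kappa> B
  by unfold_locales (rule stable)

lemma universal_filtration:
  assumes M0: "M0 \<in> K\<^sub>\<kappa>" "M0 \<preceq>\<^bsub>K\<^esub> B"
  obtains M where "long.submodel_chain M" "M long.zero = M0"
    "\<And>i. i \<in> Field (cardSuc \<kappa>) \<Longrightarrow> universal_over K (M (long.succ i)) (M i)"
    "B = union_struct (M ` Field (cardSuc \<kappa>))"
proof -
  obtain M where M: "long.continuous_chain M" "M long.zero = M0" "\<And>i. i \<in> Field (cardSuc \<kappa>) \<Longrightarrow> M i \<preceq>\<^bsub>K\<^esub> B"
    "\<And>i. i \<in> Field (cardSuc \<kappa>) \<Longrightarrow> universal_over K (M (long.succ i)) (M i)"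
    "B = union_struct (M ` Field (cardSuc \<kappa>))"
  proof (rule filtration[OF B M0, of "\<lambda>M N. universal_over K N M"])
    show "\<exists>M'\<in>K\<^sub>\<kappa>. M \<preceq>\<^bsub>K\<^esub> M' \<and> M' \<preceq>\<^bsub>K\<^esub> B \<and> universal_over K M' M" if "M \<in> K\<^sub>\<kappa>" "M \<preceq>\<^bsub>K\<^esub> B" for M
      using universal_extension[OF that] by metis
    show "universal_over K M'' M"
      if "M \<in> K\<^sub>\<kappa>" "M'' \<in> K\<^sub>\<kappa>" "universal_over K M' M" "M' \<preceq>\<^bsub>K\<^esub> M''" for M M' M''
      by (rule universal_over_mono[OF that(3,4,1,2)])
  qed (rule that)
  moreover have "long.submodel_chain M"
    using M(1,3) by (simp add: long.submodel_chain_def)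
  ultimately show ?thesis
    using that by blast
qed

lemma nonsplit_continuous:
  assumes cont: "splitting_continuous_in K \<kappa>" and M: "long.submodel_chain M"
      "\<And>i. i \<in> Field (cardSuc \<kappa>) \<Longrightarrow> universal_over K (M (long.succ i)) (M i)"
    and d: "limit_elem (cardSuc \<kappa>) d" and a: "a \<in> carrier B" "a \<notin> carrier (M d)"
    and ns: "\<And>i. i \<in> long.underS d \<Longrightarrow> nonsplit a (M i) (M long.zero)"
  shows "nonsplit a (M d) (M long.zero)"
proof -
  note MD = long.submodel_chainD[OF M(1)]
  let ?p = "gtp K a (M d) B"
  have MdB: "M d \<preceq>\<^bsub>K\<^esub> B"
    by (rule MD(3)) (use d in \<open>simp add: limit_elem_def\<close>)
  have "cont_chain K \<kappa> (cardSuc \<kappa>) d M"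
    unfolding cont_chain_def using MD(2,4,6) by (auto simp: under_def Field_def)
  moreover have "\<forall>i\<in>long.underS d. universal_over K (M (long.succ i)) (M i)"
    using M(2) long.underS_FieldD(1) by blast
  moreover have "?p \<in> gS_na K (M d)"
    using MdB a unfolding gS_na_def by blast
  moreover have "\<not> splits_over K \<kappa> (restrict_type K ?p (M i)) (M i) (M long.zero)"
    if i: "i \<in> long.underS d" for i
    using restrict_gtp[OF MD(4)[OF long.underS_leq[OF i]] MdB a(1)]
      nonsplit_imp_not_splits_over[OF MD(3)[OF long.underS_FieldD(1)[OF i]] a(1) ns[OF i]] by simp
  ultimately have "\<not> splits_over K \<kappa> ?p (M d) (M long.zero)"
    using cont d unfolding splitting_continuous_in_def Let_def by blast
  then show ?thesis
    by (rule not_splits_over_imp_nonsplit[OF MdB a(1)])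
qed

text \<open>
  Here \<open>\<phi>\<close> stands for its restriction to \<open>N\<close>; the non-splitting clause allows one to extend that
  restriction to larger models without hitting \<open>b\<close>.
\<close>

definition omits :: "'a \<Rightarrow> ('a, 'f, 'r) struct \<Rightarrow> ('a \<Rightarrow> 'a) \<Rightarrow> ('a, 'f, 'r) struct \<Rightarrow> bool" where
  "omits b M \<phi> N \<longleftrightarrow> inv \<phi> b \<notin> carrier N \<and> nonsplit (inv \<phi> b) N M"

lemma omits_agree:
  assumes \<phi>: "aut \<phi>" "omits b M \<phi> N" and \<psi>: "aut \<psi>" "\<And>x. x \<in> carrier N \<Longrightarrow> \<psi> x = \<phi> x"
  shows "omits b M \<psi> N"
proof -
  have "conjugate (carrier N) (inv \<phi> b) (inv \<psi> b)"
    by (rule conjugateI[of "inv \<psi> \<circ> \<phi>"]) (use aut_comp aut_inv \<phi>(1) \<psi> in \<open>simp_all flip: \<psi>(2)\<close>)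
  then have "nonsplit (inv \<psi> b) N M"
    using \<phi>(2) nonsplit_conjugate by (auto simp: omits_def)
  moreover have "inv \<psi> b \<notin> carrier N"
  proof
    assume "inv \<psi> b \<in> carrier N"
    moreover from this have "\<phi> (inv \<psi> b) = b"
      using \<psi> by (metis aut_inv_simps(2))
    ultimately show False
      using \<phi> aut_inv_simps(1)[OF \<phi>(1), of "inv \<psi> b"] by (simp add: omits_def)
  qed
  ultimately show ?thesis
    by (simp add: omits_def)
qed

lemma omits_extension:
  assumes univ: "universal_over K N M" and M: "M \<in> K\<^sub>\<kappa>" and b: "b \<in> carrier B"
    and N: "N \<in> K\<^sub>\<kappa>" "N \<preceq>\<^bsub>K\<^esub> N'" and N': "N' \<in> K\<^sub>\<kappa>" "N' \<preceq>\<^bsub>K\<^esub> B"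
    and \<phi>: "aut \<phi>" "omits b M \<phi> N"
  shows "\<exists>\<psi>. aut \<psi> \<and> omits b M \<psi> N' \<and> (\<forall>x\<in>carrier N. \<psi> x = \<phi> x)"
proof -
  have "inv \<phi> b \<in> carrier B" "inv \<phi> b \<notin> carrier N" "nonsplit (inv \<phi> b) N M"
    using \<phi> b aut_in_B[OF aut_inv[OF \<phi>(1)]] by (simp_all add: omits_def)
  moreover have "M \<preceq>\<^bsub>K\<^esub> N'"
    using univ le_trans[OF _ N(2)] by (simp add: universal_over_def)
  ultimately obtain c where c: "c \<notin> carrier N'" "nonsplit c N' M" "conjugate (carrier N) (inv \<phi> b) c"
    using nonsplit_extension[OF univ M N(1) le_trans[OF N(2) N'(2)] _ _ _ N'(1) _ N'(2)] N(2) by metis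
  obtain \<rho> where \<rho>: "aut \<rho>" "\<forall>x\<in>carrier N. \<rho> x = x" "\<rho> c = inv \<phi> b"
    by (rule conjugateE[OF conjugate_sym[OF c(3)]])
  have aut: "aut (\<phi> \<circ> \<rho>)"
    by (rule aut_comp[OF \<phi>(1) \<rho>(1)])
  have "inv (\<phi> \<circ> \<rho>) b = c"
    using aut_inv_simps(1)[OF aut, of c] \<rho>(3) \<phi>(1) by simp
  then show ?thesis
    using aut c(1,2) \<rho>(2) by (intro exI[of _ "\<phi> \<circ> \<rho>"]) (simp add: omits_def)
qed

lemma omits_succ:
  assumes M: "long.submodel_chain M"
      "\<And>i. i \<in> Field (cardSuc \<kappa>) \<Longrightarrow> universal_over K (M (long.succ i)) (M i)"
    and b: "b \<in> carrier B" and i: "i \<in> Field (cardSuc \<kappa>)" "i \<noteq> long.zero"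
    and \<phi>: "aut \<phi>" "omits b (M long.zero) \<phi> (M i)"
  shows "\<exists>\<psi>. aut \<psi> \<and> omits b (M long.zero) \<psi> (M (long.succ i)) \<and> (\<forall>x\<in>carrier (M i). \<psi> x = \<phi> x)"
proof -
  note MD = long.submodel_chainD[OF M(1)] and iS = long.succ_in_Field[OF i(1)]
  have M0: "M long.zero \<in> K\<^sub>\<kappa>"
    by (rule MD(2)[OF long.zero_in_Field])
  have "(long.succ long.zero, i) \<in> cardSuc \<kappa>"
    using long.zero_leq[OF i(1)] long.leq_cases long.succ_leq i(2) by metis
  then have "universal_over K (M i) (M long.zero)"
    by (intro universal_over_mono[OF M(2)[OF long.zero_in_Field] MD(4) M0 MD(2)[OF i(1)]])
  then show ?thesis
    by (rule omits_extension[OF _ M0 b MD(2)[OF i(1)] MD(4)[OF long.leq_succ[OF i(1)]]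
          MD(2)[OF iS] MD(3)[OF iS] \<phi>])
qed

lemma omits_limit:
  assumes cont: "splitting_continuous_in K \<kappa>" and M: "long.submodel_chain M"
      "\<And>i. i \<in> Field (cardSuc \<kappa>) \<Longrightarrow> universal_over K (M (long.succ i)) (M i)"
    and b: "b \<in> carrier B" and d: "limit_elem (cardSuc \<kappa>) d" and \<phi>: "aut \<phi>"
    and below: "\<And>i. i \<in> long.underS d \<Longrightarrow> omits b (M long.zero) \<phi> (M i)"
  shows "omits b (M long.zero) \<phi> (M d)"
proof -
  have "inv \<phi> b \<in> carrier B"
    by (simp add: aut_in_B[OF aut_inv[OF \<phi>]] b)
  moreover have "inv \<phi> b \<notin> carrier (M d)"
    unfolding long.submodel_chainD(6)[OF M(1) d] using below by (simp add: omits_def)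
  ultimately have "nonsplit (inv \<phi> b) (M d) (M long.zero)"
    using nonsplit_continuous[OF cont M d] below by (simp add: omits_def)
  with \<open>inv \<phi> b \<notin> carrier (M d)\<close> show ?thesis
    by (simp add: omits_def)
qed

lemma omitting_chain:
  assumes cont: "splitting_continuous_in K \<kappa>" and M: "long.submodel_chain M"
      "\<And>i. i \<in> Field (cardSuc \<kappa>) \<Longrightarrow> universal_over K (M (long.succ i)) (M i)"
    and b: "b \<in> carrier B" "b \<notin> carrier (M (long.succ long.zero))"
      "nonsplit b (M (long.succ long.zero)) (M long.zero)"
  obtains \<phi> where "\<And>i. i \<in> Field (cardSuc \<kappa>) \<Longrightarrow> aut (\<phi> i)"
    "\<And>i. i \<in> Field (cardSuc \<kappa>) \<Longrightarrow> inv (\<phi> i) b \<notin> carrier (M i)"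
    "\<And>i j x. (i, j) \<in> cardSuc \<kappa> \<Longrightarrow> x \<in> carrier (M i) \<Longrightarrow> \<phi> j x = \<phi> i x"
proof -
  note MD = long.submodel_chainD[OF M(1)]
  let ?M0 = "M long.zero" and ?r = "cardSuc \<kappa>"
  let ?Q = "\<lambda>i \<phi>. omits b ?M0 \<phi> (M i) \<and> (i = long.zero \<longrightarrow> \<phi> = id)"
  have b_M1: "omits b ?M0 id (M (long.succ long.zero))"
    using b by (simp add: omits_def)
  obtain \<phi> where \<phi>: "\<And>i. i \<in> Field ?r \<Longrightarrow> aut (\<phi> i)" "\<And>i. i \<in> Field ?r \<Longrightarrow> ?Q i (\<phi> i)"
    "\<And>i j x. (i, j) \<in> ?r \<Longrightarrow> x \<in> carrier (M i) \<Longrightarrow> \<phi> j x = \<phi> i x"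
  proof (rule long.automorphism_chain[OF M(1) aut_id, where Q = ?Q and St = "\<lambda>_ _ _. True"])
    have "(long.zero, long.succ long.zero) \<in> ?r"
      by (rule long.leq_succ[OF long.zero_in_Field])
    then show "?Q long.zero id"
      using b_M1 MD(5) nonsplit_restrict[OF _ MD(4)] by (auto simp: omits_def)
    show "\<exists>\<psi>. aut \<psi> \<and> ?Q (long.succ i) \<psi> \<and> (\<forall>x\<in>carrier (M i). \<psi> x = \<phi> x) \<and> True"
      if i: "i \<in> Field ?r" and \<phi>: "aut \<phi>" "?Q i \<phi>" for i \<phi>
    proof (cases "i = long.zero")
      case True
      then show ?thesis
        using \<phi> b_M1 long.succ_neq_zero[OF i] by blast
    next
      case False
      then show ?thesis
        using omits_succ[OF M b(1) i _ \<phi>(1)] \<phi>(2) long.succ_neq_zero[OF i] by simp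
    qed
    show "?Q d \<psi>"
      if d: "limit_elem ?r d" and \<psi>: "aut \<psi>"
        and Q: "\<And>i. i \<in> long.underS d \<Longrightarrow> aut (\<phi> i) \<and> ?Q i (\<phi> i)"
        and agree: "\<And>i x. i \<in> long.underS d \<Longrightarrow> x \<in> carrier (M i) \<Longrightarrow> \<psi> x = \<phi> i x" for d \<phi> \<psi>
    proof
      have below: "omits b ?M0 \<psi> (M i)" if "i \<in> long.underS d" for i
        by (rule omits_agree[OF _ _ \<psi> agree[OF that]]) (use Q[OF that] in simp_all)
      show "omits b ?M0 \<psi> (M d)"
        by (rule omits_limit[OF cont M b(1) d \<psi> below])
    qed (use d long.zero_not_limit in blast)
  qed (rule that)
  show ?thesis
  proof (rule that[of \<phi>])
    show "inv (\<phi> i) b \<notin> carrier (M i)" if "i \<in> Field ?r" for i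
      using \<phi>(2)[OF that] by (simp add: omits_def)
  qed (rule \<phi>(1,3); assumption)+
qed

lemma not_splitting_continuous: "\<not> splitting_continuous_in K \<kappa>"
proof
  assume cont: "splitting_continuous_in K \<kappa>"
  let ?r = "cardSuc \<kappa>"
  obtain M0 M1 a where M0: "M0 \<in> K\<^sub>\<kappa>" "M1 \<in> K\<^sub>\<kappa>" "M0 \<preceq>\<^bsub>K\<^esub> B" "M1 \<preceq>\<^bsub>K\<^esub> B" "universal_over K M1 M0"
    and a: "a \<in> carrier B" "a \<notin> carrier M1" "nonsplit a M1 M0"
    by (rule exists_nonsplit[OF models_of_cardD(4)[OF B]])
  obtain M where M: "long.submodel_chain M" "M long.zero = M0"
    "\<And>i. i \<in> Field ?r \<Longrightarrow> universal_over K (M (long.succ i)) (M i)" "B = union_struct (M ` Field ?r)"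
    using universal_filtration[OF M0(1,3)] by metis
  note MD = long.submodel_chainD[OF M(1)]
  have one: "long.succ long.zero \<in> Field ?r"
    by (rule long.succ_in_Field[OF long.zero_in_Field])
  have "M0 \<preceq>\<^bsub>K\<^esub> M (long.succ long.zero)"
    using MD(4)[OF long.leq_succ[OF long.zero_in_Field]] M(2) by simp
  then obtain b where b: "b \<in> carrier B" "b \<notin> carrier (M (long.succ long.zero))"
    "nonsplit b (M (long.succ long.zero)) (M long.zero)"
    unfolding M(2) by (rule nonsplit_extension[OF M0(5,1,2,4) a MD(2)[OF one] _ MD(3)[OF one]])
  obtain \<phi> where \<phi>: "\<And>i. i \<in> Field ?r \<Longrightarrow> aut (\<phi> i)" "\<And>i. i \<in> Field ?r \<Longrightarrow> inv (\<phi> i) b \<notin> carrier (M i)"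
    "\<And>i j x. (i, j) \<in> ?r \<Longrightarrow> x \<in> carrier (M i) \<Longrightarrow> \<phi> j x = \<phi> i x"
  proof (rule omitting_chain[OF cont M(1,3) b])
  qed (assumption | rule that)+
  let ?f = "long.glued M \<phi> (Field ?r)"
  have f: "emb ?f B B" "\<And>i x. i \<in> Field ?r \<Longrightarrow> x \<in> carrier (M i) \<Longrightarrow> ?f x = \<phi> i x"
    using long.emb_glued_auts[OF M(1) long.limit_set_Field, of \<phi>] \<phi>(1,3) M(4) by simp_all
  obtain x where x: "x \<in> carrier B" "b = ?f x"
    using b(1) emb_onto[OF f(1)] by blast
  then obtain i where i: "i \<in> Field ?r" "x \<in> carrier (M i)"
    using arg_cong[OF M(4), of carrier] by auto
  then have "inv (\<phi> i) b = x"
    using f(2) \<phi>(1) x(2) by simp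
  then show False
    using \<phi>(2)[OF i(1)] i(2) by simp
qed

end

section \<open>Existence of a model\<close>

lemma (in aec_card) no_maximal_model_in_cardSuc:
  assumes "cardSuc (cardSuc \<kappa>) \<le>o |UNIV :: 'a set|" "amalgamation_in K \<kappa>" "stable_in K \<kappa>"
    and "splitting_continuous_in K \<kappa>"
  shows "no_maximal_model_in K (cardSuc \<kappa>)"
proof (rule ccontr)
  assume "\<not> no_maximal_model_in K (cardSuc \<kappa>)"
  then obtain B where "B \<in> models_of_card K (cardSuc \<kappa>)"
    "\<And>N. N \<in> models_of_card K (cardSuc \<kappa>) \<Longrightarrow> B \<preceq>\<^bsub>K\<^esub> N \<Longrightarrow> N = B"
    unfolding no_maximal_model_in_def by blast
  then interpret stable_maximal_model K \<kappa> B
    by unfold_locales (use assms(1-3) in auto)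
  show False
    using not_splitting_continuous assms(4) by blast
qed

theorem theorem3p6:
  fixes K :: "('a, 'f, 'r) aclass" and lam :: "'b rel"
  assumes "AEC K"
    and "Card_order lam" and "LS K \<le>o lam"
    and universe: "cardSuc (cardSuc lam) \<le>o |UNIV :: 'a set|"
    and nonempty: "models_of_card K lam \<noteq> {}"
    and "amalgamation_in K lam"
    and "no_maximal_model_in K lam"
    and "stable_in K lam"
    and "splitting_continuous_in K lam"
  shows "\<exists>M\<in>models K. |carrier M| =o cardSuc (cardSuc lam)"
proof -
  have card_Suc: "Card_order (cardSuc lam)"
    by (rule cardSuc_Card_order[OF assms(2)])
  interpret aec_card K lam
    by unfold_locales (use assms(1-3) ordLeq_transitive[OF cardSuc_ordLeq[OF card_Suc] assms(4)] in auto)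
  interpret plus: aec_card K "cardSuc lam"
    by unfold_locales
      (use card_Suc assms(4) ordLeq_transitive[OF assms(3) cardSuc_ordLeq[OF assms(2)]] in auto)
  have "models_of_card K (cardSuc lam) \<noteq> {}"
    by (rule model_of_cardSuc[OF assms(5,7)])
  moreover have "no_maximal_model_in K (cardSuc lam)"
    by (rule no_maximal_model_in_cardSuc[OF assms(4,6,8,9)])
  ultimately have "models_of_card K (cardSuc (cardSuc lam)) \<noteq> {}"
    by (rule plus.model_of_cardSuc)
  then show ?thesis
    by (auto simp: models_of_card_def)
qed

end
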